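(* Let $n,r\ge1$ and $q=t^2$. The Hilbert–Poincaré series of the cohomology of $\mathrm{Quot}_2(\mathcal{O}_{\mathbb{A}^n}^{\oplus r})$ is $$\sum_{i\ge0}\mathrm{rk}_{\mathbb{Z}}H^i\big(\mathrm{Quot}_2(\mathcal{O}_{\mathbb{A}^n}^{\oplus r}),\mathbb{Z}\big)\,t^i=\frac{(q^r-1)\cdot(q^{n+r}+q^{n+r-1}-q^r-1)}{(q-1)^2(q+1)}.$$
   Context: The base field is $\mathbb{C}$ and $H^*$ is singular cohomology. $\mathrm{Quot}_2(\mathcal{O}_{\mathbb{A}^n}^{\oplus r})$ is the Quot scheme of points parametrizing equivalence classes of surjections $\mathcal{O}_{\mathbb{A}^n}^{\oplus r}\twoheadrightarrow\mathcal{F}$ with $\mathcal{F}$ of finite length $2$. *)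

theory Defs
  imports
    "HOL-Homology.Homology"
    "HOL-Algebra.Module"
    "HOL-Library.Extended_Nat"
    "HOL-Computational_Algebra.Formal_Power_Series"
begin

section \<open>Complex points of the Quot scheme of points on affine space\<close>

text \<open>The polynomial ring \<open>\<complex>[x\<^sub>0, \<dots>, x\<^bsub>n-1\<^esub>]\<close>: a monomial is its exponent vector,
  a polynomial is the finitely supported function of its coefficients.\<close>

type_synonym mpoly = "(nat \<Rightarrow>\<^sub>0 nat) \<Rightarrow>\<^sub>0 complex"

definition coordinate_ring :: "nat \<Rightarrow> mpoly ring" where
  "coordinate_ring n =
     \<lparr>carrier = {p. \<forall>m \<in> Poly_Mapping.keys p. Poly_Mapping.keys m \<subseteq> {..<n}},
      monoid.mult = (*), one = 1, zero = 0, add = (+)\<rparr>"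

text \<open>The free module of rank \<open>r\<close>, i.e. the global sections of \<open>\<O>\<^sup>r\<close> on affine \<open>n\<close>-space.
  The multiplicative fields of the record play no role in the locale \<^locale>\<open>module\<close>.\<close>

definition free_module :: "nat \<Rightarrow> nat \<Rightarrow> (mpoly, nat \<Rightarrow>\<^sub>0 mpoly) module" where
  "free_module n r =
     \<lparr>carrier = {v. Poly_Mapping.keys v \<subseteq> {..<r} \<and>
                    (\<forall>j. Poly_Mapping.lookup v j \<in> carrier (coordinate_ring n))},
      monoid.mult = undefined, one = undefined, zero = 0, add = (+),
      smult = (\<lambda>p. Poly_Mapping.map ((*) p))\<rparr>"

definition has_quotient_length ::
    "('a, 'c) ring_scheme \<Rightarrow> ('a, 'b, 'd) module_scheme \<Rightarrow> 'b set \<Rightarrow> nat \<Rightarrow> bool" where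
  "has_quotient_length R M K d \<longleftrightarrow>
     (\<exists>N. N 0 = K \<and> N d = carrier M \<and> (\<forall>i\<le>d. submodule (N i) R M) \<and>
        (\<forall>i<d. N i \<subset> N (Suc i) \<and> \<not> (\<exists>P. submodule P R M \<and> N i \<subset> P \<and> P \<subset> N (Suc i))))"

text \<open>Finite length quotients of \<open>\<O>\<^sup>r\<close> on affine space are finite length quotients of the free
  module, and two surjections are equivalent iff their kernels coincide. So a point is a kernel.\<close>

definition quot_points :: "nat \<Rightarrow> nat \<Rightarrow> nat \<Rightarrow> (nat \<Rightarrow>\<^sub>0 mpoly) set set" where
  "quot_points d n r =
     {K. submodule K (coordinate_ring n) (free_module n r) \<and>
         has_quotient_length (coordinate_ring n) (free_module n r) K d}"

definition lincomb :: "nat \<Rightarrow> (nat \<Rightarrow> complex) \<Rightarrow> (nat \<Rightarrow> nat \<Rightarrow>\<^sub>0 mpoly) \<Rightarrow> nat \<Rightarrow>\<^sub>0 mpoly" where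
  "lincomb d c b = (\<Sum>i<d. Poly_Mapping.map ((*) (Poly_Mapping.single 0 (c i))) (b i))"

text \<open>The classes of \<open>b 0, \<dots>, b (d - 1)\<close> form a \<open>\<complex>\<close>-basis of the quotient by \<open>K\<close>.\<close>

definition quotient_basis ::
    "nat \<Rightarrow> nat \<Rightarrow> nat \<Rightarrow> (nat \<Rightarrow>\<^sub>0 mpoly) set \<Rightarrow> (nat \<Rightarrow> nat \<Rightarrow>\<^sub>0 mpoly) \<Rightarrow> bool" where
  "quotient_basis d n r K b \<longleftrightarrow>
     (\<forall>i<d. b i \<in> carrier (free_module n r)) \<and>
     (\<forall>v \<in> carrier (free_module n r).
        \<exists>!c. c \<in> {..<d} \<rightarrow>\<^sub>E UNIV \<and> v - lincomb d c b \<in> K)"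

text \<open>The analytic topology. For fixed \<open>b\<close>, the kernels for which \<open>b\<close> is a basis of the quotient
  form an affine open subscheme (where the tautological map from \<open>\<O>\<^sup>d\<close> given by \<open>b\<close> is an
  isomorphism), and these charts cover, as simple modules over the coordinate ring are
  one-dimensional over \<open>\<complex>\<close>. The coordinate ring of a chart is generated by the functions sending
  \<open>K\<close> to the coordinates \<open>c i\<close> of the class of \<open>v\<close> in the basis \<open>b\<close>, for \<open>v\<close> in the free module.
  The analytic topology is the coarsest one for which the charts are open and these functions
  are continuous on them.\<close>

definition quot_chart_open ::
    "nat \<Rightarrow> nat \<Rightarrow> nat \<Rightarrow> (nat \<Rightarrow> nat \<Rightarrow>\<^sub>0 mpoly) \<Rightarrow> (nat \<Rightarrow>\<^sub>0 mpoly) \<Rightarrow> (nat \<Rightarrow> complex set)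
      \<Rightarrow> (nat \<Rightarrow>\<^sub>0 mpoly) set set" where
  "quot_chart_open d n r b v W =
     {K \<in> quot_points d n r. quotient_basis d n r K b \<and>
        (\<exists>c. (\<forall>i<d. c i \<in> W i) \<and> v - lincomb d c b \<in> K)}"

definition quot_space :: "nat \<Rightarrow> nat \<Rightarrow> nat \<Rightarrow> (nat \<Rightarrow>\<^sub>0 mpoly) set topology" where
  "quot_space d n r = topology_generated_by
     {quot_chart_open d n r b v W | b v W. v \<in> carrier (free_module n r) \<and> (\<forall>i<d. open (W i))}"


section \<open>Singular cohomology with integer coefficients\<close>

definition cochain_group :: "nat \<Rightarrow> 'a topology \<Rightarrow> ('a chain \<Rightarrow> int) monoid" where
  "cochain_group p X =
     \<lparr>carrier = hom (free_Abelian_group (singular_simplex_set p X)) integer_group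
                  \<inter> extensional (singular_chain_set p X),
      monoid.mult = (\<lambda>\<phi> \<psi>. \<lambda>c \<in> singular_chain_set p X. \<phi> c + \<psi> c),
      one = (\<lambda>c \<in> singular_chain_set p X. 0)\<rparr>"

definition coboundary :: "nat \<Rightarrow> 'a topology \<Rightarrow> ('a chain \<Rightarrow> int) \<Rightarrow> ('a chain \<Rightarrow> int)" where
  "coboundary p X \<phi> = (\<lambda>c \<in> singular_chain_set (Suc p) X. \<phi> (chain_boundary (Suc p) c))"

definition cocycles :: "nat \<Rightarrow> 'a topology \<Rightarrow> ('a chain \<Rightarrow> int) set" where
  "cocycles p X =
     {\<phi> \<in> carrier (cochain_group p X). coboundary p X \<phi> = \<one>\<^bsub>cochain_group (Suc p) X\<^esub>}"

definition coboundaries :: "nat \<Rightarrow> 'a topology \<Rightarrow> ('a chain \<Rightarrow> int) set" where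
  "coboundaries p X =
     (case p of 0 \<Rightarrow> {\<one>\<^bsub>cochain_group 0 X\<^esub>}
        | Suc k \<Rightarrow> coboundary k X ` carrier (cochain_group k X))"

definition cohomology_group :: "nat \<Rightarrow> 'a topology \<Rightarrow> ('a chain \<Rightarrow> int) set monoid" where
  "cohomology_group p X = (cochain_group p X\<lparr>carrier := cocycles p X\<rparr>) Mod coboundaries p X"


section \<open>Rank of an abelian group\<close>

definition int_independent :: "('a, 'b) monoid_scheme \<Rightarrow> 'a set \<Rightarrow> bool" where
  "int_independent G S \<longleftrightarrow> finite S \<and> S \<subseteq> carrier G \<and>
     (\<forall>k :: 'a \<Rightarrow> int. finprod G (\<lambda>x. x [^]\<^bsub>G\<^esub> k x) S = \<one>\<^bsub>G\<^esub> \<longrightarrow> (\<forall>x\<in>S. k x = 0))"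

definition abelian_rank :: "('a, 'b) monoid_scheme \<Rightarrow> enat" where
  "abelian_rank G = (SUP S \<in> {S. int_independent G S}. enat (card S))"


section \<open>Well-definedness\<close>

lemma cring_coordinate_ring: "cring (coordinate_ring n)"
proof -
  have mult: "p * q \<in> carrier (coordinate_ring n)"
    if "p \<in> carrier (coordinate_ring n)" "q \<in> carrier (coordinate_ring n)" for p q
  proof -
    have "Poly_Mapping.keys m \<subseteq> {..<n}" if "m \<in> Poly_Mapping.keys (p * q)" for m
    proof -
      obtain a b where "m = a + b" "a \<in> Poly_Mapping.keys p" "b \<in> Poly_Mapping.keys q"
        using \<open>m \<in> Poly_Mapping.keys (p * q)\<close> keys_mult[of p q] by blast
      moreover from this have "Poly_Mapping.keys a \<subseteq> {..<n}" "Poly_Mapping.keys b \<subseteq> {..<n}"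
        using \<open>p \<in> _\<close> \<open>q \<in> _\<close> by (simp_all add: coordinate_ring_def)
      ultimately show ?thesis
        using Poly_Mapping.keys_add[of a b] by blast
    qed
    then show ?thesis by (simp add: coordinate_ring_def)
  qed
  have add: "p + q \<in> carrier (coordinate_ring n)"
    if "p \<in> carrier (coordinate_ring n)" "q \<in> carrier (coordinate_ring n)" for p q
    using that Poly_Mapping.keys_add[of p q] unfolding coordinate_ring_def by auto
  have neg: "- p \<in> carrier (coordinate_ring n)" if "p \<in> carrier (coordinate_ring n)" for p
    using that unfolding coordinate_ring_def by auto
  show ?thesis
  proof (rule cringI)
    show "abelian_group (coordinate_ring n)"
    proof (rule abelian_groupI)
      fix p assume "p \<in> carrier (coordinate_ring n)"
      then show "\<exists>q \<in> carrier (coordinate_ring n).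
          q \<oplus>\<^bsub>coordinate_ring n\<^esub> p = \<zero>\<^bsub>coordinate_ring n\<^esub>"
        using neg by (intro bexI[of _ "- p"]) (auto simp: coordinate_ring_def)
    next
      fix p q assume "p \<in> carrier (coordinate_ring n)" "q \<in> carrier (coordinate_ring n)"
      then show "p \<oplus>\<^bsub>coordinate_ring n\<^esub> q \<in> carrier (coordinate_ring n)"
        using add[of p q] by (simp add: coordinate_ring_def)
    qed (simp_all add: coordinate_ring_def add_ac)
    show "comm_monoid (coordinate_ring n)"
    proof (rule comm_monoidI)
      fix p q assume "p \<in> carrier (coordinate_ring n)" "q \<in> carrier (coordinate_ring n)"
      then show "p \<otimes>\<^bsub>coordinate_ring n\<^esub> q \<in> carrier (coordinate_ring n)"
        using mult[of p q] by (simp add: coordinate_ring_def)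
    qed (simp_all add: coordinate_ring_def mult_ac)
  qed (simp_all add: coordinate_ring_def distrib_right)
qed

lemma module_free_module: "module (coordinate_ring n) (free_module n r)"
proof -
  interpret R: cring "coordinate_ring n" by (rule cring_coordinate_ring)
  have R: "p + q \<in> carrier (coordinate_ring n)" "p * q \<in> carrier (coordinate_ring n)"
    if "p \<in> carrier (coordinate_ring n)" "q \<in> carrier (coordinate_ring n)" for p q
    using R.a_closed[OF that] R.m_closed[OF that] by (auto simp: coordinate_ring_def)
  have R0: "0 \<in> carrier (coordinate_ring n)" by (simp add: coordinate_ring_def)
  have Rn: "- p \<in> carrier (coordinate_ring n)" if "p \<in> carrier (coordinate_ring n)" for p
    using that unfolding coordinate_ring_def by auto
  have lookup_smult: "Poly_Mapping.lookup (Poly_Mapping.map ((*) p) v) j = p * Poly_Mapping.lookup v j"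
    for p :: mpoly and v :: "nat \<Rightarrow>\<^sub>0 mpoly" and j
    by (simp add: Poly_Mapping.map.rep_eq when_def)
  have keys_smult: "Poly_Mapping.keys (Poly_Mapping.map ((*) p) v) \<subseteq> Poly_Mapping.keys v"
    for p :: mpoly and v :: "nat \<Rightarrow>\<^sub>0 mpoly"
    by (auto simp: in_keys_iff lookup_smult)
  show ?thesis
  proof (rule moduleI)
    show "cring (coordinate_ring n)" by (rule cring_coordinate_ring)
    show "abelian_group (free_module n r)"
    proof (rule abelian_groupI)
      fix v assume "v \<in> carrier (free_module n r)"
      then show "\<exists>w \<in> carrier (free_module n r).
          w \<oplus>\<^bsub>free_module n r\<^esub> v = \<zero>\<^bsub>free_module n r\<^esub>"
        by (intro bexI[of _ "- v"]) (auto simp: free_module_def Rn)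
    next
      fix v w assume "v \<in> carrier (free_module n r)" "w \<in> carrier (free_module n r)"
      then show "v \<oplus>\<^bsub>free_module n r\<^esub> w \<in> carrier (free_module n r)"
        using Poly_Mapping.keys_add[of v w] by (auto simp: free_module_def lookup_add R)
    qed (simp_all add: free_module_def add_ac R0)
    fix p v assume "p \<in> carrier (coordinate_ring n)" "v \<in> carrier (free_module n r)"
    then show "p \<odot>\<^bsub>free_module n r\<^esub> v \<in> carrier (free_module n r)"
      using keys_smult[of p v] by (auto simp: free_module_def lookup_smult R)
  qed (simp_all add: free_module_def coordinate_ring_def,
       (rule poly_mapping_eqI, simp add: lookup_smult lookup_add ring_distribs mult.assoc)+)
qed

lemma cochain_group_simps [simp]:
  "\<phi> \<otimes>\<^bsub>cochain_group p X\<^esub> \<psi> = (\<lambda>c \<in> singular_chain_set p X. \<phi> c + \<psi> c)"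
  "\<one>\<^bsub>cochain_group p X\<^esub> = (\<lambda>c \<in> singular_chain_set p X. 0)"
  by (simp_all add: cochain_group_def)

lemma cochain_group_carrier_iff:
  "\<phi> \<in> carrier (cochain_group p X) \<longleftrightarrow> \<phi> \<in> extensional (singular_chain_set p X) \<and>
     (\<forall>c d. singular_chain p X c \<longrightarrow> singular_chain p X d \<longrightarrow> \<phi> (c + d) = \<phi> c + \<phi> d)"
  by (auto simp: cochain_group_def hom_def singular_chain_def)

lemma comm_group_cochain_group: "comm_group (cochain_group p X)"
proof (rule comm_groupI)
  fix \<phi> assume "\<phi> \<in> carrier (cochain_group p X)"
  then show "\<exists>\<psi> \<in> carrier (cochain_group p X).
      \<psi> \<otimes>\<^bsub>cochain_group p X\<^esub> \<phi> = \<one>\<^bsub>cochain_group p X\<^esub>"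
    by (intro bexI[of _ "\<lambda>c \<in> singular_chain_set p X. - \<phi> c"])
      (auto simp: cochain_group_carrier_iff singular_chain_add)
qed (auto simp: cochain_group_carrier_iff singular_chain_add fun_eq_iff extensional_def)

lemma coboundary_hom:
  "coboundary p X \<in> hom (cochain_group p X) (cochain_group (Suc p) X)"
  by (rule homI)
    (auto simp: coboundary_def cochain_group_carrier_iff singular_chain_add chain_boundary_add
        singular_chain_boundary_alt fun_eq_iff)

lemma subgroup_cocycles: "subgroup (cocycles p X) (cochain_group p X)"
proof -
  interpret group_hom "cochain_group p X" "cochain_group (Suc p) X" "coboundary p X"
    using comm_group_cochain_group coboundary_hom
    by (auto simp: group_hom_def group_hom_axioms_def comm_group_def)
  show ?thesis using subgroup_kernel by (simp add: cocycles_def kernel_def)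
qed

lemma coboundaries_subset_cocycles: "coboundaries p X \<subseteq> cocycles p X"
proof (cases p)
  case 0
  then show ?thesis
    using subgroup.one_closed[OF subgroup_cocycles[of 0 X]] by (simp add: coboundaries_def)
next
  case (Suc k)
  have "coboundary (Suc k) X (coboundary k X \<phi>) = \<one>\<^bsub>cochain_group (Suc (Suc k)) X\<^esub>"
    if \<phi>: "\<phi> \<in> carrier (cochain_group k X)" for \<phi>
  proof -
    have "\<phi> 0 = 0"
      using \<phi> singular_chain_0[of k X] add_cancel_left_left[of "\<phi> 0" "\<phi> 0"]
      unfolding cochain_group_carrier_iff by (metis add_0)
    then show ?thesis
      by (auto simp: coboundary_def fun_eq_iff singular_chain_boundary_alt
          chain_boundary_boundary_alt)
  qed
  then show ?thesis
    using Suc hom_in_carrier[OF coboundary_hom[of k X]]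
    by (auto simp: coboundaries_def cocycles_def simp del: cochain_group_simps)
qed

lemma subgroup_coboundaries: "subgroup (coboundaries p X) (cochain_group p X)"
proof (cases p)
  case 0
  have "group (cochain_group 0 X)"
    using comm_group_cochain_group[of 0 X] by (simp add: comm_group_def)
  then show ?thesis
    using 0 group.triv_subgroup[of "cochain_group 0 X"] by (simp add: coboundaries_def)
next
  case (Suc k)
  interpret group_hom "cochain_group k X" "cochain_group (Suc k) X" "coboundary k X"
    using comm_group_cochain_group coboundary_hom
    by (auto simp: group_hom_def group_hom_axioms_def comm_group_def)
  show ?thesis using Suc img_is_subgroup by (simp add: coboundaries_def)
qed

lemma comm_group_cohomology_group: "comm_group (cohomology_group p X)"
proof -
  interpret C: comm_group "cochain_group p X" by (rule comm_group_cochain_group)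
  have "subgroup (coboundaries p X) (cochain_group p X\<lparr>carrier := cocycles p X\<rparr>)"
    using C.subgroup_incl subgroup_coboundaries subgroup_cocycles coboundaries_subset_cocycles
    by blast
  moreover have "comm_group (cochain_group p X\<lparr>carrier := cocycles p X\<rparr>)"
    using C.subgroup_imp_group[OF subgroup_cocycles] C.m_comm
      subgroup.subset[OF subgroup_cocycles[of p X]]
    by (intro group.group_comm_groupI) (auto simp del: cochain_group_simps)
  ultimately show ?thesis
    unfolding cohomology_group_def by (metis comm_group.abelian_FactGroup)
qed

end

theory Submission
  imports Defs "HOL-Library.Product_Lexorder" "HOL-Computational_Algebra.Fundamental_Theorem_Algebra"
begin

text \<open>A point of the Quot scheme is given by commuting \<open>2 \<times> 2\<close> matrices \<open>A\<^sub>l\<close> and vectors \<open>v\<^sub>k\<close> that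
  together generate \<open>\<complex>\<^sup>2\<close>, up to a change of basis. Either two of the vectors \<open>v\<^sub>i, v\<^sub>j\<close> form a basis, or
  \<open>v\<^sub>i, A\<^sub>l v\<^sub>i\<close> do for some \<open>i, l\<close>, so the charts of these bases cover. Taken in lexicographic order, with
  the charts of the first kind before those of the second, each chart meets the union of its
  predecessors in the complement of the common zeros of \<open>c\<close> of its coordinates, where \<open>c = i + j - 1\<close>
  respectively \<open>c = r - 1 + i + l\<close>. Scaling the data shows that the chart is contractible
  and that this complement is homotopy equivalent to the sphere of dimension \<open>2c - 1\<close>, so attaching
  the chart adds a free summand of rank one to the homology in degree \<open>2c\<close> and changes nothing else, as
  all degrees involved are even. Since the homology is free, the cohomology has the same ranks.\<close>


section \<open>Free abelian groups of finite rank\<close>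

text \<open>Not all charts are cells: where \<open>v_i, v_j\<close> is the basis, the chart is an
  affine space times the variety of commuting n-tuples of 2 x 2 matrices, which is singular as soon
  as n >= 2. A decomposition into affine cells or a Thom isomorphism for smooth strata is therefore
  not at hand. What survives is that commutation is a homogeneous condition, so scaling acts on
  every chart. It has two independent parameters: one multiplies the c coordinates whose common
  zeros are removed, the other all remaining free data. Sending both to 0 contracts the chart;
  sending only the second to 0, with the first kept positive, shrinks the complement onto a copy of
  C^c minus the origin. Only the homology of this pair enters the long exact sequence, never the
  geometry of the strata. The number c counts the equations for lying in no earlier chart. For the
  charts of two generators it is the codimension of a Schubert cell, and they contribute the
  Poincare polynomial of a Grassmannian; the others contribute that of a product of projective
  spaces of dimensions r - 1 and n - 1, multiplied by q^(r - 1).\<close>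

lemma linear_dependence_idom:
  fixes f :: "'s \<Rightarrow> nat \<Rightarrow> 'r :: idom"
  assumes "finite S" "m < card S"
  shows "\<exists>k. (\<exists>s\<in>S. k s \<noteq> 0) \<and> (\<forall>i<m. (\<Sum>s\<in>S. k s * f s i) = 0)"
  using assms
proof (induction m arbitrary: S f)
  case 0
  then have "S \<noteq> {}" by auto
  then show ?case by (intro exI[of _ "\<lambda>_. 1"]) auto
next
  case (Suc m)
  show ?case
  proof (cases "\<forall>s\<in>S. f s m = 0")
    case True
    obtain k where k: "\<exists>s\<in>S. k s \<noteq> 0" "\<forall>i<m. (\<Sum>s\<in>S. k s * f s i) = 0"
      using Suc.IH[of S f] Suc.prems by auto
    then show ?thesis
      using True by (intro exI[of _ k]) (auto simp: less_Suc_eq)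
  next
    case False
    then obtain a where a: "a \<in> S" "f a m \<noteq> 0" by blast
    define S' where "S' = S - {a}"
    have S': "finite S'" "m < card S'" "S = insert a S'" "a \<notin> S'"
      using Suc.prems a by (auto simp: S'_def)
    obtain k where k: "\<exists>s\<in>S'. k s \<noteq> 0"
      "\<forall>i<m. (\<Sum>s\<in>S'. k s * (f a m * f s i - f s m * f a i)) = 0"
      using Suc.IH[of S' "\<lambda>s i. f a m * f s i - f s m * f a i"] S' by blast
    \<comment> \<open>Elimination without division: the coefficients of the remaining vectors are
      multiplied by the pivot \<open>f a m\<close>, and the coefficient at \<open>a\<close> is what
      equation \<open>m\<close> then forces.\<close>
    define k' where "k' s = (if s = a then - (\<Sum>t\<in>S'. k t * f t m) else k s * f a m)" for s
    have "(\<Sum>s\<in>S. k' s * f s i) = (\<Sum>s\<in>S'. k s * (f a m * f s i - f s m * f a i))" for i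
    proof -
      have "(\<Sum>s\<in>S'. k' s * f s i) = (\<Sum>s\<in>S'. k s * f a m * f s i)"
        using S' by (intro sum.cong) (auto simp: k'_def)
      then show ?thesis
        using S' by (simp add: k'_def sum_distrib_left sum_distrib_right sum_subtractf algebra_simps)
    qed
    moreover have "(\<Sum>s\<in>S'. k s * (f a m * f s m - f s m * f a m)) = 0"
      by (simp add: mult.commute)
    moreover have "\<exists>s\<in>S. k' s \<noteq> 0"
      using k(1) S' a by (auto simp: k'_def)
    ultimately show ?thesis
      using k(2) by (intro exI[of _ k']) (auto simp: less_Suc_eq)
  qed
qed

text \<open>Spanning is replaced by joint injectivity of the coordinate functionals: in an abelian
  group, \<open>x\<close> and the combination of the \<open>b i\<close> with coefficients
  \<open>h i x\<close> have the same coordinates, so they agree. Functionals are also what lifts to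
  chains and cochains.\<close>

definition dual_basis ::
    "('a, 'b) monoid_scheme \<Rightarrow> nat \<Rightarrow> (nat \<Rightarrow> 'a) \<Rightarrow> (nat \<Rightarrow> 'a \<Rightarrow> int) \<Rightarrow> bool" where
  "dual_basis G m b h \<longleftrightarrow>
     (\<forall>i<m. b i \<in> carrier G) \<and> (\<forall>i<m. h i \<in> hom G integer_group) \<and>
     (\<forall>i<m. \<forall>j<m. h i (b j) = (if i = j then 1 else 0)) \<and>
     (\<forall>x\<in>carrier G. (\<forall>i<m. h i x = 0) \<longrightarrow> x = \<one>\<^bsub>G\<^esub>)"

definition free_of_rank :: "('a, 'b) monoid_scheme \<Rightarrow> nat \<Rightarrow> bool" where
  "free_of_rank G m \<longleftrightarrow> (\<exists>b h. dual_basis G m b h)"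

lemma int_pow_integer_group: "x [^]\<^bsub>integer_group\<^esub> (k :: int) = k * x"
proof -
  have "x [^]\<^bsub>integer_group\<^esub> (m :: nat) = int m * x" for m
    by (induction m) (simp_all add: nat_pow_Suc algebra_simps)
  then show ?thesis by (simp add: int_pow_def2)
qed

lemma hom_int_finprod:
  assumes "comm_group G" "h \<in> hom G integer_group" "finite S" "f ` S \<subseteq> carrier G"
  shows "h (finprod G (\<lambda>x. f x [^]\<^bsub>G\<^esub> (k x :: int)) S) = (\<Sum>x\<in>S. k x * h (f x))"
proof -
  interpret G: comm_group G by fact
  interpret H: group_hom G integer_group h
    using assms G.is_group by (simp add: group_hom_def group_hom_axioms_def)
  show ?thesis
    using assms(3,4)
  proof (induction S rule: finite_induct)
    case empty
    then show ?case using H.hom_one by simp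
  next
    case (insert x S)
    have pow: "h (f x [^]\<^bsub>G\<^esub> (k x)) = k x * h (f x)"
      using insert.prems H.hom_int_pow[of "f x" "k x"] by (simp add: int_pow_integer_group)
    have fin: "finprod G (\<lambda>x. f x [^]\<^bsub>G\<^esub> k x) S \<in> carrier G"
      using insert by (intro G.finprod_closed) auto
    have "h (finprod G (\<lambda>x. f x [^]\<^bsub>G\<^esub> k x) (insert x S))
      = h (f x [^]\<^bsub>G\<^esub> k x \<otimes>\<^bsub>G\<^esub> finprod G (\<lambda>x. f x [^]\<^bsub>G\<^esub> k x) S)"
      using insert by (subst G.finprod_insert) auto
    also have "\<dots> = h (f x [^]\<^bsub>G\<^esub> k x) + h (finprod G (\<lambda>x. f x [^]\<^bsub>G\<^esub> k x) S)"
      using insert.prems fin by (subst H.hom_mult) auto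
    also have "\<dots> = (\<Sum>x\<in>insert x S. k x * h (f x))"
      using insert pow by simp
    finally show ?case .
  qed
qed

text \<open>More than \<open>m\<close> elements are dependent because their coordinate vectors are,
  and an element with vanishing coordinates is trivial.\<close>

lemma abelian_rank_free:
  assumes G: "comm_group G" and "free_of_rank G m"
  shows "abelian_rank G = enat m"
proof -
  interpret G: comm_group G by fact
  obtain b h where bh: "dual_basis G m b h"
    using assms by (auto simp: free_of_rank_def)
  have b: "b i \<in> carrier G" and h: "h i \<in> hom G integer_group" if "i < m" for i
    using that bh by (auto simp: dual_basis_def)
  have hb: "h i (b j) = (if i = j then 1 else 0)" if "i < m" "j < m" for i j
    using that bh by (auto simp: dual_basis_def)
  have ker: "x = \<one>\<^bsub>G\<^esub>" if "x \<in> carrier G" "\<And>i. i < m \<Longrightarrow> h i x = 0" for x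
    using that bh by (auto simp: dual_basis_def)
  have inj: "inj_on b {..<m}"
  proof (rule inj_onI)
    fix i j assume "i \<in> {..<m}" "j \<in> {..<m}" "b i = b j"
    then show "i = j" using hb[of i i] hb[of i j] by (auto split: if_splits)
  qed
  have "int_independent G (b ` {..<m})"
    unfolding int_independent_def
  proof (intro conjI allI impI ballI)
    fix k :: "'a \<Rightarrow> int" and x
    assume k: "finprod G (\<lambda>x. x [^]\<^bsub>G\<^esub> k x) (b ` {..<m}) = \<one>\<^bsub>G\<^esub>" and "x \<in> b ` {..<m}"
    then obtain i where i: "i < m" "x = b i" by auto
    have "0 = h i (finprod G (\<lambda>x. x [^]\<^bsub>G\<^esub> k x) (b ` {..<m}))"
      using k h[OF i(1)] hom_one[OF h[OF i(1)]] by simp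
    also have "\<dots> = (\<Sum>x\<in>b ` {..<m}. k x * h i x)"
      using hom_int_finprod[OF G h[OF i(1)], of "b ` {..<m}" "\<lambda>x. x"] b by auto
    also have "\<dots> = (\<Sum>j<m. k (b j) * h i (b j))"
      using inj by (simp add: sum.reindex)
    also have "\<dots> = (\<Sum>j<m. if j = i then k (b j) else 0)"
      using i hb by (intro sum.cong) auto
    also have "\<dots> = k x" using i by simp
    finally show "k x = 0" by simp
  qed (use b in auto)
  moreover have "card (b ` {..<m}) = m" using inj by (simp add: card_image)
  ultimately have ge: "enat m \<le> abelian_rank G"
    unfolding abelian_rank_def by (metis (mono_tags, lifting) SUP_upper mem_Collect_eq)
  have "card S \<le> m" if S: "int_independent G S" for S
  proof (rule ccontr)
    assume "\<not> card S \<le> m"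
    then obtain k where k: "\<exists>s\<in>S. k s \<noteq> 0" "\<forall>i<m. (\<Sum>s\<in>S. k s * h i s) = 0"
      using linear_dependence_idom[of S m "\<lambda>s i. h i s"] S
      by (auto simp: int_independent_def)
    have S': "finite S" "S \<subseteq> carrier G" using S by (auto simp: int_independent_def)
    have "finprod G (\<lambda>x. x [^]\<^bsub>G\<^esub> k x) S = \<one>\<^bsub>G\<^esub>"
      using S' k(2) hom_int_finprod[OF G h, of _ S "\<lambda>x. x"]
      by (intro ker G.finprod_closed) auto
    then show False using S k(1) by (auto simp: int_independent_def)
  qed
  then have "abelian_rank G \<le> enat m"
    unfolding abelian_rank_def by (intro SUP_least) auto
  then show ?thesis using ge by simp
qed

lemma free_of_rank_trivial:
  assumes "trivial_group G"
  shows "free_of_rank G 0"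
  using assms by (auto simp: free_of_rank_def dual_basis_def trivial_group_def)

lemma free_of_rank_0_iff:
  assumes "group G"
  shows "free_of_rank G 0 \<longleftrightarrow> trivial_group G"
  using assms group.is_monoid[OF assms] monoid.one_closed[of G]
  by (auto simp: free_of_rank_def dual_basis_def trivial_group_def)

lemma free_of_rank_iso:
  assumes "group G" "group H" "G \<cong> H" "free_of_rank H m"
  shows "free_of_rank G m"
proof -
  obtain \<phi> where \<phi>: "\<phi> \<in> iso G H" using assms by (auto simp: is_iso_def)
  obtain b h where bh: "dual_basis H m b h" using assms by (auto simp: free_of_rank_def)
  interpret \<phi>: group_hom G H \<phi>
    using \<phi> assms by (auto simp: group_hom_def group_hom_axioms_def iso_def)
  have bij: "bij_betw \<phi> (carrier G) (carrier H)" using \<phi> by (simp add: iso_def)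
  define b' where "b' i = inv_into (carrier G) \<phi> (b i)" for i
  have b': "b' i \<in> carrier G" "\<phi> (b' i) = b i" if "i < m" for i
    using that bh bij by (auto simp: dual_basis_def b'_def bij_betw_def inv_into_into f_inv_into_f)
  have "dual_basis G m b' (\<lambda>i. h i \<circ> \<phi>)"
    unfolding dual_basis_def
  proof (intro conjI allI impI ballI)
    fix i assume "i < m"
    then show "h i \<circ> \<phi> \<in> hom G integer_group"
      using bh hom_compose[OF \<phi>.homh] by (auto simp: dual_basis_def)
  next
    fix x assume "x \<in> carrier G" and "\<forall>i<m. (h i \<circ> \<phi>) x = 0"
    then have "\<phi> x = \<one>\<^bsub>H\<^esub>" using bh by (auto simp: dual_basis_def)
    then have "\<phi> x = \<phi> \<one>\<^bsub>G\<^esub>" by simp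
    then show "x = \<one>\<^bsub>G\<^esub>"
      using bij \<open>x \<in> carrier G\<close> inj_onD[of \<phi> "carrier G"] by (auto simp: bij_betw_def)
  qed (use b' bh in \<open>auto simp: dual_basis_def\<close>)
  then show ?thesis by (auto simp: free_of_rank_def)
qed

lemma free_of_rank_integer_group: "free_of_rank integer_group 1"
proof -
  have "dual_basis integer_group 1 (\<lambda>_. 1) (\<lambda>_ x. x)"
    by (auto simp: dual_basis_def hom_def)
  then show ?thesis by (auto simp: free_of_rank_def)
qed

text \<open>The sequence splits because \<open>C\<close> is infinite cyclic: a preimage
  \<open>c\<close> of its generator completes the image of a basis of \<open>A\<close>.\<close>

lemma free_of_rank_extension:
  assumes "comm_group B" "comm_group A" "group C"
    and f: "f \<in> hom A B" "inj_on f (carrier A)" and g: "g \<in> hom B C" "g ` carrier B = carrier C"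
    and exact: "kernel B C g = f ` carrier A"
    and A: "free_of_rank A m" and C: "free_of_rank C 1"
  shows "free_of_rank B (Suc m)"
proof -
  interpret A: comm_group A by fact
  interpret B: comm_group B by fact
  interpret f: group_hom A B f
    using f A.is_group B.is_group by (simp add: group_hom_def group_hom_axioms_def)
  interpret g: group_hom B C g
    using g assms(3) B.is_group by (simp add: group_hom_def group_hom_axioms_def)
  obtain b h where bh: "dual_basis A m b h" using A by (auto simp: free_of_rank_def)
  obtain c0 h0 where c0: "dual_basis C 1 c0 h0" using C by (auto simp: free_of_rank_def)
  define \<gamma> where "\<gamma> = h0 0"
  have \<gamma>: "\<gamma> \<in> hom C integer_group" "\<gamma> (c0 0) = 1" "c0 0 \<in> carrier C"
    "\<And>x. x \<in> carrier C \<Longrightarrow> \<gamma> x = 0 \<Longrightarrow> x = \<one>\<^bsub>C\<^esub>"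
    using c0 by (auto simp: dual_basis_def \<gamma>_def)
  obtain c where c: "c \<in> carrier B" "\<gamma> (g c) = 1" using \<gamma> g(2) by (metis imageE)
  have \<gamma>g: "\<gamma> \<circ> g \<in> hom B integer_group" using hom_compose[OF g(1) \<gamma>(1)] .
  interpret \<gamma>g: group_hom B integer_group "\<gamma> \<circ> g"
    using \<gamma>g B.is_group by (simp add: group_hom_def group_hom_axioms_def)
  \<comment> \<open>Projection of \<open>B\<close> onto the kernel of \<open>g\<close> along the
    powers of \<open>c\<close>; followed by the inverse of \<open>f\<close> it becomes the
    retraction \<open>\<rho>\<close> onto \<open>A\<close>.\<close>
  define \<pi> where "\<pi> x = x \<otimes>\<^bsub>B\<^esub> c [^]\<^bsub>B\<^esub> (- \<gamma> (g x))" for x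
  have \<pi>_in: "\<pi> x \<in> f ` carrier A" if x: "x \<in> carrier B" for x
  proof -
    have "(\<gamma> \<circ> g) (\<pi> x) = 0"
      unfolding \<pi>_def using x c
      by (subst \<gamma>g.hom_mult) (auto simp: \<gamma>g.hom_int_pow int_pow_integer_group simp del: o_apply, simp)
    moreover have "\<pi> x \<in> carrier B" using x c by (simp add: \<pi>_def)
    ultimately have "\<pi> x \<in> kernel B C g"
      using \<gamma>(4)[of "g (\<pi> x)"] by (auto simp: kernel_def)
    then show ?thesis using exact by simp
  qed
  have \<pi>_mult: "\<pi> (x \<otimes>\<^bsub>B\<^esub> y) = \<pi> x \<otimes>\<^bsub>B\<^esub> \<pi> y" if x: "x \<in> carrier B" and y: "y \<in> carrier B" for x y
  proof -
    have "\<gamma> (g (x \<otimes>\<^bsub>B\<^esub> y)) = \<gamma> (g x) + \<gamma> (g y)" using \<gamma>g.hom_mult[OF x y] by simp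
    then show ?thesis
      unfolding \<pi>_def using x y c
      by (simp add: B.int_pow_mult[symmetric] B.m_ac add.commute)
  qed
  define \<rho> where "\<rho> x = inv_into (carrier A) f (\<pi> x)" for x
  have \<rho>: "\<rho> x \<in> carrier A" "f (\<rho> x) = \<pi> x" if "x \<in> carrier B" for x
    using \<pi>_in[OF that] by (auto simp: \<rho>_def inv_into_into f_inv_into_f)
  have \<rho>_hom: "\<rho> \<in> hom B A"
  proof (rule homI)
    fix x y assume xy: "x \<in> carrier B" "y \<in> carrier B"
    have "f (\<rho> (x \<otimes>\<^bsub>B\<^esub> y)) = f (\<rho> x \<otimes>\<^bsub>A\<^esub> \<rho> y)" using xy \<rho> \<pi>_mult by simp
    then show "\<rho> (x \<otimes>\<^bsub>B\<^esub> y) = \<rho> x \<otimes>\<^bsub>A\<^esub> \<rho> y" using xy \<rho> by (intro inj_onD[OF f(2)]) auto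
  qed (use \<rho> in auto)
  have \<rho>f: "\<rho> (f a) = a" if a: "a \<in> carrier A" for a
  proof -
    have "f a \<in> kernel B C g" using exact a by blast
    then have "g (f a) = \<one>\<^bsub>C\<^esub>" by (simp add: kernel_def)
    then have "\<gamma> (g (f a)) = 0" using hom_one[OF \<gamma>(1)] assms(3) by simp
    then have "\<pi> (f a) = f a" using a by (simp add: \<pi>_def)
    then show ?thesis using f(2) a by (simp add: \<rho>_def)
  qed
  have \<gamma>f: "\<gamma> (g (f a)) = 0" if a: "a \<in> carrier A" for a
  proof -
    have "f a \<in> kernel B C g" using exact a by blast
    then have "g (f a) = \<one>\<^bsub>C\<^esub>" by (simp add: kernel_def)
    then show ?thesis using hom_one[OF \<gamma>(1)] assms(3) by simp
  qed
  have \<rho>c: "\<rho> c = \<one>\<^bsub>A\<^esub>"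
  proof -
    have "\<pi> c = \<one>\<^bsub>B\<^esub>" using c by (simp add: \<pi>_def B.int_pow_neg)
    then have "f (\<rho> c) = f \<one>\<^bsub>A\<^esub>" using \<rho> c by simp
    then show ?thesis using \<rho> c by (intro inj_onD[OF f(2)]) auto
  qed
  define b' where "b' i = (if i = m then c else f (b i))" for i
  define h' where "h' i = (if i = m then \<gamma> \<circ> g else h i \<circ> \<rho>)" for i
  have h1: "h i \<one>\<^bsub>A\<^esub> = 0" if "i < m" for i
    using bh that hom_one[of "h i" A integer_group] by (auto simp: dual_basis_def)
  have "dual_basis B (Suc m) b' h'"
    unfolding dual_basis_def
  proof (intro conjI allI impI ballI)
    fix i assume i: "i < Suc m"
    show "b' i \<in> carrier B" using i c bh by (auto simp: b'_def dual_basis_def)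
    show "h' i \<in> hom B integer_group"
      using i \<gamma>g bh hom_compose[OF \<rho>_hom, of "h i" integer_group] by (auto simp: h'_def dual_basis_def)
    fix j assume j: "j < Suc m"
    have "b j \<in> carrier A" if "j \<noteq> m" using that j bh by (auto simp: dual_basis_def)
    then show "h' i (b' j) = (if i = j then 1 else 0)"
      using i j c bh by (auto simp: h'_def b'_def \<gamma>f \<rho>f \<rho>c h1) (auto simp: dual_basis_def)
  next
    fix x assume x: "x \<in> carrier B" and 0: "\<forall>i<Suc m. h' i x = 0"
    have "h i (\<rho> x) = 0" if "i < m" for i
      using 0[rule_format, of i] that by (simp add: h'_def)
    then have 1: "\<rho> x = \<one>\<^bsub>A\<^esub>" using bh \<rho> x by (auto simp: dual_basis_def)
    have 2: "\<gamma> (g x) = 0" using 0[rule_format, of m] by (simp add: h'_def)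
    then have "\<pi> x = x" using x by (simp add: \<pi>_def)
    then show "x = \<one>\<^bsub>B\<^esub>" using \<rho>(2)[OF x] 1 by simp
  qed
  then show ?thesis by (auto simp: free_of_rank_def)
qed


section \<open>Cohomology of spaces with free homology\<close>

text \<open>Chains of a space form a subgroup of the free abelian group on all maps, and a homology
  functional is additive on cycles only. Hence additivity is taken relative to a predicate
  \<open>P\<close> closed under the group operations.\<close>

locale additive_on_chains =
  fixes P :: "('a \<Rightarrow>\<^sub>0 int) \<Rightarrow> bool" and f :: "('a \<Rightarrow>\<^sub>0 int) \<Rightarrow> 'b :: ab_group_add"
  assumes P0: "P 0" and Padd: "P a \<Longrightarrow> P b \<Longrightarrow> P (a + b)" and Pneg: "P a \<Longrightarrow> P (- a)"
    and add: "P a \<Longrightarrow> P b \<Longrightarrow> f (a + b) = f a + f b"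
begin

lemma Pdiff: "P a \<Longrightarrow> P b \<Longrightarrow> P (a - b)"
  using Padd[of a "- b"] Pneg[of b] by simp

lemma zero: "f 0 = 0"
  using add[OF P0 P0] by simp

lemma neg: "P a \<Longrightarrow> f (- a) = - f a"
  using add[of a "- a"] Pneg[of a] zero by (simp add: eq_neg_iff_add_eq_0 add.commute)

lemma diff: "P a \<Longrightarrow> P b \<Longrightarrow> f (a - b) = f a - f b"
  using add[of a "- b"] Pneg[of b] neg[of b] by simp

lemma Pcmul: "P a \<Longrightarrow> P (frag_cmul k a)"
  by (rule frag_closure_minus_cmul) (auto intro: P0 Pdiff)

lemma Psum: "(\<And>i. i \<in> I \<Longrightarrow> P (g i)) \<Longrightarrow> P (\<Sum>i\<in>I. g i)"
  by (induction I rule: infinite_finite_induct) (auto simp: P0 Padd)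

lemma sum: "(\<And>i. i \<in> I \<Longrightarrow> P (g i)) \<Longrightarrow> f (\<Sum>i\<in>I. g i) = (\<Sum>i\<in>I. f (g i))"
  by (induction I rule: infinite_finite_induct) (auto simp: zero add Psum)

end

lemma (in additive_on_chains) cmul_general:
  assumes "P a"
  shows "f (frag_cmul (int k) a) = (\<Sum>i<k. f a)"
proof (induction k)
  case 0
  then show ?case by (simp add: zero)
next
  case (Suc k)
  have "f (frag_cmul (int (Suc k)) a) = f (frag_cmul (int k) a + a)"
    by (simp add: frag_cmul_distrib add.commute)
  also have "\<dots> = f (frag_cmul (int k) a) + f a"
    using assms by (intro add Pcmul)
  finally show ?case using Suc by simp
qed

locale int_additive_on_chains = additive_on_chains P f
  for P :: "('a \<Rightarrow>\<^sub>0 int) \<Rightarrow> bool" and f :: "('a \<Rightarrow>\<^sub>0 int) \<Rightarrow> int"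
begin

lemma cmul:
  assumes "P a"
  shows "f (frag_cmul k a) = k * f a"
proof (cases k)
  case (nonneg m)
  then show ?thesis using cmul_general[OF assms, of m] by simp
next
  case (neg m)
  have "frag_cmul k a = - frag_cmul (int (Suc m)) a" using neg by simp
  then have "f (frag_cmul k a) = - f (frag_cmul (int (Suc m)) a)"
    using additive_on_chains.neg[OF additive_on_chains_axioms Pcmul[OF assms]] by metis
  also have "f (frag_cmul (int (Suc m)) a) = int (Suc m) * f a"
    by (subst cmul_general[OF assms]) simp
  also have "- (int (Suc m) * f a) = k * f a" by (simp add: neg minus_mult_left)
  finally show ?thesis .
qed

lemma lin_comb:
  assumes "\<And>i. i \<in> I \<Longrightarrow> P (z i)"
  shows "f (\<Sum>i\<in>I. frag_cmul (k i) (z i)) = (\<Sum>i\<in>I. k i * f (z i))"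
  using assms by (subst sum) (auto intro!: Pcmul sum.cong simp: cmul)

end

text \<open>A \<open>dual_basis\<close> of the homology group lifted to cycles: representatives of
  the basis, and functionals whose common kernel among the cycles consists of the
  boundaries.\<close>

definition homology_dual_basis ::
    "nat \<Rightarrow> 'a topology \<Rightarrow> nat \<Rightarrow> (nat \<Rightarrow> 'a chain) \<Rightarrow> (nat \<Rightarrow> 'a chain \<Rightarrow> int) \<Rightarrow> bool" where
  "homology_dual_basis p X m z h \<longleftrightarrow>
     (\<forall>i<m. singular_relcycle p X {} (z i)) \<and>
     (\<forall>i<m. int_additive_on_chains (singular_relcycle p X {}) (h i)) \<and>
     (\<forall>i<m. \<forall>c. singular_relboundary p X {} c \<longrightarrow> h i c = 0) \<and>
     (\<forall>i<m. \<forall>j<m. h i (z j) = (if i = j then 1 else 0)) \<and>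
     (\<forall>c. singular_relcycle p X {} c \<longrightarrow> (\<forall>i<m. h i c = 0) \<longrightarrow> singular_relboundary p X {} c)"

lemma homology_dual_basis_exists:
  assumes "free_of_rank (homology_group (int p) X) m"
  obtains z h where "homology_dual_basis p X m z h"
proof -
  let ?H = "homology_group (int p) X"
  obtain b h where bh: "dual_basis ?H m b h" using assms by (auto simp: free_of_rank_def)
  define cl where "cl = homologous_rel_set p X {}"
  have carr: "carrier ?H = cl ` singular_relcycle_set p X {}"
    unfolding cl_def by (rule carrier_relative_homology_group)
  have cl_hom: "cl \<in> hom (relcycle_group p X {}) ?H"
    using normal.r_coset_hom_Mod[OF normal_subgroup_singular_relboundary_relcycle[of p X "{}"]]
    by (simp add: right_coset_singular_relboundary nontrivial_relative_homology_group cl_def)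
  have cl0: "cl c = \<one>\<^bsub>?H\<^esub> \<longleftrightarrow> singular_relboundary p X {} c" for c
    unfolding cl_def using homologous_rel_set_eq_relboundary by simp
  have "\<forall>i. \<exists>c. i < m \<longrightarrow> singular_relcycle p X {} c \<and> b i = cl c"
    using bh carr by (auto simp: dual_basis_def)
  then obtain z where z: "\<And>i. i < m \<Longrightarrow> singular_relcycle p X {} (z i)" "\<And>i. i < m \<Longrightarrow> b i = cl (z i)"
    by metis
  have "homology_dual_basis p X m z (\<lambda>i c. h i (cl c))"
    unfolding homology_dual_basis_def
  proof (intro conjI allI impI)
    fix i assume i: "i < m"
    have hi: "h i \<in> hom ?H integer_group" using bh i by (auto simp: dual_basis_def)
    have comp: "h i \<circ> cl \<in> hom (relcycle_group p X {}) integer_group"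
      by (rule hom_compose[OF cl_hom hi])
    show "int_additive_on_chains (singular_relcycle p X {}) (\<lambda>c. h i (cl c))"
    proof (intro int_additive_on_chains.intro additive_on_chains.intro)
      fix c d assume "singular_relcycle p X {} c" "singular_relcycle p X {} d"
      then show "h i (cl (c + d)) = h i (cl c) + h i (cl d)"
        using comp by (auto simp: hom_def)
    qed (auto simp: singular_relcycle_add singular_relcycle_minus)
    fix c assume "singular_relboundary p X {} c"
    then have "cl c = \<one>\<^bsub>?H\<^esub>" using cl0 by blast
    then show "h i (cl c) = 0" using hom_one[OF hi] by simp
  next
    fix c assume c: "singular_relcycle p X {} c" "\<forall>i<m. h i (cl c) = 0"
    then have "cl c = \<one>\<^bsub>?H\<^esub>" using bh carr by (auto simp: dual_basis_def)
    then show "singular_relboundary p X {} c" using cl0 by blast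
  qed (use z bh in \<open>auto simp: dual_basis_def\<close>)
  then show thesis using that by blast
qed

section \<open>Splitting the chain groups along cycles and boundaries\<close>

definition cycle_retraction :: "nat \<Rightarrow> 'a topology \<Rightarrow> ('a chain \<Rightarrow> 'a chain) \<Rightarrow> bool" where
  "cycle_retraction p X \<rho> \<longleftrightarrow>
     additive_on_chains (singular_chain p X) \<rho> \<and>
     (\<forall>c. singular_chain p X c \<longrightarrow> singular_relcycle p X {} (\<rho> c)) \<and>
     (\<forall>c. singular_relcycle p X {} c \<longrightarrow> \<rho> c = c)"

definition boundary_section :: "nat \<Rightarrow> 'a topology \<Rightarrow> ('a chain \<Rightarrow> 'a chain) \<Rightarrow> bool" where
  "boundary_section p X \<kappa> \<longleftrightarrow>
     additive_on_chains (singular_chain p X) \<kappa> \<and>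
     (\<forall>c. singular_chain p X c \<longrightarrow> singular_chain (Suc p) X (\<kappa> c)) \<and>
     (\<forall>c. singular_relboundary p X {} c \<longrightarrow> chain_boundary (Suc p) (\<kappa> c) = c)"

text \<open>Boundaries are a direct summand of the chains: retract to the cycles, then subtract the
  part seen by the homology functionals. The resulting projection \<open>\<sigma>\<close> lifts
  through the boundary map because chains are free on simplices.\<close>

lemma boundary_section_exists:
  assumes \<rho>: "cycle_retraction p X \<rho>" and zh: "homology_dual_basis p X m z h"
  shows "\<exists>\<kappa>. boundary_section p X \<kappa>"
proof -
  have z: "\<And>i. i < m \<Longrightarrow> singular_relcycle p X {} (z i)"
    and h: "\<And>i. i < m \<Longrightarrow> int_additive_on_chains (singular_relcycle p X {}) (h i)"
    and hb: "\<And>i c. i < m \<Longrightarrow> singular_relboundary p X {} c \<Longrightarrow> h i c = 0"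
    and hz: "\<And>i j. i < m \<Longrightarrow> j < m \<Longrightarrow> h i (z j) = (if i = j then 1 else 0)"
    and ker: "\<And>c. singular_relcycle p X {} c \<Longrightarrow> (\<And>i. i < m \<Longrightarrow> h i c = 0) \<Longrightarrow> singular_relboundary p X {} c"
    using zh by (auto simp: homology_dual_basis_def)
  interpret \<rho>: additive_on_chains "singular_chain p X" \<rho>
    using \<rho> by (simp add: cycle_retraction_def)
  have \<rho>c: "\<And>c. singular_chain p X c \<Longrightarrow> singular_relcycle p X {} (\<rho> c)"
    and \<rho>id: "\<And>c. singular_relcycle p X {} c \<Longrightarrow> \<rho> c = c"
    using \<rho> by (auto simp: cycle_retraction_def)
  define \<sigma> where "\<sigma> c = \<rho> c - (\<Sum>i<m. frag_cmul (h i (\<rho> c)) (z i))" for c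
  have cyc_comb: "singular_relcycle p X {} (\<Sum>i<m. frag_cmul (k i) (z i))" for k
    by (intro singular_relcycle_sum singular_relcycle_cmul z) auto
  have \<sigma>_boundary: "singular_relboundary p X {} (\<sigma> c)" if c: "singular_chain p X c" for c
  proof (rule ker)
    show "singular_relcycle p X {} (\<sigma> c)"
      unfolding \<sigma>_def by (intro singular_relcycle_diff \<rho>c c cyc_comb)
    fix j assume j: "j < m"
    interpret h: int_additive_on_chains "singular_relcycle p X {}" "h j" using h[OF j] .
    have "h j (\<Sum>i<m. frag_cmul (h i (\<rho> c)) (z i)) = (\<Sum>i<m. h i (\<rho> c) * h j (z i))"
      by (rule h.lin_comb) (use z in auto)
    also have "\<dots> = (\<Sum>i<m. if i = j then h i (\<rho> c) else 0)"
      by (intro sum.cong) (use hz j in auto)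
    also have "\<dots> = h j (\<rho> c)" using j by simp
    finally show "h j (\<sigma> c) = 0"
      unfolding \<sigma>_def using h.diff[OF \<rho>c[OF c] cyc_comb] by simp
  qed
  have \<sigma>_id: "\<sigma> c = c" if c: "singular_relboundary p X {} c" for c
  proof -
    have "singular_relcycle p X {} c" using c singular_relboundary_imp_relcycle by blast
    then have "\<rho> c = c" by (rule \<rho>id)
    then show ?thesis using hb c by (simp add: \<sigma>_def)
  qed
  have \<sigma>_diff: "\<sigma> (a - b) = \<sigma> a - \<sigma> b" if "singular_chain p X a" "singular_chain p X b" for a b
  proof -
    have "h i (\<rho> (a - b)) = h i (\<rho> a) - h i (\<rho> b)" if "i < m" for i
      using \<rho>.diff[OF \<open>singular_chain p X a\<close> \<open>singular_chain p X b\<close>]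
        additive_on_chains.diff[OF int_additive_on_chains.axioms[OF h[OF that]]] \<rho>c
          \<open>singular_chain p X a\<close> \<open>singular_chain p X b\<close> by simp
    then show ?thesis
      unfolding \<sigma>_def using \<rho>.diff[OF that]
      by (simp add: frag_cmul_diff_distrib sum_subtractf)
  qed
  have "\<forall>f. \<exists>d. singular_simplex p X f \<longrightarrow>
      singular_chain (Suc p) X d \<and> chain_boundary (Suc p) d = \<sigma> (frag_of f)"
    using \<sigma>_boundary singular_boundary singular_chain_of by blast
  then obtain k where k: "\<And>f. singular_simplex p X f \<Longrightarrow> singular_chain (Suc p) X (k f)"
    "\<And>f. singular_simplex p X f \<Longrightarrow> chain_boundary (Suc p) (k f) = \<sigma> (frag_of f)"
    by metis
  define \<kappa> where "\<kappa> = frag_extend k"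
  have \<kappa>_chain: "singular_chain (Suc p) X (\<kappa> c)" if c: "singular_chain p X c" for c
    unfolding \<kappa>_def using c k(1) by (intro singular_chain_extend) (auto simp: singular_chain_def)
  have *: "singular_chain p X c \<and> chain_boundary (Suc p) (\<kappa> c) = \<sigma> c"
    if c: "Poly_Mapping.keys c \<subseteq> singular_simplex_set p X" for c
    using c
  proof (induction c rule: frag_induction)
    case zero
    have "\<sigma> 0 = 0" using \<sigma>_diff[of 0 0] by simp
    then show ?case by (simp add: \<kappa>_def)
  next
    case (one x)
    then show ?case using k(2) by (simp add: \<kappa>_def singular_chain_of)
  next
    case (diff a b)
    then show ?case
      by (simp add: \<kappa>_def frag_extend_diff chain_boundary_diff \<sigma>_diff singular_chain_diff)
  qed
  have "boundary_section p X \<kappa>"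
    unfolding boundary_section_def
  proof (intro conjI allI impI)
    show "additive_on_chains (singular_chain p X) \<kappa>"
      by unfold_locales (auto simp: singular_chain_add singular_chain_minus \<kappa>_def frag_extend_add)
    fix c assume c: "singular_relboundary p X {} c"
    then have "singular_chain p X c" by (rule singular_boundary_imp_chain)
    then show "chain_boundary (Suc p) (\<kappa> c) = c"
      using * \<sigma>_id[OF c] by (simp add: singular_chain_def)
  qed (rule \<kappa>_chain)
  then show ?thesis by blast
qed

lemma boundary_section_cycle:
  assumes \<kappa>: "boundary_section p X \<kappa>" and c: "singular_chain (Suc p) X c"
  shows "singular_relcycle (Suc p) X {} (c - \<kappa> (chain_boundary (Suc p) c))"
proof -
  have b: "singular_relboundary p X {} (chain_boundary (Suc p) c)"
    using c singular_boundary by blast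
  then have "singular_chain p X (chain_boundary (Suc p) c)" by (rule singular_boundary_imp_chain)
  then show ?thesis
    using \<kappa> c b by (auto simp: singular_cycle boundary_section_def chain_boundary_diff singular_chain_diff)
qed

text \<open>Removing from \<open>c\<close> a chain with the same boundary leaves a cycle, and from a
  cycle nothing is removed.\<close>

lemma cycle_retraction_Suc:
  assumes \<kappa>: "boundary_section p X \<kappa>"
  shows "cycle_retraction (Suc p) X (\<lambda>c. c - \<kappa> (chain_boundary (Suc p) c))"
proof -
  interpret \<kappa>: additive_on_chains "singular_chain p X" \<kappa>
    using \<kappa> by (simp add: boundary_section_def)
  have bd: "singular_chain p X (chain_boundary (Suc p) c)" if "singular_chain (Suc p) X c" for c
    using that singular_chain_boundary_alt by blast
  show ?thesis
    unfolding cycle_retraction_def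
  proof (intro conjI allI impI)
    show "additive_on_chains (singular_chain (Suc p) X) (\<lambda>c. c - \<kappa> (chain_boundary (Suc p) c))"
      by unfold_locales
        (auto simp: singular_chain_add singular_chain_minus chain_boundary_add \<kappa>.add bd)
  next
    fix c assume "singular_relcycle (Suc p) X {} c"
    then show "c - \<kappa> (chain_boundary (Suc p) c) = c"
      by (simp add: singular_cycle \<kappa>.zero)
  qed (rule boundary_section_cycle[OF \<kappa>])
qed

lemma cycle_retraction_exists:
  assumes "\<And>q. q < p \<Longrightarrow> free_of_rank (homology_group (int q) X) (m q)"
  shows "\<exists>\<rho>. cycle_retraction p X \<rho>"
  using assms
proof (induction p)
  case 0
  \<comment> \<open>In degree 0 every chain is a cycle.\<close>
  have "cycle_retraction 0 X (\<lambda>c. c)"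
    unfolding cycle_retraction_def
    by (intro conjI additive_on_chains.intro)
      (auto simp: singular_chain_add singular_chain_minus singular_cycle chain_boundary_def)
  then show ?case by blast
next
  case (Suc p)
  obtain \<rho> where "cycle_retraction p X \<rho>" using Suc by fastforce
  moreover obtain z h where "homology_dual_basis p X (m p) z h"
    using homology_dual_basis_exists Suc.prems[of p] by blast
  ultimately obtain \<kappa> where "boundary_section p X \<kappa>" using boundary_section_exists by blast
  then show ?case using cycle_retraction_Suc by blast
qed

text \<open>A chain differs from \<open>\<kappa>\<close> of its boundary by a cycle. Hence
  \<open>\<phi>\<close> depends on the boundary alone, and it is the coboundary of
  \<open>\<phi>\<close> composed with \<open>\<kappa>\<close>.\<close>

lemma cocycle_vanishing_on_cycles:
  assumes \<phi>: "\<phi> \<in> cocycles p X" and 0: "\<And>c. singular_relcycle p X {} c \<Longrightarrow> \<phi> c = 0"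
    and free: "\<And>q. q < p \<Longrightarrow> free_of_rank (homology_group (int q) X) (m q)"
  shows "\<phi> \<in> coboundaries p X"
proof (cases p)
  case 0
  have "singular_relcycle 0 X {} c" if "singular_chain 0 X c" for c
    using that by (simp add: singular_cycle chain_boundary_def)
  then have "\<phi> = (\<lambda>c\<in>singular_chain_set p X. 0)"
    using \<phi> assms(2) 0 by (auto simp: cocycles_def cochain_group_carrier_iff extensional_def fun_eq_iff)
  then show ?thesis using 0 by (simp add: coboundaries_def)
next
  case (Suc k)
  obtain \<rho> where "cycle_retraction k X \<rho>"
    using cycle_retraction_exists[of k X m] free Suc by auto
  moreover obtain z h where "homology_dual_basis k X (m k) z h"
    using homology_dual_basis_exists free[of k] Suc by blast
  ultimately obtain \<kappa> where \<kappa>: "boundary_section k X \<kappa>" using boundary_section_exists by blast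
  interpret \<kappa>: additive_on_chains "singular_chain k X" \<kappa>
    using \<kappa> by (simp add: boundary_section_def)
  have \<kappa>c: "\<And>c. singular_chain k X c \<Longrightarrow> singular_chain (Suc k) X (\<kappa> c)"
    using \<kappa> by (simp add: boundary_section_def)
  have \<phi>_ext: "\<phi> \<in> extensional (singular_chain_set (Suc k) X)"
    and \<phi>_add: "\<And>c d. singular_chain (Suc k) X c \<Longrightarrow> singular_chain (Suc k) X d \<Longrightarrow> \<phi> (c + d) = \<phi> c + \<phi> d"
    using \<phi> Suc by (auto simp: cocycles_def cochain_group_carrier_iff)
  interpret \<phi>: int_additive_on_chains "singular_chain (Suc k) X" \<phi>
    by unfold_locales (auto simp: singular_chain_add singular_chain_minus \<phi>_add)
  define \<psi> where "\<psi> = (\<lambda>c\<in>singular_chain_set k X. \<phi> (\<kappa> c))"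
  have "\<psi> \<in> carrier (cochain_group k X)"
    unfolding cochain_group_carrier_iff \<psi>_def
    by (auto simp: singular_chain_add \<kappa>.add \<phi>_add \<kappa>c)
  moreover have "\<phi> = coboundary k X \<psi>"
  proof
    fix c
    show "\<phi> c = coboundary k X \<psi> c"
    proof (cases "singular_chain (Suc k) X c")
      case True
      have b: "singular_chain k X (chain_boundary (Suc k) c)"
        using True singular_chain_boundary_alt by blast
      have "\<phi> (c - \<kappa> (chain_boundary (Suc k) c)) = 0"
        using boundary_section_cycle[OF \<kappa> True] 0[unfolded Suc] assms(2) Suc by blast
      then show ?thesis
        using True b \<phi>.diff[OF True \<kappa>c[OF b]] by (simp add: coboundary_def \<psi>_def)
    next
      case False
      then show ?thesis using \<phi>_ext by (auto simp: coboundary_def extensional_def)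
    qed
  qed
  ultimately show ?thesis using Suc by (auto simp: coboundaries_def)
qed

text \<open>If the homology is free, then by induction on the degree the cycles are a direct summand of
  the chains, so that no \<open>Ext\<close> term appears.\<close>

lemma free_of_rank_cohomology_group:
  assumes free: "\<And>q. q \<le> p \<Longrightarrow> free_of_rank (homology_group (int q) X) (m q)"
  shows "free_of_rank (cohomology_group p X) (m p)"
proof -
  define C where "C = cochain_group p X\<lparr>carrier := cocycles p X\<rparr>"
  define N where "N = coboundaries p X"
  interpret C0: comm_group "cochain_group p X" by (rule comm_group_cochain_group)
  have C: "comm_group C"
    unfolding C_def using C0.subgroup_imp_group[OF subgroup_cocycles] C0.m_comm
      subgroup.subset[OF subgroup_cocycles[of p X]]
    by (intro group.group_comm_groupI) (auto simp del: cochain_group_simps)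
  interpret C: comm_group C by (rule C)
  have sub: "subgroup N C"
    unfolding C_def N_def
    using C0.subgroup_incl subgroup_coboundaries subgroup_cocycles coboundaries_subset_cocycles by blast
  then have normal: "N \<lhd> C" using C.normal_iff_subgroup by blast
  have H: "cohomology_group p X = C Mod N" by (simp add: cohomology_group_def C_def N_def)
  obtain \<rho> where \<rho>: "cycle_retraction p X \<rho>"
    using cycle_retraction_exists[of p X m] free by auto
  obtain z h where zh: "homology_dual_basis p X (m p) z h"
    using homology_dual_basis_exists free[of p] by blast
  have z: "\<And>i. i < m p \<Longrightarrow> singular_relcycle p X {} (z i)"
    and h: "\<And>i. i < m p \<Longrightarrow> int_additive_on_chains (singular_relcycle p X {}) (h i)"
    and hb: "\<And>i c. i < m p \<Longrightarrow> singular_relboundary p X {} c \<Longrightarrow> h i c = 0"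
    and hz: "\<And>i j. i < m p \<Longrightarrow> j < m p \<Longrightarrow> h i (z j) = (if i = j then 1 else 0)"
    and ker: "\<And>c. singular_relcycle p X {} c \<Longrightarrow> (\<And>i. i < m p \<Longrightarrow> h i c = 0) \<Longrightarrow> singular_relboundary p X {} c"
    using zh by (auto simp: homology_dual_basis_def)
  have zc: "\<And>i. i < m p \<Longrightarrow> singular_chain p X (z i)" using z by (simp add: singular_cycle)
  interpret \<rho>: additive_on_chains "singular_chain p X" \<rho>
    using \<rho> by (simp add: cycle_retraction_def)
  have \<rho>c: "\<And>c. singular_chain p X c \<Longrightarrow> singular_relcycle p X {} (\<rho> c)"
    and \<rho>id: "\<And>c. singular_relcycle p X {} c \<Longrightarrow> \<rho> c = c"
    using \<rho> by (auto simp: cycle_retraction_def)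
  \<comment> \<open>The functional \<open>h i\<close> lives on cycles; the retraction
    \<open>\<rho>\<close> extends it to all chains, and the result is a cocycle because
    \<open>h i\<close> kills boundaries.\<close>
  define b where "b i = (\<lambda>c\<in>singular_chain_set p X. h i (\<rho> c))" for i
  have b_in: "b i \<in> carrier C" if i: "i < m p" for i
  proof -
    interpret h: int_additive_on_chains "singular_relcycle p X {}" "h i" using h[OF i] .
    have "b i \<in> carrier (cochain_group p X)"
      unfolding cochain_group_carrier_iff b_def
      by (auto simp: singular_chain_add \<rho>.add h.add \<rho>c)
    moreover have "coboundary p X (b i) = \<one>\<^bsub>cochain_group (Suc p) X\<^esub>"
    proof -
      have "b i (chain_boundary (Suc p) c) = 0" if c: "singular_chain (Suc p) X c" for c
      proof -
        have 1: "singular_relboundary p X {} (chain_boundary (Suc p) c)"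
          using c singular_boundary by blast
        then have "singular_relcycle p X {} (chain_boundary (Suc p) c)"
          using singular_relboundary_imp_relcycle by blast
        then show ?thesis using 1 hb[OF i] \<rho>id by (simp add: b_def singular_cycle)
      qed
      then show ?thesis by (auto simp: coboundary_def fun_eq_iff)
    qed
    ultimately show ?thesis by (simp add: C_def cocycles_def)
  qed
  have addC: "(\<phi> \<otimes>\<^bsub>C\<^esub> \<psi>) c = \<phi> c + \<psi> c" if "singular_chain p X c" for \<phi> \<psi> c
    using that by (simp add: C_def)
  have vanish: "\<phi> (z i) = 0" if \<phi>: "\<phi> \<in> N" and i: "i < m p" for \<phi> i
  proof (cases p)
    case 0
    then show ?thesis using \<phi> zc[OF i] by (simp add: N_def coboundaries_def)
  next
    case (Suc k)
    then obtain \<psi> where \<psi>: "\<psi> \<in> carrier (cochain_group k X)" "\<phi> = coboundary k X \<psi>"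
      using \<phi> by (auto simp: N_def coboundaries_def)
    have "chain_boundary (Suc k) (z i) = 0" using z[OF i] Suc by (simp add: singular_cycle)
    moreover have "\<psi> 0 = 0"
      using \<psi> singular_chain_0[of k X] add_cancel_left_left[of "\<psi> 0" "\<psi> 0"]
      unfolding cochain_group_carrier_iff by (metis add_0)
    ultimately show ?thesis using \<psi> zc[OF i] Suc by (simp add: coboundary_def)
  qed
  \<comment> \<open>Evaluation at the cycle \<open>z i\<close> kills coboundaries, so it descends to
    cohomology. These evaluations are dual to the classes of the \<open>b i\<close>.\<close>
  have "\<exists>g. g \<in> hom (C Mod N) integer_group \<and> (\<forall>\<phi>\<in>carrier C. g (N #>\<^bsub>C\<^esub> \<phi>) = \<phi> (z i))"
    if i: "i < m p" for i
  proof -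
    have "(\<lambda>\<phi>. \<phi> (z i)) \<in> hom C integer_group"
      using zc[OF i] addC by (intro homI) auto
    then interpret e: group_hom C integer_group "\<lambda>\<phi>. \<phi> (z i)"
      using C.is_group by (simp add: group_hom_def group_hom_axioms_def)
    have "N \<subseteq> kernel C integer_group (\<lambda>\<phi>. \<phi> (z i))"
      using vanish i subgroup.subset[OF sub] by (auto simp: kernel_def)
    from e.FactGroup_universal_kernel[OF normal this] show ?thesis by metis
  qed
  then obtain e where e: "\<And>i. i < m p \<Longrightarrow> e i \<in> hom (C Mod N) integer_group"
    "\<And>i \<phi>. i < m p \<Longrightarrow> \<phi> \<in> carrier C \<Longrightarrow> e i (N #>\<^bsub>C\<^esub> \<phi>) = \<phi> (z i)"
    by metis
  have "dual_basis (C Mod N) (m p) (\<lambda>i. N #>\<^bsub>C\<^esub> b i) e"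
    unfolding dual_basis_def
  proof (intro conjI allI impI ballI)
    fix i assume i: "i < m p"
    show "N #>\<^bsub>C\<^esub> b i \<in> carrier (C Mod N)"
      using b_in[OF i] by (auto simp: FactGroup_def RCOSETS_def)
    show "e i \<in> hom (C Mod N) integer_group" using e i by blast
    fix j assume j: "j < m p"
    have "e i (N #>\<^bsub>C\<^esub> b j) = b j (z i)" using e(2) i b_in[OF j] by blast
    also have "\<dots> = h j (z i)" using zc[OF i] \<rho>id z[OF i] by (simp add: b_def)
    finally show "e i (N #>\<^bsub>C\<^esub> b j) = (if i = j then 1 else 0)" using hz i j by auto
  next
    fix x assume x: "x \<in> carrier (C Mod N)" and 0: "\<forall>i<m p. e i x = 0"
    obtain \<phi> where \<phi>: "\<phi> \<in> carrier C" "x = N #>\<^bsub>C\<^esub> \<phi>"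
      using x by (auto simp: FactGroup_def RCOSETS_def)
    have \<phi>z: "\<phi> (z i) = 0" if "i < m p" for i using 0 e(2)[OF that \<phi>(1)] \<phi>(2) that by simp
    have \<phi>_coc: "\<phi> \<in> cocycles p X" using \<phi> by (simp add: C_def)
    then have \<phi>_add: "\<And>c d. singular_chain p X c \<Longrightarrow> singular_chain p X d \<Longrightarrow> \<phi> (c + d) = \<phi> c + \<phi> d"
      and \<phi>_bd: "\<And>c. singular_chain (Suc p) X c \<Longrightarrow> \<phi> (chain_boundary (Suc p) c) = 0"
      by (auto simp: cocycles_def cochain_group_carrier_iff coboundary_def fun_eq_iff restrict_def split: if_splits)
    interpret \<phi>: int_additive_on_chains "singular_chain p X" \<phi>
      by unfold_locales (auto simp: singular_chain_add singular_chain_minus \<phi>_add)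
    have "\<phi> c = 0" if c: "singular_relcycle p X {} c" for c
    proof -
      \<comment> \<open>The combination of the \<open>z i\<close> homologous to \<open>c\<close>: a
        cocycle vanishing on every \<open>z i\<close> then vanishes on \<open>c\<close>.\<close>
      define s where "s = (\<Sum>i<m p. frag_cmul (h i c) (z i))"
      have s: "singular_relcycle p X {} s"
        unfolding s_def by (intro singular_relcycle_sum singular_relcycle_cmul z) auto
      have "singular_relboundary p X {} (c - s)"
      proof (rule ker)
        fix j assume j: "j < m p"
        interpret h: int_additive_on_chains "singular_relcycle p X {}" "h j" using h[OF j] .
        have "h j s = (\<Sum>i<m p. h i c * h j (z i))"
          unfolding s_def by (rule h.lin_comb) (use z in auto)
        also have "\<dots> = (\<Sum>i<m p. if i = j then h i c else 0)"
          by (intro sum.cong) (use hz j in auto)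
        also have "\<dots> = h j c" using j by simp
        finally show "h j (c - s) = 0" using h.diff[OF c s] by simp
      qed (intro singular_relcycle_diff c s)
      then have "\<phi> (c - s) = 0" using \<phi>_bd unfolding singular_boundary by metis
      moreover have "\<phi> s = 0" unfolding s_def by (subst \<phi>.lin_comb) (use zc \<phi>z in auto)
      ultimately show ?thesis using \<phi>.diff[of c s] c s by (simp add: singular_cycle)
    qed
    then have "\<phi> \<in> N"
      unfolding N_def using free \<phi>_coc
      by (intro cocycle_vanishing_on_cycles[where m = m]) auto
    then show "x = \<one>\<^bsub>C Mod N\<^esub>"
      using \<phi>(2) subgroup.rcos_const[OF sub] C.is_group by (simp add: FactGroup_def)
  qed
  then show ?thesis unfolding H free_of_rank_def by blast
qed


section \<open>Homology of a space covered by contractible charts\<close>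

lemma free_of_rank_homology_contractible:
  assumes "contractible_space X" "topspace X \<noteq> {}"
  shows "free_of_rank (homology_group (int p) X) (if p = 0 then 1 else 0)"
proof -
  obtain a where a: "a \<in> topspace X" "X homotopy_equivalent_space subtopology X {a}"
    using assms by (auto simp: contractible_eq_homotopy_equivalent_singleton_subtopology)
  have iso: "homology_group (int p) X \<cong> homology_group (int p) (subtopology X {a})"
    using a by (intro homotopy_equivalent_space_imp_isomorphic_homology_groups)
  have top: "topspace (subtopology X {a}) = {a}" using a by auto
  have "free_of_rank (homology_group (int p) (subtopology X {a})) (if p = 0 then 1 else 0)"
  proof (cases "p = 0")
    case True
    have "free_of_rank (homology_group 0 (subtopology X {a})) 1"
      by (rule free_of_rank_iso[OF group_relative_homology_group group_integer_group
            homology_coefficients[OF top] free_of_rank_integer_group])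
    then show ?thesis using True by simp
  next
    case False
    then show ?thesis
      using homology_dimension_axiom[OF top, of "int p"] by (simp add: free_of_rank_trivial)
  qed
  then show ?thesis
    by (rule free_of_rank_iso[OF group_relative_homology_group group_relative_homology_group iso])
qed

text \<open>Contractibility of \<open>W\<close> identifies the relative homology with the reduced
  homology of \<open>S\<close> one degree lower. For \<open>c = 0\<close> there is no sphere, and
  the group is the homology of \<open>W\<close> itself.\<close>

lemma free_of_rank_relative_homology_cell:
  assumes W: "contractible_space W" "topspace W \<noteq> {}" and S: "S \<subseteq> topspace W"
    and empty: "c = 0 \<Longrightarrow> S = {}"
    and sphere: "c > 0 \<Longrightarrow> subtopology W S homotopy_equivalent_space nsphere (2 * c - 1)"
  shows "free_of_rank (relative_homology_group (int p) W S) (if p = 2 * c then 1 else 0)"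
proof (cases "c = 0")
  case True
  then show ?thesis using free_of_rank_homology_contractible[OF W, of p] empty by simp
next
  case False
  \<comment> \<open>The shift to reduced homology requires a nonempty \<open>S\<close>, which it
    inherits from the sphere.\<close>
  have ne: "topspace W \<inter> S \<noteq> {}"
  proof
    assume "topspace W \<inter> S = {}"
    then have "topspace (subtopology W S) = {}" by simp
    moreover obtain g where "continuous_map (nsphere (2 * c - 1)) (subtopology W S) g"
      using sphere False unfolding homotopy_equivalent_space_def by blast
    ultimately have "g \<in> topspace (nsphere (2 * c - 1)) \<rightarrow> {}"
      using continuous_map_funspace by metis
    then show False using in_topspace_nsphere[of "2 * c - 1"] by (auto simp: Pi_iff)
  qed
  let ?R = "reduced_homology_group (int p - 1) (nsphere (2 * c - 1))"
  have iso: "relative_homology_group (int p) W S \<cong> ?R"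
    using isomorphic_group_relative_homology_of_contractible[OF W(1) ne, of "int p"]
      homotopy_equivalent_space_imp_isomorphic_reduced_homology_groups[OF sphere, of "int p - 1"] False
      iso_trans by blast
  have "free_of_rank ?R (if p = 2 * c then 1 else 0)"
  proof (cases "p = 2 * c")
    case True
    then have eq: "int p - 1 = int (2 * c - 1)" using False by simp
    have fr: "free_of_rank (reduced_homology_group (int (2 * c - 1)) (nsphere (2 * c - 1))) 1"
      by (rule free_of_rank_iso[OF group_reduced_homology_group group_integer_group
            reduced_homology_group_nsphere(1) free_of_rank_integer_group])
    show ?thesis unfolding eq using fr True by simp
  next
    case False
    then have "int p - 1 \<noteq> int (2 * c - 1)" using \<open>c \<noteq> 0\<close> by simp
    then show ?thesis
      using False reduced_homology_group_nsphere(2) by (simp add: free_of_rank_trivial)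
  qed
  then show ?thesis
    by (rule free_of_rank_iso[OF group_relative_homology_group group_reduced_homology_group iso])
qed

text \<open>By excision the pair \<open>(X, U)\<close> has the homology of
  \<open>(W, W \<inter> U)\<close>, a single infinite cyclic group in degree \<open>2 * c\<close>.
  Its boundary lands in an odd degree of \<open>U\<close>, where the homology vanishes, so the long
  exact sequence breaks up.\<close>

lemma free_of_rank_homology_attach:
  assumes U: "openin X U" and W: "openin X W" and XUW: "topspace X = U \<union> W"
    and contr: "contractible_space (subtopology X W)" and "W \<noteq> {}"
    and empty: "c = 0 \<Longrightarrow> W \<inter> U = {}"
    and sphere: "c > 0 \<Longrightarrow> subtopology X (W \<inter> U) homotopy_equivalent_space nsphere (2 * c - 1)"
    and free: "\<And>p. free_of_rank (homology_group (int p) (subtopology X U)) (m p)"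
    and odd: "\<And>p. odd p \<Longrightarrow> m p = 0"
  shows "free_of_rank (homology_group (int p) X) (m p + (if p = 2 * c then 1 else 0))"
proof -
  have WX: "W \<subseteq> topspace X" "U \<subseteq> topspace X"
    using W U openin_subset by auto
  have rel: "free_of_rank (relative_homology_group (int q) X U) (if q = 2 * c then 1 else 0)" for q
  proof -
    have "closedin X (topspace X - W)" using W by blast
    then have cl: "X closure_of (topspace X - W) \<subseteq> X interior_of U"
      using U XUW by (auto simp: closure_of_closedin interior_of_openin)
    have "relative_homology_group (int q) (subtopology X (topspace X - (topspace X - W)))
            (U - (topspace X - W))
          \<cong> relative_homology_group (int q) (subtopology X (topspace X)) U"
      using homology_excision_axiom[OF cl WX(2), of "int q"] by (rule is_isoI)
    moreover have "topspace X - (topspace X - W) = W" "U - (topspace X - W) = W \<inter> U"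
      using WX by auto
    ultimately have iso: "relative_homology_group (int q) (subtopology X W) (W \<inter> U)
        \<cong> relative_homology_group (int q) X U" by simp
    have "free_of_rank (relative_homology_group (int q) (subtopology X W) (W \<inter> U))
        (if q = 2 * c then 1 else 0)"
    proof (rule free_of_rank_relative_homology_cell[OF contr])
      show "topspace (subtopology X W) \<noteq> {}" "W \<inter> U \<subseteq> topspace (subtopology X W)"
        using WX \<open>W \<noteq> {}\<close> by auto
      assume "c > 0"
      moreover have "subtopology (subtopology X W) (W \<inter> U) = subtopology X (W \<inter> U)"
        by (simp add: subtopology_subtopology)
      ultimately show "subtopology (subtopology X W) (W \<inter> U) homotopy_equivalent_space nsphere (2 * c - 1)"
        using sphere by simp
    qed (rule empty)
    then show ?thesis
      using iso by (meson free_of_rank_iso group.iso_sym group_relative_homology_group)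
  qed
  have rel0: "trivial_group (relative_homology_group (int q) X U)" if "q \<noteq> 2 * c" for q
    using rel[of q] that by (simp add: free_of_rank_0_iff)
  have U0: "trivial_group (homology_group (int q) (subtopology X U))" if "odd q" for q
    using free[of q] odd[OF that] by (simp add: free_of_rank_0_iff)
  let ?j = "hom_induced (int p) (subtopology X U) {} X {} id"
  let ?g = "hom_induced (int p) X {} X U id"
  let ?HU = "homology_group (int p) (subtopology X U)"
  let ?HX = "homology_group (int p) X"
  let ?HR = "relative_homology_group (int p) X U"
  note ex1 = homology_exactness_axiom_1[of "int p" X U]
  note ex2 = homology_exactness_axiom_2[of "int (Suc p)" X U, simplified]
  note ex3 = homology_exactness_axiom_3[of "int p" X U]
  have jker: "kernel ?HU ?HX ?j = hom_boundary (int (Suc p)) X U ` carrier (relative_homology_group (int (Suc p)) X U)"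
    using ex2 by (simp add: add.commute)
  have jg: "kernel ?HX ?HR ?g = ?j ` carrier ?HU" using ex3 by simp
  interpret j: group_hom ?HU ?HX ?j
    by (simp add: group_hom_def group_hom_axioms_def hom_induced_hom)
  interpret g: group_hom ?HX ?HR ?g
    by (simp add: group_hom_def group_hom_axioms_def hom_induced_hom)
  have jinj: "inj_on ?j (carrier ?HU)" if "Suc p \<noteq> 2 * c"
  proof -
    have hb: "hom_boundary (int (Suc p)) X U \<in> hom (relative_homology_group (int (Suc p)) X U) ?HU"
      using hom_boundary_hom[of "int (Suc p)" X U] by simp
    have "carrier (relative_homology_group (int (Suc p)) X U) = {\<one>\<^bsub>relative_homology_group (int (Suc p)) X U\<^esub>}"
      using rel0[OF that] by (simp add: trivial_group_def)
    then have "kernel ?HU ?HX ?j = {\<one>\<^bsub>?HU\<^esub>}"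
      unfolding jker using hom_one[OF hb] by simp
    then show ?thesis using j.inj_iff_trivial_ker by blast
  qed
  \<comment> \<open>In degree \<open>2 * c\<close> a short exact sequence remains; one degree below,
    the homology of \<open>X\<close> sits between two trivial groups; elsewhere the inclusion of
    \<open>U\<close> induces an isomorphism.\<close>
  consider "p = 2 * c" | "Suc p = 2 * c" | "p \<noteq> 2 * c" "Suc p \<noteq> 2 * c" by blast
  then show ?thesis
  proof cases
    case 1
    have "Suc p \<noteq> 2 * c" using 1 by simp
    have kb: "?g ` carrier ?HX = kernel ?HR (homology_group (int p - 1) (subtopology X U)) (hom_boundary (int p) X U)"
      using ex1 by simp
    have "trivial_group (homology_group (int p - 1) (subtopology X U))"
    proof (cases p)
      case 0
      then show ?thesis by simp
    next
      case (Suc k)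
      have "odd k" using Suc 1 by presburger
      moreover have eq: "int p - 1 = int k" using Suc by simp
      ultimately show ?thesis unfolding eq using U0 by blast
    qed
    then have "kernel ?HR (homology_group (int p - 1) (subtopology X U)) (hom_boundary (int p) X U) = carrier ?HR"
      using hom_boundary_carrier[of "int p" X U] by (auto simp: kernel_def trivial_group_def)
    then have surj: "?g ` carrier ?HX = carrier ?HR" using kb by simp
    have "free_of_rank ?HX (Suc (m p))"
    proof (rule free_of_rank_extension[where A = ?HU and C = ?HR])
      show "free_of_rank ?HR 1" using rel[of p] 1 by simp
    qed (use abelian_homology_group jinj[OF \<open>Suc p \<noteq> 2 * c\<close>] surj jg free in \<open>auto simp: hom_induced_hom\<close>)
    then show ?thesis using 1 by simp
  next
    case 2
    then have "odd p" by presburger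
    have "p \<noteq> 2 * c" using 2 by simp
    have "carrier ?HU = {\<one>\<^bsub>?HU\<^esub>}" using U0[OF \<open>odd p\<close>] by (simp add: trivial_group_def)
    then have "kernel ?HX ?HR ?g = {\<one>\<^bsub>?HX\<^esub>}" using jg j.hom_one by simp
    moreover have "kernel ?HX ?HR ?g = carrier ?HX"
      using rel0[OF \<open>p \<noteq> 2 * c\<close>] g.hom_closed by (auto simp: kernel_def trivial_group_def)
    ultimately have "trivial_group ?HX" by (simp add: trivial_group_def)
    then show ?thesis using odd[OF \<open>odd p\<close>] \<open>p \<noteq> 2 * c\<close> by (simp add: free_of_rank_trivial)
  next
    case 3
    have "kernel ?HX ?HR ?g = carrier ?HX"
      using rel0[OF 3(1)] g.hom_closed by (auto simp: kernel_def trivial_group_def)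
    then have "?j \<in> iso ?HU ?HX"
      using jinj[OF 3(2)] jg hom_induced_hom by (auto simp: iso_def bij_betw_def)
    then have "?HX \<cong> ?HU"
      using group.iso_sym[OF group_relative_homology_group is_isoI] by blast
    then show ?thesis using free[of p] 3 free_of_rank_iso[of ?HX ?HU "m p"] by simp
  qed
qed

lemma free_of_rank_homology_charts:
  fixes W :: "'i :: linorder \<Rightarrow> 'a set" and c :: "'i \<Rightarrow> nat"
  assumes "finite I"
    and open_W: "\<And>k. k \<in> I \<Longrightarrow> openin X (W k)"
    and contr: "\<And>k. k \<in> I \<Longrightarrow> contractible_space (subtopology X (W k))"
    and nonempty: "\<And>k. k \<in> I \<Longrightarrow> W k \<noteq> {}"
    and empty: "\<And>k. k \<in> I \<Longrightarrow> c k = 0 \<Longrightarrow> W k \<inter> (\<Union>l\<in>{l\<in>I. l < k}. W l) = {}"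
    and sphere: "\<And>k. k \<in> I \<Longrightarrow> c k > 0 \<Longrightarrow>
      subtopology X (W k \<inter> (\<Union>l\<in>{l\<in>I. l < k}. W l)) homotopy_equivalent_space nsphere (2 * c k - 1)"
  shows "free_of_rank (homology_group (int p) (subtopology X (\<Union>k\<in>I. W k))) (card {k\<in>I. 2 * c k = p})"
proof -
  \<comment> \<open>Induction over initial segments of \<open>I\<close>, so that the greatest index,
    attached last, meets precisely the union over its predecessors.\<close>
  have "free_of_rank (homology_group (int p) (subtopology X (\<Union>k\<in>J. W k))) (card {k\<in>J. 2 * c k = p})"
    if J: "J = {l\<in>I. \<forall>k\<in>J. l \<le> k \<or> l \<in> J}" "finite J" "J \<subseteq> I" "\<And>k l. k \<in> J \<Longrightarrow> l \<in> I \<Longrightarrow> l < k \<Longrightarrow> l \<in> J"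
    for J p
    using J(2,3,4)
  proof (induction J arbitrary: p rule: finite_linorder_max_induct)
    case empty
    then show ?case by (simp add: free_of_rank_trivial trivial_homology_group_empty)
  next
    case (insert k J)
    define U where "U = (\<Union>l\<in>J. W l)"
    define Y where "Y = subtopology X (U \<union> W k)"
    have k: "k \<in> I" using insert by simp
    have J_eq: "J = {l\<in>I. l < k}"
    proof
      show "J \<subseteq> {l\<in>I. l < k}" using insert.prems insert.hyps by auto
      show "{l\<in>I. l < k} \<subseteq> J" using insert.prems(2)[of k] by auto
    qed
    have IH: "free_of_rank (homology_group (int p) (subtopology X U)) (card {k\<in>J. 2 * c k = p})" for p
      unfolding U_def
    proof (rule insert.IH)
      show "l \<in> J" if "k' \<in> J" "l \<in> I" "l < k'" for k' l
        using that J_eq by auto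
    qed (use insert.prems in auto)
    have U: "openin X U" unfolding U_def using open_W insert.prems by (intro openin_Union) auto
    have Wk: "openin X (W k)" using open_W k by blast
    have UW: "openin X (U \<union> W k)" using U Wk by blast
    have sub: "subtopology Y S = subtopology X S" if "S \<subseteq> U \<union> W k" for S
      using that by (simp add: Y_def subtopology_subtopology Int_absorb1)
    have "free_of_rank (homology_group (int p) Y) (card {k\<in>J. 2 * c k = p} + (if p = 2 * c k then 1 else 0))"
    proof (rule free_of_rank_homology_attach[where U = U and W = "W k"])
      show "openin Y U" "openin Y (W k)"
        using U Wk UW by (auto simp: Y_def openin_open_subtopology)
      show "topspace Y = U \<union> W k" using UW openin_subset by (auto simp: Y_def)
      show "contractible_space (subtopology Y (W k))" using contr[OF k] sub by simp
      show "W k \<noteq> {}" using nonempty k by blast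
      show "W k \<inter> U = {}" if "c k = 0" using empty[OF k that] J_eq by (simp add: U_def)
      show "subtopology Y (W k \<inter> U) homotopy_equivalent_space nsphere (2 * c k - 1)" if "c k > 0"
      proof -
        have "subtopology Y (W k \<inter> U) = subtopology X (W k \<inter> U)" by (rule sub) auto
        then show ?thesis using sphere[OF k that] J_eq by (simp add: U_def)
      qed
      show "free_of_rank (homology_group (int q) (subtopology Y U)) (card {k\<in>J. 2 * c k = q})" for q
        using IH[of q] sub by simp
      show "card {k\<in>J. 2 * c k = q} = 0" if "odd q" for q
      proof -
        have "{k\<in>J. 2 * c k = q} = {}" using that by auto
        then show ?thesis by (metis card.empty)
      qed
    qed
    moreover have "Y = subtopology X (\<Union>l\<in>insert k J. W l)"
      by (simp add: Y_def U_def Un_commute)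
    moreover have "card {l\<in>insert k J. 2 * c l = p} = card {k\<in>J. 2 * c k = p} + (if p = 2 * c k then 1 else 0)"
    proof -
      have "k \<notin> J" using insert.hyps by auto
      moreover have "{l\<in>insert k J. 2 * c l = p} =
          (if p = 2 * c k then insert k {k\<in>J. 2 * c k = p} else {k\<in>J. 2 * c k = p})" by auto
      ultimately show ?thesis using insert.hyps(1) by simp
    qed
    ultimately show ?case by simp
  qed
  from this[of I p] show ?thesis using \<open>finite I\<close> by auto
qed


section \<open>Charts with a scaling homotopy\<close>

lemma continuous_map_euclidean_pair:
  assumes "continuous_map X euclidean f" "continuous_map X euclidean g"
  shows "continuous_map X euclidean (\<lambda>x. (f x, g x))"
proof -
  have "continuous_map X (prod_topology euclidean euclidean) (\<lambda>x. (f x, g x))"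
    using assms by (simp only: continuous_map_pairwise o_def fst_conv snd_conv simp_thms)
  then show ?thesis by simp
qed

lemma continuous_map_euclidean_mult:
  fixes f g :: "'a \<Rightarrow> 'b :: real_normed_algebra"
  assumes "continuous_map X euclidean f" "continuous_map X euclidean g"
  shows "continuous_map X euclidean (\<lambda>x. f x * g x)"
proof -
  note 1 = continuous_map_euclidean_pair[OF assms]
  have "continuous_map euclidean euclidean (\<lambda>p::'b \<times> 'b. fst p * snd p)"
    by (auto intro!: continuous_intros)
  from continuous_map_compose[OF 1 this] show ?thesis by (simp add: o_def)
qed

lemma continuous_map_euclidean_add:
  fixes f g :: "'a \<Rightarrow> 'b :: real_normed_vector"
  assumes "continuous_map X euclidean f" "continuous_map X euclidean g"
  shows "continuous_map X euclidean (\<lambda>x. f x + g x)"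
proof -
  note 1 = continuous_map_euclidean_pair[OF assms]
  have "continuous_map euclidean euclidean (\<lambda>p::'b \<times> 'b. fst p + snd p)"
    by (auto intro!: continuous_intros)
  from continuous_map_compose[OF 1 this] show ?thesis by (simp add: o_def)
qed

lemma continuous_map_euclidean_compose:
  assumes "continuous_map X euclidean f" "continuous_on UNIV h"
  shows "continuous_map X euclidean (\<lambda>x. h (f x))"
  using continuous_map_compose[OF assms(1), of euclidean h] assms(2) by (simp add: o_def)

text \<open>Here \<open>g\<close> collects the coordinates whose common zeros are removed,
  \<open>s\<close> is a section of \<open>g\<close> serving as the core of the chart, and
  \<open>\<Theta> l t\<close> scales \<open>g\<close> by \<open>l\<close>, with \<open>t\<close>
  reserved for everything else. At \<open>t = 0\<close> only the core remains.\<close>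

lemma real_cell_homotopy:
  fixes W :: "'a topology" and g :: "'a \<Rightarrow> nat \<Rightarrow> real" and s :: "(nat \<Rightarrow> real) \<Rightarrow> 'a"
    and \<Theta> :: "real \<Rightarrow> real \<Rightarrow> 'a \<Rightarrow> 'a"
  assumes g: "\<And>i. i < d \<Longrightarrow> continuous_map W euclidean (\<lambda>x. g x i)"
    and \<Theta>: "continuous_map (prod_topology (prod_topology euclidean euclidean) W) W (\<lambda>((l, t), x). \<Theta> l t x)"
    and s: "continuous_map (product_topology (\<lambda>_. euclidean) UNIV) W s"
    and \<Theta>1: "\<And>x. x \<in> topspace W \<Longrightarrow> \<Theta> 1 1 x = x"
    and \<Theta>g: "\<And>l t x i. x \<in> topspace W \<Longrightarrow> i < d \<Longrightarrow> g (\<Theta> l t x) i = l * g x i"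
    and \<Theta>0: "\<And>l x. x \<in> topspace W \<Longrightarrow> \<Theta> l 0 x = s (\<lambda>i. if i < d then l * g x i else 0)"
    and gs: "\<And>y i. i < d \<Longrightarrow> g (s y) i = y i"
  shows "contractible_space W"
    and "d > 0 \<Longrightarrow> subtopology W {x. \<exists>i<d. g x i \<noteq> 0} homotopy_equivalent_space nsphere (d - 1)"
proof -
  let ?I = "top_of_set {0..1::real}"
  have fstI: "continuous_map (prod_topology ?I X) euclidean fst" for X :: "'b topology"
    using continuous_map_fst[of ?I X] continuous_map_into_fulltopology by blast
  have \<Theta>_comp: "continuous_map X W (\<lambda>x. \<Theta> (a x) (b x) (c x))"
    if "continuous_map X euclidean a" "continuous_map X euclidean b" "continuous_map X W c"
    for X :: "'b topology" and a b c
  proof -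
    have "continuous_map X (prod_topology (prod_topology euclidean euclidean) W) (\<lambda>x. ((a x, b x), c x))"
      using that by (simp only: continuous_map_pairwise o_def fst_conv snd_conv simp_thms)
    from continuous_map_compose[OF this \<Theta>] show ?thesis by (simp add: o_def)
  qed
  show "contractible_space W"
  proof -
    \<comment> \<open>Both parameters run along the diagonal \<open>l = t\<close>, from the constant
      map to the identity.\<close>
    have "homotopic_with (\<lambda>x. True) W W (\<lambda>x. s (\<lambda>i. 0)) id"
    proof (simp add: homotopic_with, intro exI conjI ballI)
      show "continuous_map (prod_topology ?I W) W (\<lambda>p. \<Theta> (fst p) (fst p) (snd p))"
        by (intro \<Theta>_comp fstI continuous_map_snd)
      show "\<Theta> (fst (0, x)) (fst (0, x)) (snd (0, x)) = s (\<lambda>i. 0)" if "x \<in> topspace W" for x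
        using \<Theta>0[OF that, of 0] by (simp cong: if_cong)
    qed (use \<Theta>1 in auto)
    then show ?thesis
      unfolding contractible_space_def using homotopic_with_symD by blast
  qed
  assume d: "d > 0"
  define W' where "W' = subtopology W {x. \<exists>i<d. g x i \<noteq> 0}"
  define N where "N x = sqrt (\<Sum>i<d. (g x i)\<^sup>2)" for x
  have top_sphere: "topspace (nsphere (d - 1)) = {y. (\<Sum>i<d. (y i)\<^sup>2) = 1 \<and> (\<forall>i\<ge>d. y i = 0)}"
  proof -
    \<comment> \<open>\<open>nsphere (d - 1)\<close> uses the coordinates up to and including
      \<open>d - 1\<close>; these are \<open>d\<close> many only because
      \<open>d > 0\<close>.\<close>
    have "{..d - 1} = {..<d}" "\<And>i. d - 1 < i \<longleftrightarrow> d \<le> i" using d by auto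
    then show ?thesis by (auto simp: nsphere)
  qed
  have sphere: "nsphere (d - 1) = subtopology (product_topology (\<lambda>_. euclidean) UNIV) (topspace (nsphere (d - 1)))"
    by (simp add: nsphere)
  have topW': "topspace W' = {x \<in> topspace W. \<exists>i<d. g x i \<noteq> 0}" by (auto simp: W'_def)
  have N: "N x > 0" if x: "x \<in> topspace W'" for x
  proof -
    obtain i where "i < d" "g x i \<noteq> 0" using x topW' by auto
    then have "0 < (\<Sum>i<d. (g x i)\<^sup>2)" by (intro sum_pos2[of _ i]) auto
    then show ?thesis by (simp add: N_def)
  qed
  have gW': "continuous_map W' euclidean (\<lambda>x. g x i)" if "i < d" for i
    unfolding W'_def by (rule continuous_map_from_subtopology[OF g[OF that]])
  have N_cont: "continuous_map W' euclidean N"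
  proof -
    have "continuous_map W' euclidean (\<lambda>x. \<Sum>i<d. (g x i)\<^sup>2)"
      by (intro continuous_map_sum continuous_map_real_pow gW') auto
    then show ?thesis
      unfolding N_def by (rule continuous_map_euclidean_compose[where h = sqrt]) (auto intro: continuous_intros)
  qed
  have Ninv: "continuous_map W' euclidean (\<lambda>x. inverse (N x))"
    using N by (intro continuous_map_real_inverse N_cont) force
  define f where "f x = (\<lambda>i. if i < d then g x i * inverse (N x) else 0)" for x
  have f_cont: "continuous_map W' (nsphere (d - 1)) f"
  proof -
    have "continuous_map W' (product_topology (\<lambda>_. euclidean) UNIV) f"
      unfolding continuous_map_componentwise_UNIV
    proof
      fix i
      show "continuous_map W' euclidean (\<lambda>x. f x i)"
        unfolding f_def by (cases "i < d") (auto intro!: continuous_map_real_mult gW' Ninv)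
    qed
    moreover have "f x \<in> topspace (nsphere (d - 1))" if x: "x \<in> topspace W'" for x
    proof -
      have "(\<Sum>i<d. (f x i)\<^sup>2) = (\<Sum>i<d. (g x i)\<^sup>2) * (inverse (N x))\<^sup>2"
        unfolding f_def by (simp add: power_mult_distrib sum_distrib_right)
      also have "(\<Sum>i<d. (g x i)\<^sup>2) = (N x)\<^sup>2"
        unfolding N_def by (simp add: sum_nonneg)
      also have "(N x)\<^sup>2 * (inverse (N x))\<^sup>2 = 1"
        using N[OF x] by (simp add: power_inverse)
      finally have "(\<Sum>i<d. (f x i)\<^sup>2) = 1" .
      moreover have "\<forall>i\<ge>d. f x i = 0" by (simp add: f_def)
      ultimately show ?thesis unfolding top_sphere by blast
    qed
    ultimately show ?thesis
      by (subst sphere) (auto simp: continuous_map_in_subtopology)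
  qed
  have s_cont: "continuous_map (nsphere (d - 1)) W' s"
    unfolding W'_def continuous_map_in_subtopology
  proof
    show "continuous_map (nsphere (d - 1)) W s"
      by (subst sphere) (rule continuous_map_from_subtopology[OF s])
    show "s \<in> topspace (nsphere (d - 1)) \<rightarrow> {x. \<exists>i<d. g x i \<noteq> 0}"
    proof
      fix y assume "y \<in> topspace (nsphere (d - 1))"
      then have "(\<Sum>i<d. (y i)\<^sup>2) \<noteq> 0" unfolding top_sphere by auto
      then obtain i where "i < d" "y i \<noteq> 0"
        by (metis (no_types, lifting) lessThan_iff sum.neutral zero_power2)
      then show "s y \<in> {x. \<exists>i<d. g x i \<noteq> 0}" using gs by auto
    qed
  qed
  have fs: "f (s y) = y" if y: "y \<in> topspace (nsphere (d - 1))" for y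
  proof -
    have y': "(\<Sum>i<d. (y i)\<^sup>2) = 1" "\<forall>i\<ge>d. y i = 0" using y unfolding top_sphere by auto
    then have "N (s y) = 1" using gs by (simp add: N_def)
    then show ?thesis using y' gs by (auto simp: f_def)
  qed
  have "homotopic_with (\<lambda>x. True) (nsphere (d - 1)) (nsphere (d - 1)) (f \<circ> s) id"
    using fs by (intro homotopic_with_equal continuous_map_compose[OF s_cont f_cont]) auto
  moreover have "homotopic_with (\<lambda>x. True) W' W' (s \<circ> f) id"
  proof (simp add: homotopic_with, intro exI conjI ballI)
    let ?X = "prod_topology ?I W'"
    \<comment> \<open>The factor runs from \<open>inverse (N x)\<close>, which normalises the point
      onto the sphere, to 1. It stays positive, so the path never leaves \<open>W'\<close>.\<close>
    let ?l = "\<lambda>p. (1 - fst p) * inverse (N (snd p)) + fst p"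
    let ?h = "\<lambda>p. \<Theta> (?l p) (fst p) (snd p)"
    have snd': "continuous_map ?X W' snd" by (rule continuous_map_snd)
    have "continuous_map ?X euclidean ?l"
      using continuous_map_compose[OF snd' Ninv]
      by (intro continuous_map_add continuous_map_real_mult continuous_map_diff fstI)
        (auto simp: o_def)
    moreover have "continuous_map ?X W snd"
      using snd' unfolding W'_def by (simp add: continuous_map_in_subtopology)
    ultimately have h: "continuous_map ?X W ?h" by (intro \<Theta>_comp fstI)
    have pos: "?l (t, x) > 0" if "0 \<le> t" "t \<le> 1" "x \<in> topspace W'" for t x
    proof (cases "t = 0")
      case True
      then show ?thesis using N[OF that(3)] by simp
    next
      case False
      have "0 \<le> (1 - t) * inverse (N x)" using N[OF that(3)] that by simp
      then show ?thesis using False that by simp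
    qed
    have "?h p \<in> {x. \<exists>i<d. g x i \<noteq> 0}" if p: "p \<in> topspace ?X" for p
    proof -
      obtain t x where tx: "p = (t, x)" "0 \<le> t" "t \<le> 1" "x \<in> topspace W'" using p by auto
      obtain i where "i < d" "g x i \<noteq> 0" "x \<in> topspace W" using tx topW' by auto
      then show ?thesis using pos[OF tx(2-4)] \<Theta>g[of x i "?l p" t] tx(1) by auto
    qed
    then show "continuous_map ?X W' ?h"
      using h unfolding W'_def by (auto simp: continuous_map_in_subtopology)
    fix x assume x: "x \<in> topspace W'"
    then have xW: "x \<in> topspace W" by (simp add: topW')
    have "f x = (\<lambda>i. if i < d then inverse (N x) * g x i else 0)" by (auto simp: f_def)
    then show "?h (0, x) = s (f x)" using \<Theta>0[OF xW] by simp
    show "?h (1, x) = x" using \<Theta>1[OF xW] by simp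
  qed
  ultimately have "W' homotopy_equivalent_space nsphere (d - 1)"
    unfolding homotopy_equivalent_space_def using f_cont s_cont by blast
  then show "subtopology W {x. \<exists>i<d. g x i \<noteq> 0} homotopy_equivalent_space nsphere (d - 1)"
    by (simp add: W'_def)
qed

lemma complex_cell_homotopy:
  fixes W :: "'a topology" and g :: "'a \<Rightarrow> nat \<Rightarrow> complex" and s :: "(nat \<Rightarrow> complex) \<Rightarrow> 'a"
    and \<Theta> :: "real \<Rightarrow> real \<Rightarrow> 'a \<Rightarrow> 'a"
  assumes g: "\<And>i. i < c \<Longrightarrow> continuous_map W euclidean (\<lambda>x. g x i)"
    and \<Theta>: "continuous_map (prod_topology (prod_topology euclidean euclidean) W) W (\<lambda>((l, t), x). \<Theta> l t x)"
    and s: "continuous_map (product_topology (\<lambda>_. euclidean) UNIV) W s"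
    and \<Theta>1: "\<And>x. x \<in> topspace W \<Longrightarrow> \<Theta> 1 1 x = x"
    and \<Theta>g: "\<And>l t x i. x \<in> topspace W \<Longrightarrow> i < c \<Longrightarrow> g (\<Theta> l t x) i = of_real l * g x i"
    and \<Theta>0: "\<And>l x. x \<in> topspace W \<Longrightarrow> \<Theta> l 0 x = s (\<lambda>i. if i < c then of_real l * g x i else 0)"
    and gs: "\<And>y i. i < c \<Longrightarrow> g (s y) i = y i"
  shows "contractible_space W"
    and "c > 0 \<Longrightarrow> subtopology W {x. \<exists>i<c. g x i \<noteq> 0} homotopy_equivalent_space nsphere (2 * c - 1)"
proof -
  \<comment> \<open>Real and imaginary parts are interleaved: the real coordinates
    \<open>2 * i\<close> and \<open>2 * i + 1\<close> come from the \<open>i\<close>-th complex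
    one.\<close>
  define g' where "g' x i = (if even i then Re (g x (i div 2)) else Im (g x (i div 2)))" for x i
  define s' where "s' y = s (\<lambda>i. Complex (y (2 * i)) (y (2 * i + 1)))" for y :: "nat \<Rightarrow> real"
  have g'_cont: "continuous_map W euclidean (\<lambda>x. g' x i)" if "i < 2 * c" for i
  proof -
    have *: "continuous_map W euclidean (\<lambda>x. g x (i div 2))" using that by (intro g) auto
    show ?thesis
      unfolding g'_def
      by (cases "even i") (simp_all add: continuous_map_euclidean_compose[OF *] continuous_intros)
  qed
  have s'_cont: "continuous_map (product_topology (\<lambda>_. euclidean) UNIV) W s'"
  proof -
    have "continuous_map (product_topology (\<lambda>_. euclidean) UNIV) (product_topology (\<lambda>_. euclidean) UNIV)
        (\<lambda>y (i :: nat). Complex (y (2 * i)) (y (2 * i + 1)) :: complex)"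
      unfolding continuous_map_componentwise_UNIV
    proof
      fix i :: nat
      have proj: "continuous_map (product_topology (\<lambda>_. euclidean) UNIV) euclidean
          (\<lambda>y. complex_of_real (y j))" for j :: nat
      proof -
        have "continuous_map (product_topology (\<lambda>_. euclidean) UNIV) euclidean (\<lambda>y. y j :: real)"
          by (rule continuous_map_product_projection) simp
        then show ?thesis
          by (rule continuous_map_euclidean_compose[where h = of_real]) (auto intro: continuous_intros)
      qed
      have "continuous_map (product_topology (\<lambda>_. euclidean) UNIV) euclidean
          (\<lambda>y. complex_of_real (y (2 * i)) + \<i> * complex_of_real (y (2 * i + 1)))"
        by (intro continuous_map_euclidean_add continuous_map_euclidean_mult proj) auto
      then show "continuous_map (product_topology (\<lambda>_. euclidean) UNIV) euclidean
          (\<lambda>y. Complex (y (2 * i)) (y (2 * i + 1)))"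
        by (simp add: Complex_eq)
    qed
    from continuous_map_compose[OF this s] show ?thesis by (simp add: s'_def[abs_def] o_def)
  qed
  have \<Theta>0': "\<Theta> l 0 x = s' (\<lambda>i. if i < 2 * c then l * g' x i else 0)" if x: "x \<in> topspace W" for l x
  proof -
    have "(\<lambda>i. if i < c then of_real l * g x i else 0) =
        (\<lambda>i. Complex (if 2 * i < 2 * c then l * g' x (2 * i) else 0)
                     (if 2 * i + 1 < 2 * c then l * g' x (2 * i + 1) else 0))"
      by (rule ext) (auto simp: g'_def complex_eq_iff)
    then show ?thesis by (simp only: \<Theta>0[OF x] s'_def)
  qed
  have \<Theta>g': "g' (\<Theta> l t x) i = l * g' x i" if "x \<in> topspace W" "i < 2 * c" for l t x i
    using \<Theta>g[OF that(1), of "i div 2" l t] that(2) by (auto simp: g'_def)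
  have gs': "g' (s' y) i = y i" if "i < 2 * c" for y i
    using gs[of "i div 2"] that by (auto simp: g'_def s'_def)
  note * = real_cell_homotopy[where W = W and \<Theta> = \<Theta> and g = g' and s = s' and d = "2 * c",
      OF g'_cont \<Theta> s'_cont \<Theta>1 \<Theta>g' \<Theta>0' gs']
  show "contractible_space W" using * by blast
  have "(\<exists>i<2 * c. g' x i \<noteq> 0) \<longleftrightarrow> (\<exists>i<c. g x i \<noteq> 0)" for x
  proof
    assume "\<exists>i<2 * c. g' x i \<noteq> 0"
    then obtain i where "i < 2 * c" "g' x i \<noteq> 0" by blast
    then show "\<exists>i<c. g x i \<noteq> 0" by (intro exI[of _ "i div 2"]) (auto simp: g'_def split: if_splits)
  next
    assume "\<exists>i<c. g x i \<noteq> 0"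
    then obtain i where i: "i < c" "g x i \<noteq> 0" by blast
    then have "g' x (2 * i) \<noteq> 0 \<or> g' x (2 * i + 1) \<noteq> 0" by (auto simp: g'_def complex_eq_iff)
    then show "\<exists>i<2 * c. g' x i \<noteq> 0"
    proof
      assume "g' x (2 * i) \<noteq> 0"
      then show ?thesis using i(1) by (intro exI[of _ "2 * i"]) auto
    next
      assume "g' x (2 * i + 1) \<noteq> 0"
      then show ?thesis using i(1) by (intro exI[of _ "2 * i + 1"]) auto
    qed
  qed
  then show "subtopology W {x. \<exists>i<c. g x i \<noteq> 0} homotopy_equivalent_space nsphere (2 * c - 1)" if "c > 0"
    using *(2) that by simp
qed

text \<open>A renumbering only: the charts index their coordinates naturally by a tag for the kind
  of datum together with a position.\<close>

lemma indexed_cell_homotopy: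
  fixes W :: "'a topology" and g :: "'a \<Rightarrow> 'i \<Rightarrow> complex" and s :: "('i \<Rightarrow> complex) \<Rightarrow> 'a"
    and \<Theta> :: "real \<Rightarrow> real \<Rightarrow> 'a \<Rightarrow> 'a"
  assumes S: "finite S" "card S = c"
    and g: "\<And>i. i \<in> S \<Longrightarrow> continuous_map W euclidean (\<lambda>x. g x i)"
    and \<Theta>: "continuous_map (prod_topology (prod_topology euclidean euclidean) W) W (\<lambda>((l, t), x). \<Theta> l t x)"
    and s: "continuous_map (product_topology (\<lambda>_. euclidean) UNIV) W s"
    and \<Theta>1: "\<And>x. x \<in> topspace W \<Longrightarrow> \<Theta> 1 1 x = x"
    and \<Theta>g: "\<And>l t x i. x \<in> topspace W \<Longrightarrow> i \<in> S \<Longrightarrow> g (\<Theta> l t x) i = of_real l * g x i"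
    and \<Theta>0: "\<And>l x. x \<in> topspace W \<Longrightarrow> \<Theta> l 0 x = s (\<lambda>i. if i \<in> S then of_real l * g x i else 0)"
    and gs: "\<And>y i. i \<in> S \<Longrightarrow> g (s y) i = y i"
  shows "contractible_space W"
    and "c > 0 \<Longrightarrow> subtopology W {x. \<exists>i\<in>S. g x i \<noteq> 0} homotopy_equivalent_space nsphere (2 * c - 1)"
proof -
  obtain e where e: "bij_betw e {..<c} S"
    using ex_bij_betw_nat_finite[OF S(1)] S(2) by (auto simp: atLeast0LessThan)
  define e' where "e' = inv_into {..<c} e"
  have e': "e' i < c" "e (e' i) = i" if "i \<in> S" for i
    using e that bij_betw_inv_into_right[OF e that] bij_betw_apply[OF bij_betw_inv_into[OF e] that]
    by (auto simp: e'_def)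
  have eS: "e k \<in> S" "e' (e k) = k" if "k < c" for k
    using e that bij_betw_inv_into_left[OF e] bij_betw_apply[OF e] by (auto simp: e'_def)
  define g' where "g' x k = g x (e k)" for x k
  define s' where "s' y = s (\<lambda>i. if i \<in> S then y (e' i) else 0)" for y :: "nat \<Rightarrow> complex"
  have "continuous_map (product_topology (\<lambda>_. euclidean) UNIV) (product_topology (\<lambda>_. euclidean) UNIV)
      (\<lambda>y i. if i \<in> S then y (e' i) else (0 :: complex))"
    unfolding continuous_map_componentwise_UNIV
  proof
    fix i
    show "continuous_map (product_topology (\<lambda>_. euclidean) UNIV) euclidean
        (\<lambda>y. if i \<in> S then y (e' i) else (0 :: complex))"
      by (cases "i \<in> S") (auto intro: continuous_map_product_projection)
  qed
  from continuous_map_compose[OF this s]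
  have s'_cont: "continuous_map (product_topology (\<lambda>_. euclidean) UNIV) W s'"
    by (simp add: s'_def[abs_def] o_def)
  have g'_cont: "continuous_map W euclidean (\<lambda>x. g' x k)" if "k < c" for k
    unfolding g'_def by (rule g[OF eS(1)[OF that]])
  have \<Theta>g': "g' (\<Theta> l t x) k = of_real l * g' x k" if "x \<in> topspace W" "k < c" for l t x k
    unfolding g'_def by (rule \<Theta>g[OF that(1) eS(1)[OF that(2)]])
  have \<Theta>0': "\<Theta> l 0 x = s' (\<lambda>k. if k < c then of_real l * g' x k else 0)" if "x \<in> topspace W" for l x
  proof -
    have "(\<lambda>i. if i \<in> S then of_real l * g x i else 0) =
        (\<lambda>i. if i \<in> S then (if e' i < c then of_real l * g' x (e' i) else 0) else 0)"
      by (rule ext) (auto simp: g'_def e')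
    then show ?thesis unfolding \<Theta>0[OF that] s'_def by simp
  qed
  have gs': "g' (s' y) k = y k" if "k < c" for y k
    unfolding g'_def s'_def using gs[OF eS(1)[OF that]] eS[OF that] by simp
  note * = complex_cell_homotopy[where W = W and \<Theta> = \<Theta> and g = g' and s = s' and c = c,
      OF g'_cont \<Theta> s'_cont \<Theta>1 \<Theta>g' \<Theta>0' gs']
  show "contractible_space W" using * by blast
  have "{x. \<exists>i<c. g' x i \<noteq> 0} = {x. \<exists>i\<in>S. g x i \<noteq> 0}"
    unfolding g'_def using eS e' by (metis (no_types, opaque_lifting))
  then show "subtopology W {x. \<exists>i\<in>S. g x i \<noteq> 0} homotopy_equivalent_space nsphere (2 * c - 1)" if "c > 0"
  proof -
    have "subtopology W {x. \<exists>i<c. g' x i \<noteq> 0} homotopy_equivalent_space nsphere (2 * c - 1)"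
      using * that by blast
    then show ?thesis using \<open>{x. \<exists>i<c. g' x i \<noteq> 0} = _\<close> by simp
  qed
qed


section \<open>Submodules of the free module\<close>

type_synonym vec = "nat \<Rightarrow>\<^sub>0 mpoly"

definition smul :: "mpoly \<Rightarrow> vec \<Rightarrow> vec" where
  "smul p = Poly_Mapping.map ((*) p)"

abbreviation const :: "complex \<Rightarrow> mpoly" where
  "const c \<equiv> Poly_Mapping.single 0 c"

definition xvar :: "nat \<Rightarrow> mpoly" where
  "xvar l = Poly_Mapping.single (Poly_Mapping.single l 1) 1"

abbreviation csmul :: "complex \<Rightarrow> vec \<Rightarrow> vec" where
  "csmul c \<equiv> smul (const c)"

abbreviation evec :: "nat \<Rightarrow> vec" where
  "evec k \<equiv> Poly_Mapping.single k 1"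

definition mon_vec :: "(nat \<Rightarrow>\<^sub>0 nat) \<Rightarrow> nat \<Rightarrow> vec" where
  "mon_vec m k = Poly_Mapping.single k (Poly_Mapping.single m 1)"

abbreviation vecs :: "nat \<Rightarrow> nat \<Rightarrow> vec set" where
  "vecs n r \<equiv> carrier (free_module n r)"

abbreviation polys :: "nat \<Rightarrow> mpoly set" where
  "polys n \<equiv> carrier (coordinate_ring n)"

lemma lookup_smul: "Poly_Mapping.lookup (smul p v) j = p * Poly_Mapping.lookup v j"
  by (simp add: smul_def Poly_Mapping.map.rep_eq when_def)

lemma smul_simps:
  "smul p (v + w) = smul p v + smul p w" "smul (p + q) v = smul p v + smul q v"
  "smul (p * q) v = smul p (smul q v)" "smul 1 v = v" "smul 0 v = 0" "smul p (0::vec) = 0"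
  "smul p (- v) = - smul p v" "smul p (v - w) = smul p v - smul p w" "smul (- p) v = - smul p v"
  "smul (p - q) v = smul p v - smul q v"
  by (rule poly_mapping_eqI; simp add: lookup_smul lookup_add lookup_minus algebra_simps)+

lemma smul_trivial [simp]: "smul 1 v = v" "smul 0 v = 0" "smul p 0 = 0"
  by (rule smul_simps)+

lemma smul_sum: "smul p (\<Sum>i\<in>I. f i) = (\<Sum>i\<in>I. smul p (f i))"
  by (induction I rule: infinite_finite_induct) (simp_all add: smul_simps)

lemma sum_smul: "smul (\<Sum>i\<in>I. f i) v = (\<Sum>i\<in>I. smul (f i) v)"
  by (induction I rule: infinite_finite_induct) (simp_all add: smul_simps)

lemma smul_commute: "smul p (smul q v) = smul q (smul p v)"
  by (metis mult.commute smul_simps(3))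

lemma csmul_csmul: "csmul a (csmul b v) = csmul (a * b) v"
  by (simp add: smul_simps(3)[symmetric] mult_single)

lemma csmul_one: "csmul 1 v = v"
  by (metis single_one smul_simps(4))

lemma csmul_add_left: "csmul (a + b) v = csmul a v + csmul b v"
  by (simp add: single_add smul_simps)

lemma csmul_minus_left: "csmul (- a) v = - csmul a v"
  by (simp add: single_uminus smul_simps)

lemma csmul_zero: "csmul 0 v = 0"
  by (simp add: smul_simps)

lemma csmul_diff_left: "csmul (a - b) v = csmul a v - csmul b v"
  using csmul_add_left[of a "- b" v] by (simp add: csmul_minus_left)

lemma smul_mon: "smul (Poly_Mapping.single m c) (csmul d (mon_vec m' k)) = csmul (c * d) (mon_vec (m + m') k)"
  by (rule poly_mapping_eqI) (simp add: lookup_smul mon_vec_def lookup_single when_def mult_single)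

lemma smul_mon': "smul (Poly_Mapping.single m 1) (mon_vec m' k) = mon_vec (m + m') k"
  by (rule poly_mapping_eqI) (simp add: lookup_smul mon_vec_def lookup_single when_def mult_single)

lemma mon_vec_eq: "mon_vec m k = smul (Poly_Mapping.single m 1) (evec k)"
  by (rule poly_mapping_eqI) (simp add: lookup_smul mon_vec_def lookup_single when_def)

lemma polys_iff: "p \<in> polys n \<longleftrightarrow> (\<forall>m\<in>Poly_Mapping.keys p. Poly_Mapping.keys m \<subseteq> {..<n})"
  by (simp add: coordinate_ring_def)

lemma vecs_iff:
  "v \<in> vecs n r \<longleftrightarrow> Poly_Mapping.keys v \<subseteq> {..<r} \<and> (\<forall>j. Poly_Mapping.lookup v j \<in> polys n)"
  by (simp add: free_module_def)

lemma const_polys: "const c \<in> polys n"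
  by (auto simp: polys_iff)

lemma single_polys: "Poly_Mapping.keys m \<subseteq> {..<n} \<Longrightarrow> Poly_Mapping.single m c \<in> polys n"
  by (auto simp: polys_iff)

lemma xvar_polys: "l < n \<Longrightarrow> xvar l \<in> polys n"
  by (auto simp: polys_iff xvar_def)

lemma polys_closed:
  assumes "p \<in> polys n" "q \<in> polys n"
  shows "p + q \<in> polys n" "p * q \<in> polys n" "- p \<in> polys n" "p - q \<in> polys n"
proof -
  interpret cring "coordinate_ring n" by (rule cring_coordinate_ring)
  show "p + q \<in> polys n" "p * q \<in> polys n"
    using add.m_closed[OF assms] m_closed[OF assms] by (simp_all add: coordinate_ring_def)
  have *: "- p \<in> polys n" if "p \<in> polys n" for p using that by (simp add: polys_iff)
  show "- p \<in> polys n" using * assms(1) by blast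
  show "p - q \<in> polys n"
    using add.m_closed[OF assms(1) *[OF assms(2)]] by (simp add: coordinate_ring_def)
qed

lemma vecs_0: "0 \<in> vecs n r"
  by (simp add: vecs_iff polys_iff)

lemma vecs_add: "v \<in> vecs n r \<Longrightarrow> w \<in> vecs n r \<Longrightarrow> v + w \<in> vecs n r"
  using Poly_Mapping.keys_add[of v w] by (auto simp: vecs_iff lookup_add polys_closed)

lemma vecs_uminus: "v \<in> vecs n r \<Longrightarrow> - v \<in> vecs n r"
  unfolding vecs_iff by (auto simp: polys_iff)

lemma vecs_diff: "v \<in> vecs n r \<Longrightarrow> w \<in> vecs n r \<Longrightarrow> v - w \<in> vecs n r"
  using vecs_add[of v n r "- w"] vecs_uminus by simp

lemma vecs_smul: "p \<in> polys n \<Longrightarrow> v \<in> vecs n r \<Longrightarrow> smul p v \<in> vecs n r"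
  unfolding vecs_iff by (auto simp: lookup_smul polys_closed in_keys_iff subset_iff)

lemma vecs_csmul: "v \<in> vecs n r \<Longrightarrow> csmul c v \<in> vecs n r"
  by (rule vecs_smul[OF const_polys])

lemma evec_vecs: "k < r \<Longrightarrow> evec k \<in> vecs n r"
  by (auto simp: vecs_iff polys_iff lookup_single when_def)

lemma mon_vecs: "k < r \<Longrightarrow> Poly_Mapping.keys m \<subseteq> {..<n} \<Longrightarrow> mon_vec m k \<in> vecs n r"
  unfolding mon_vec_eq by (intro vecs_smul single_polys evec_vecs)

lemma sum_single_keys: "p = (\<Sum>m\<in>Poly_Mapping.keys p. Poly_Mapping.single m (Poly_Mapping.lookup p m))"
proof (rule poly_mapping_eqI)
  fix k
  show "Poly_Mapping.lookup p k
    = Poly_Mapping.lookup (\<Sum>m\<in>Poly_Mapping.keys p. Poly_Mapping.single m (Poly_Mapping.lookup p m)) k"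
    by (simp add: lookup_sum lookup_single when_def in_keys_iff)
qed

lemma vec_expansion:
  "v = (\<Sum>k\<in>Poly_Mapping.keys v. \<Sum>m\<in>Poly_Mapping.keys (Poly_Mapping.lookup v k).
          csmul (Poly_Mapping.lookup (Poly_Mapping.lookup v k) m) (mon_vec m k))"
proof -
  have *: "(\<Sum>m\<in>Poly_Mapping.keys p. csmul (Poly_Mapping.lookup p m) (mon_vec m k)) = Poly_Mapping.single k p"
    for p :: mpoly and k
  proof -
    have "csmul c (mon_vec m k) = Poly_Mapping.single k (Poly_Mapping.single m c)" for c m
      by (rule poly_mapping_eqI) (simp add: lookup_smul mon_vec_def lookup_single when_def mult_single)
    moreover have "(\<Sum>m\<in>S. Poly_Mapping.single k (f m)) = Poly_Mapping.single k (\<Sum>m\<in>S. f m)"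
      for S and f :: "(nat \<Rightarrow>\<^sub>0 nat) \<Rightarrow> mpoly"
      by (induction S rule: infinite_finite_induct) (simp_all add: single_add)
    ultimately show ?thesis using sum_single_keys[of p] by simp
  qed
  show ?thesis unfolding * by (rule sum_single_keys)
qed

lemma vec_induct [consumes 1, case_names zero add mon]:
  assumes v: "v \<in> vecs n r" and P0: "P 0"
    and add: "\<And>v w. v \<in> vecs n r \<Longrightarrow> w \<in> vecs n r \<Longrightarrow> P v \<Longrightarrow> P w \<Longrightarrow> P (v + w)"
    and mon: "\<And>c m k. k < r \<Longrightarrow> Poly_Mapping.keys m \<subseteq> {..<n} \<Longrightarrow> P (csmul c (mon_vec m k))"
  shows "P v"
proof -
  have sum: "(\<Sum>i\<in>I. f i) \<in> vecs n r \<and> P (\<Sum>i\<in>I. f i)"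
    if "\<And>i. i \<in> I \<Longrightarrow> f i \<in> vecs n r \<and> P (f i)" for I :: "'x set" and f
    using that by (induction I rule: infinite_finite_induct) (auto intro: P0 add vecs_0 vecs_add)
  have "P (\<Sum>k\<in>Poly_Mapping.keys v. \<Sum>m\<in>Poly_Mapping.keys (Poly_Mapping.lookup v k).
          csmul (Poly_Mapping.lookup (Poly_Mapping.lookup v k) m) (mon_vec m k))"
  proof (rule sum[THEN conjunct2], rule sum, intro conjI)
    fix k m assume "k \<in> Poly_Mapping.keys v" "m \<in> Poly_Mapping.keys (Poly_Mapping.lookup v k)"
    then have "k < r" "Poly_Mapping.keys m \<subseteq> {..<n}" using v by (auto simp: vecs_iff polys_iff)
    then show "csmul (Poly_Mapping.lookup (Poly_Mapping.lookup v k) m) (mon_vec m k) \<in> vecs n r"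
      "P (csmul (Poly_Mapping.lookup (Poly_Mapping.lookup v k) m) (mon_vec m k))"
      by (auto intro: mon vecs_csmul mon_vecs)
  qed
  then show ?thesis using vec_expansion[of v] by simp
qed

lemma monomial_induct [consumes 1, case_names zero step]:
  assumes "Poly_Mapping.keys m \<subseteq> {..<n}" and P0: "P (0 :: nat \<Rightarrow>\<^sub>0 nat)"
    and step: "\<And>l m. l < n \<Longrightarrow> Poly_Mapping.keys m \<subseteq> {..<n} \<Longrightarrow> P m \<Longrightarrow> P (Poly_Mapping.single l 1 + m)"
  shows "P m"
  using assms(1)
proof (induction "\<Sum>l<n. Poly_Mapping.lookup m l" arbitrary: m rule: less_induct)
  case less
  show ?case
  proof (cases "m = 0")
    case False
    then obtain l where l: "l \<in> Poly_Mapping.keys m" by (metis equals0I keys_eq_empty)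
    define m' where "m' = m - Poly_Mapping.single l 1"
    have m: "m = Poly_Mapping.single l 1 + m'"
      using l by (intro poly_mapping_eqI) (auto simp: m'_def lookup_add lookup_minus lookup_single when_def in_keys_iff)
    have ln: "l < n" using l less.prems by auto
    have keys: "Poly_Mapping.keys m' \<subseteq> {..<n}"
      using less.prems by (auto simp: m'_def in_keys_iff lookup_minus subset_iff)
    have "(\<Sum>l<n. Poly_Mapping.lookup m l) = (\<Sum>k<n. (if k = l then 1 else 0) + Poly_Mapping.lookup m' k)"
      unfolding m by (intro sum.cong) (auto simp: lookup_add lookup_single when_def)
    also have "\<dots> = 1 + (\<Sum>l<n. Poly_Mapping.lookup m' l)"
      using ln by (simp add: sum.distrib)
    finally have "P m'" using less.hyps[of m'] keys by simp
    then show ?thesis using step[OF ln keys] m by simp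
  qed (simp add: P0)
qed

lemma submodule_iff:
  "submodule K (coordinate_ring n) (free_module n r) \<longleftrightarrow>
     K \<subseteq> vecs n r \<and> 0 \<in> K \<and> (\<forall>v\<in>K. \<forall>w\<in>K. v + w \<in> K) \<and> (\<forall>p\<in>polys n. \<forall>v\<in>K. smul p v \<in> K)"
proof -
  interpret M: module "coordinate_ring n" "free_module n r" by (rule module_free_module)
  have ops: "v \<oplus>\<^bsub>free_module n r\<^esub> w = v + w" "p \<odot>\<^bsub>free_module n r\<^esub> v = smul p v"
    "\<zero>\<^bsub>free_module n r\<^esub> = 0" for v w p
    by (simp_all add: free_module_def smul_def)
  have neg: "\<ominus>\<^bsub>free_module n r\<^esub> v = - v" if "v \<in> vecs n r" for v
    using that vecs_uminus[OF that] by (intro M.minus_equality) (simp_all add: ops)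
  show ?thesis (is "?L \<longleftrightarrow> ?R")
  proof
    assume ?L
    then interpret S: submodule K "coordinate_ring n" "free_module n r" .
    show ?R
      using S.subset S.one_closed S.m_closed S.smult_closed by (simp add: ops)
  next
    assume R: ?R
    show ?L
    proof (rule M.submoduleI)
      fix v assume v: "v \<in> K"
      have "smul (const (-1)) v \<in> K" using R v const_polys by blast
      then show "\<ominus>\<^bsub>free_module n r\<^esub> v \<in> K"
        using R v by (subst neg) (auto simp: csmul_minus_left csmul_one)
    qed (use R in \<open>auto simp: ops\<close>)
  qed
qed

abbreviation submod :: "nat \<Rightarrow> nat \<Rightarrow> vec set \<Rightarrow> bool" where
  "submod n r K \<equiv> submodule K (coordinate_ring n) (free_module n r)"

lemma submodD:
  assumes "submod n r K"
  shows "K \<subseteq> vecs n r" "0 \<in> K" "v \<in> K \<Longrightarrow> w \<in> K \<Longrightarrow> v + w \<in> K" "p \<in> polys n \<Longrightarrow> v \<in> K \<Longrightarrow> smul p v \<in> K"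
    "v \<in> K \<Longrightarrow> csmul c v \<in> K" "v \<in> K \<Longrightarrow> - v \<in> K" "v \<in> K \<Longrightarrow> w \<in> K \<Longrightarrow> v - w \<in> K"
proof -
  note * = assms[unfolded submodule_iff]
  show "K \<subseteq> vecs n r" "0 \<in> K" "v \<in> K \<Longrightarrow> w \<in> K \<Longrightarrow> v + w \<in> K" "p \<in> polys n \<Longrightarrow> v \<in> K \<Longrightarrow> smul p v \<in> K"
    using * by blast+
  show cs: "v \<in> K \<Longrightarrow> csmul c v \<in> K" for v c using * const_polys by blast
  show neg: "v \<in> K \<Longrightarrow> - v \<in> K" for v
    using cs[of v "-1"] by (simp add: csmul_minus_left csmul_one)
  show "v \<in> K \<Longrightarrow> w \<in> K \<Longrightarrow> v - w \<in> K" using * neg[of w] by (metis add_uminus_conv_diff)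
qed

lemma submodI_monomials:
  assumes "K \<subseteq> vecs n r" "0 \<in> K" and add: "\<And>v w. v \<in> K \<Longrightarrow> w \<in> K \<Longrightarrow> v + w \<in> K"
    and csm: "\<And>c v. v \<in> K \<Longrightarrow> csmul c v \<in> K"
    and x: "\<And>l v. l < n \<Longrightarrow> v \<in> K \<Longrightarrow> smul (xvar l) v \<in> K"
  shows "submod n r K"
  unfolding submodule_iff
proof (intro conjI ballI)
  fix p v assume p: "p \<in> polys n" and v: "v \<in> K"
  have mono: "smul (Poly_Mapping.single m c) v \<in> K" if "Poly_Mapping.keys m \<subseteq> {..<n}" for m c
    using that
  proof (induction m rule: monomial_induct)
    case zero
    then show ?case using csm v by simp
  next
    case (step l m)
    have "Poly_Mapping.single (Poly_Mapping.single l 1 + m) c = xvar l * Poly_Mapping.single m c"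
      by (simp add: mult_single xvar_def)
    then show ?case using x[OF step(1) step(3)] by (simp only: smul_simps)
  qed
  have "(\<Sum>i\<in>I. f i) \<in> K" if "\<And>i. i \<in> I \<Longrightarrow> f i \<in> K" for I :: "'x set" and f
    using that by (induction I rule: infinite_finite_induct) (auto simp: assms(2) add)
  from this[of "Poly_Mapping.keys p" "\<lambda>m. smul (Poly_Mapping.single m (Poly_Mapping.lookup p m)) v"]
  have "(\<Sum>m\<in>Poly_Mapping.keys p. smul (Poly_Mapping.single m (Poly_Mapping.lookup p m)) v) \<in> K"
    using mono p by (auto simp: polys_iff)
  then show "smul p v \<in> K" by (subst sum_single_keys[of p]) (simp add: sum_smul)
qed (use assms in auto)


section \<open>Simple subquotients are one-dimensional\<close>

text \<open>There are only countably many monomial vectors. The contrast with the uncountable field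
  is what forces simple subquotients to be one-dimensional.\<close>

lemma vecs_countably_spanned:
  "\<exists>e :: nat \<Rightarrow> vec. \<forall>v\<in>vecs n r. \<exists>N f. v = (\<Sum>i<N. csmul (f i) (e i))"
proof -
  define S where "S = {m :: nat \<Rightarrow>\<^sub>0 nat. Poly_Mapping.keys m \<subseteq> {..<n}}"
  have "inj_on (\<lambda>m. map (Poly_Mapping.lookup m) [0..<n]) S"
  proof (rule inj_onI, rule poly_mapping_eqI)
    fix m m' k assume *: "m \<in> S" "m' \<in> S"
      "map (Poly_Mapping.lookup m) [0..<n] = map (Poly_Mapping.lookup m') [0..<n]"
    show "Poly_Mapping.lookup m k = Poly_Mapping.lookup m' k"
    proof (cases "k < n")
      case False
      then have "k \<notin> Poly_Mapping.keys m" "k \<notin> Poly_Mapping.keys m'" using * by (auto simp: S_def)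
      then show ?thesis by (simp add: in_keys_iff)
    qed (use *(3) in auto)
  qed
  then have "countable S" by (rule countable_image_inj_on[rotated]) simp
  define B where "B = (\<lambda>(m, k). mon_vec m k) ` (S \<times> {..<r})"
  have B: "countable B" unfolding B_def using \<open>countable S\<close> by auto
  define e where "e = from_nat_into B"
  have extend: "(\<Sum>i<N. csmul (f i) (e i)) = (\<Sum>i<M. csmul (if i < N then f i else 0) (e i))" if "N \<le> M" for N M f
    using that by (intro sum.mono_neutral_cong_left) (auto simp: csmul_zero)
  show ?thesis
  proof (rule exI, rule ballI)
    fix v assume "v \<in> vecs n r"
    then show "\<exists>N f. v = (\<Sum>i<N. csmul (f i) (e i))"
    proof (induction v rule: vec_induct)
      case zero
      show ?case by (intro exI[of _ 0]) simp
    next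
      case (add v w)
      obtain N f where v: "v = (\<Sum>i<N. csmul (f i) (e i))" using add by blast
      obtain M g where w: "w = (\<Sum>i<M. csmul (g i) (e i))" using add by blast
      note * = v w
      have "v + w = (\<Sum>i<max N M. csmul (if i < N then f i else 0) (e i))
          + (\<Sum>i<max N M. csmul (if i < M then g i else 0) (e i))"
        unfolding * by (subst (1 2) extend[of _ "max N M"]) auto
      also have "\<dots> = (\<Sum>i<max N M. csmul ((if i < N then f i else 0) + (if i < M then g i else 0)) (e i))"
        by (simp add: sum.distrib csmul_add_left)
      finally show ?case
        by (intro exI[of _ "max N M"] exI[of _ "\<lambda>i. (if i < N then f i else 0) + (if i < M then g i else 0)"])
    next
      case (mon c m k)
      then have "mon_vec m k \<in> B" by (auto simp: B_def S_def)
      then have "e (to_nat_on B (mon_vec m k)) = mon_vec m k"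
        unfolding e_def using B by (rule from_nat_into_to_nat_on[rotated])
      then have "csmul c (mon_vec m k) = (\<Sum>i<Suc (to_nat_on B (mon_vec m k)).
          csmul (if i = to_nat_on B (mon_vec m k) then c else 0) (e i))"
        by (simp add: csmul_zero if_distrib[of csmul] if_distribR csmul_zero cong: if_cong)
      then show ?case
        by (intro exI[of _ "Suc (to_nat_on B (mon_vec m k))"]
            exI[of _ "\<lambda>i. if i = to_nat_on B (mon_vec m k) then c else 0"])
    qed
  qed
qed

text \<open>Each vector is a combination of the first \<open>N x\<close> generators. By
  uncountability some value \<open>M\<close> of \<open>N\<close> is attained infinitely often, and
  \<open>Suc M\<close> of those vectors are dependent.\<close>

lemma uncountable_family_dependent:
  fixes u :: "real \<Rightarrow> vec"
  assumes "\<And>x. u x \<in> vecs n r"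
  shows "\<exists>\<Lambda> a. finite \<Lambda> \<and> (\<exists>x\<in>\<Lambda>. a x \<noteq> 0) \<and> (\<Sum>x\<in>\<Lambda>. csmul (a x) (u x)) = 0"
proof -
  obtain e :: "nat \<Rightarrow> vec" where e: "\<And>v. v \<in> vecs n r \<Longrightarrow> \<exists>N f. v = (\<Sum>i<N. csmul (f i) (e i))"
    using vecs_countably_spanned[of n r] by blast
  have "\<forall>x. \<exists>N f. u x = (\<Sum>i<N. csmul (f i) (e i))" using e assms by blast
  from choice[OF this] obtain N where "\<forall>x. \<exists>f. u x = (\<Sum>i<N x. csmul (f i) (e i))" by blast
  from choice[OF this] obtain f where Nf: "\<And>x. u x = (\<Sum>i<N x. csmul (f x i) (e i))" by blast
  have "\<exists>M. infinite {x. N x = M}"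
  proof (rule ccontr)
    assume "\<nexists>M. infinite {x. N x = M}"
    then have "countable (\<Union>M. {x. N x = M})" by (intro countable_UN) (auto intro: countable_finite)
    moreover have "(\<Union>M. {x. N x = M}) = UNIV" by auto
    ultimately show False using uncountable_UNIV_real by simp
  qed
  then obtain M where "infinite {x. N x = M}" by blast
  then obtain \<Lambda> where \<Lambda>: "finite \<Lambda>" "card \<Lambda> = Suc M" "\<Lambda> \<subseteq> {x. N x = M}"
    using infinite_arbitrarily_large by blast
  obtain a where a: "\<exists>x\<in>\<Lambda>. a x \<noteq> 0" "\<forall>i<M. (\<Sum>x\<in>\<Lambda>. a x * f x i) = 0"
    using linear_dependence_idom[of \<Lambda> M f] \<Lambda> by auto
  have "(\<Sum>x\<in>\<Lambda>. csmul (a x) (u x)) = (\<Sum>x\<in>\<Lambda>. \<Sum>i<M. csmul (a x * f x i) (e i))"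
    using \<Lambda>(3) by (intro sum.cong) (auto simp: Nf smul_sum csmul_csmul)
  also have "\<dots> = (\<Sum>i<M. \<Sum>x\<in>\<Lambda>. csmul (a x * f x i) (e i))" by (rule sum.swap)
  also have "\<dots> = (\<Sum>i<M. csmul (\<Sum>x\<in>\<Lambda>. a x * f x i) (e i))"
  proof (intro sum.cong refl)
    fix i
    show "(\<Sum>x\<in>\<Lambda>. csmul (a x * f x i) (e i)) = csmul (\<Sum>x\<in>\<Lambda>. a x * f x i) (e i)"
      using \<Lambda>(1) by (induction \<Lambda> rule: finite_induct) (auto simp: csmul_zero csmul_add_left)
  qed
  also have "\<dots> = 0" using a(2) by (simp add: csmul_zero)
  finally show ?thesis using a \<Lambda>(1) by blast
qed

definition poly_at :: "nat \<Rightarrow> complex poly \<Rightarrow> mpoly" where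
  "poly_at l q = poly (map_poly const q) (xvar l)"

lemma poly_at_0 [simp]: "poly_at l 0 = 0"
  by (simp add: poly_at_def)

lemma poly_at_pCons: "poly_at l (pCons a q) = const a + xvar l * poly_at l q"
  by (simp add: poly_at_def map_poly_pCons)

lemma poly_at_add: "poly_at l (p + q) = poly_at l p + poly_at l q"
  by (induction p q rule: poly_induct2) (simp_all add: poly_at_pCons single_add algebra_simps)

lemma poly_at_smult: "poly_at l (smult a q) = const a * poly_at l q"
  by (induction q) (simp_all add: poly_at_pCons mult_single algebra_simps)

lemma poly_at_mult: "poly_at l (p * q) = poly_at l p * poly_at l q"
  by (induction p) (simp_all add: poly_at_pCons poly_at_add poly_at_smult algebra_simps)

lemma poly_at_sum: "poly_at l (\<Sum>i\<in>I. f i) = (\<Sum>i\<in>I. poly_at l (f i))"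
  by (induction I rule: infinite_finite_induct) (simp_all add: poly_at_add)

lemma poly_at_polys: "l < n \<Longrightarrow> poly_at l q \<in> polys n"
proof (induction q)
  case 0
  show ?case by (simp add: polys_iff)
next
  case (pCons a q)
  then show ?case
    unfolding poly_at_pCons by (intro polys_closed const_polys xvar_polys)
qed

lemma poly_at_linear: "poly_at l [:- \<mu>, 1:] = xvar l - const \<mu>"
  by (simp add: poly_at_pCons single_uminus)

locale simple_subquotient =
  fixes n r :: nat and N1 N2 :: "vec set"
  assumes N1: "submod n r N1" and N2: "submod n r N2" and less: "N1 \<subset> N2"
    and simple: "\<And>P. submod n r P \<Longrightarrow> N1 \<subseteq> P \<Longrightarrow> P \<subseteq> N2 \<Longrightarrow> P = N1 \<or> P = N2"
begin

text \<open>Schur's lemma in countable dimension. If no \<open>xvar l - const \<mu>\<close> acted as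
  zero, all of them would be invertible on the simple subquotient. Applying the inverses for real
  \<open>\<mu>\<close> to one vector \<open>s\<close> gives an uncountable family, hence a linear
  relation; clearing denominators, a nonzero polynomial in \<open>xvar l\<close> kills
  \<open>s\<close>, against the invertibility of its linear factors.\<close>

lemma acts_by_scalar:
  assumes l: "l < n"
  shows "\<exists>\<mu>. \<forall>w\<in>N2. smul (xvar l - const \<mu>) w \<in> N1"
proof (rule ccontr)
  assume neg: "\<not> ?thesis"
  note N1D = submodD[OF N1] and N2D = submodD[OF N2]
  define T where "T \<mu> = xvar l - const \<mu>" for \<mu>
  have T: "T \<mu> \<in> polys n" for \<mu>
    unfolding T_def by (intro polys_closed xvar_polys l const_polys)
  have N12: "N1 \<subseteq> N2" using less by blast
  \<comment> \<open>The kernel of \<open>T \<mu>\<close> on the subquotient is a submodule, and by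
    assumption it is not everything.\<close>
  have inj: "w \<in> N1" if w: "w \<in> N2" "smul (T \<mu>) w \<in> N1" for \<mu> w
  proof -
    let ?P = "{w\<in>N2. smul (T \<mu>) w \<in> N1}"
    have "submod n r ?P"
    proof (rule submodI_monomials)
      fix k v assume k: "k < n" and v: "v \<in> ?P"
      have "smul (T \<mu>) v \<in> N1" using v by blast
      then have "smul (xvar k) (smul (T \<mu>) v) \<in> N1" by (rule N1D(4)[OF xvar_polys[OF k]])
      then have "smul (T \<mu>) (smul (xvar k) v) \<in> N1" by (subst smul_commute)
      moreover have "smul (xvar k) v \<in> N2" using v by (intro N2D(4) xvar_polys k) auto
      ultimately show "smul (xvar k) v \<in> ?P" by blast
    next
      fix c v assume v: "v \<in> ?P"
      have "smul (T \<mu>) v \<in> N1" using v by blast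
      then have "csmul c (smul (T \<mu>) v) \<in> N1" by (rule N1D(5))
      then have "smul (T \<mu>) (csmul c v) \<in> N1" by (subst smul_commute)
      moreover have "csmul c v \<in> N2" using v by (intro N2D(5)) auto
      ultimately show "csmul c v \<in> ?P" by blast
    qed (use N2D(1-3) N1D(2,3) in \<open>auto simp: smul_simps\<close>)
    moreover have "N1 \<subseteq> ?P" using N12 N1D(4) T by auto
    moreover have "?P \<noteq> N2" using neg unfolding T_def by blast
    ultimately have "?P = N1" using simple[of ?P] by blast
    then show ?thesis using w by blast
  qed
  \<comment> \<open>The image of \<open>T \<mu>\<close> on the subquotient is a submodule too, and
    by assumption it is not zero.\<close>
  have surj: "\<exists>u\<in>N2. w - smul (T \<mu>) u \<in> N1" if w: "w \<in> N2" for w \<mu>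
  proof -
    let ?P = "{w\<in>N2. \<exists>u\<in>N2. w - smul (T \<mu>) u \<in> N1}"
    have "submod n r ?P"
    proof (rule submodI_monomials)
      fix k v assume k: "k < n" and v: "v \<in> ?P"
      then obtain u where u: "u \<in> N2" "v - smul (T \<mu>) u \<in> N1" by blast
      have "smul (xvar k) v - smul (T \<mu>) (smul (xvar k) u) = smul (xvar k) (v - smul (T \<mu>) u)"
        by (simp only: smul_simps smul_commute)
      then have "smul (xvar k) v - smul (T \<mu>) (smul (xvar k) u) \<in> N1"
        using N1D(4)[OF xvar_polys[OF k] u(2)] by metis
      moreover have "smul (xvar k) v \<in> N2" "smul (xvar k) u \<in> N2"
        using N2D(4) xvar_polys[OF k] u v by blast+
      ultimately show "smul (xvar k) v \<in> ?P" by blast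
    next
      fix c v assume v: "v \<in> ?P"
      then obtain u where u: "u \<in> N2" "v - smul (T \<mu>) u \<in> N1" by blast
      have "csmul c v - smul (T \<mu>) (csmul c u) = csmul c (v - smul (T \<mu>) u)"
        by (simp only: smul_simps smul_commute)
      then have "csmul c v - smul (T \<mu>) (csmul c u) \<in> N1"
        using N1D(5)[OF u(2)] by metis
      moreover have "csmul c v \<in> N2" "csmul c u \<in> N2" using N2D(5) u v by blast+
      ultimately show "csmul c v \<in> ?P" by blast
    next
      fix v w assume v: "v \<in> ?P" and w: "w \<in> ?P"
      obtain u where u: "u \<in> N2" "v - smul (T \<mu>) u \<in> N1" using v by blast
      obtain u' where u': "u' \<in> N2" "w - smul (T \<mu>) u' \<in> N1" using w by blast
      have "(v - smul (T \<mu>) u) + (w - smul (T \<mu>) u') = v + w - smul (T \<mu>) (u + u')"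
        by (simp add: smul_simps)
      then have "v + w - smul (T \<mu>) (u + u') \<in> N1" using u u' N1D(3) by metis
      then show "v + w \<in> ?P" using v w u u' N2D(3) by blast
    next
      show "0 \<in> ?P" using N2D(2) N1D(2) by (auto intro!: bexI[of _ 0] simp: smul_simps)
    qed (use N2D(1) in blast)
    moreover have "N1 \<subseteq> ?P"
      using N12 N2D(2) by (auto intro!: bexI[of _ 0] simp: smul_simps)
    moreover have "?P \<noteq> N1"
    proof
      assume P: "?P = N1"
      have "smul (T \<mu>) u \<in> N1" if u: "u \<in> N2" for u
      proof -
        have "smul (T \<mu>) u \<in> ?P" using u N2D(4) T N1D(2) by (auto intro!: bexI[of _ u])
        then show ?thesis using P by simp
      qed
      then show False using neg unfolding T_def by blast
    qed
    ultimately have "?P = N2" using simple[of ?P] by blast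
    then show ?thesis using w by blast
  qed
  obtain s where s: "s \<in> N2" "s \<notin> N1" using less by blast
  have "\<forall>x::real. \<exists>u\<in>N2. s - smul (T (of_real x)) u \<in> N1" using surj[OF s(1)] by blast
  then obtain u where u: "\<And>x::real. u x \<in> N2" "\<And>x. s - smul (T (of_real x)) (u x) \<in> N1" by metis
  obtain \<Lambda> a where \<Lambda>: "finite \<Lambda>" "\<exists>x\<in>\<Lambda>. a x \<noteq> 0" "(\<Sum>x\<in>\<Lambda>. csmul (a x) (u x)) = 0"
    using uncountable_family_dependent[of u n r] u(1) N2D(1) by blast
  define L where "L x = [:- complex_of_real x, 1:]" for x
  have L: "poly_at l (L x) = T (of_real x)" for x
    unfolding L_def T_def by (rule poly_at_linear)
  \<comment> \<open>The numerator of the sum of \<open>a x / (X - x)\<close> over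
    \<open>\<Lambda>\<close>: multiplying the relation between the \<open>u x\<close> by all linear
    factors clears the inverses.\<close>
  define q where "q = (\<Sum>x\<in>\<Lambda>. smult (a x) (\<Prod>y\<in>\<Lambda> - {x}. L y))"
  have q_s: "smul (poly_at l q) s \<in> N1"
  proof -
    let ?Q = "\<lambda>x. poly_at l (\<Prod>y\<in>\<Lambda> - {x}. L y)"
    have sum_N1: "(\<Sum>x\<in>I. f x) \<in> N1" if "\<And>x. x \<in> I \<Longrightarrow> f x \<in> N1" for I :: "real set" and f
      using that by (induction I rule: infinite_finite_induct) (auto intro: N1D(2,3))
    have *: "csmul (a x) (smul (?Q x) (s - smul (T (of_real x)) (u x))) \<in> N1" if "x \<in> \<Lambda>" for x
      by (intro N1D(5) N1D(4) poly_at_polys l u(2))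
    have "(\<Sum>x\<in>\<Lambda>. csmul (a x) (smul (?Q x) (s - smul (T (of_real x)) (u x)))) \<in> N1"
      by (rule sum_N1) (rule *)
    moreover have "csmul (a x) (smul (?Q x) (s - smul (T (of_real x)) (u x)))
        = smul (poly_at l (smult (a x) (\<Prod>y\<in>\<Lambda> - {x}. L y))) s - smul (poly_at l (\<Prod>y\<in>\<Lambda>. L y)) (csmul (a x) (u x))"
      if "x \<in> \<Lambda>" for x
    proof -
      have "(\<Prod>y\<in>\<Lambda>. L y) = (\<Prod>y\<in>\<Lambda> - {x}. L y) * L x"
        using \<Lambda>(1) that by (subst prod.remove[of \<Lambda> x]) (auto simp: mult.commute)
      then have "poly_at l (\<Prod>y\<in>\<Lambda>. L y) = ?Q x * T (of_real x)"
        by (simp only: poly_at_mult L)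
      then show ?thesis
        by (simp only: poly_at_smult smul_simps smul_commute[of _ "const (a x)"])
    qed
    ultimately have "(\<Sum>x\<in>\<Lambda>. smul (poly_at l (smult (a x) (\<Prod>y\<in>\<Lambda> - {x}. L y))) s
        - smul (poly_at l (\<Prod>y\<in>\<Lambda>. L y)) (csmul (a x) (u x))) \<in> N1"
      by (metis (no_types, lifting) sum.cong)
    moreover have "(\<Sum>x\<in>\<Lambda>. smul (poly_at l (smult (a x) (\<Prod>y\<in>\<Lambda> - {x}. L y))) s
        - smul (poly_at l (\<Prod>y\<in>\<Lambda>. L y)) (csmul (a x) (u x)))
       = smul (poly_at l q) s - smul (poly_at l (\<Prod>y\<in>\<Lambda>. L y)) (\<Sum>x\<in>\<Lambda>. csmul (a x) (u x))"
      by (simp only: sum_subtractf q_def poly_at_sum sum_smul smul_sum)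
    ultimately show ?thesis using \<Lambda>(3) by (simp add: smul_simps)
  qed
  have "q \<noteq> 0"
  proof -
    obtain x0 where x0: "x0 \<in> \<Lambda>" "a x0 \<noteq> 0" using \<Lambda> by blast
    \<comment> \<open>At the node \<open>x0\<close> every product vanishes except the one that omits
      \<open>x0\<close>.\<close>
    have "poly q (of_real x0) = (\<Sum>x\<in>\<Lambda>. a x * (\<Prod>y\<in>\<Lambda> - {x}. complex_of_real x0 - of_real y))"
      by (simp add: q_def poly_sum poly_prod L_def)
    also have "\<dots> = (\<Sum>x\<in>\<Lambda>. if x = x0 then a x * (\<Prod>y\<in>\<Lambda> - {x}. complex_of_real x0 - of_real y) else 0)"
      using \<Lambda>(1) x0 by (intro sum.cong) auto
    also have "\<dots> = a x0 * (\<Prod>y\<in>\<Lambda> - {x0}. complex_of_real x0 - of_real y)"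
      using \<Lambda>(1) x0 by simp
    finally have "poly q (of_real x0) \<noteq> 0" using x0 \<Lambda>(1) by auto
    then show ?thesis by auto
  qed
  \<comment> \<open>Linear factors of \<open>q\<close> are stripped one at a time, each being
    injective modulo \<open>N1\<close>, until a nonzero constant is left.\<close>
  moreover have "w \<in> N1" if "w \<in> N2" "q \<noteq> 0" "smul (poly_at l q) w \<in> N1" for q w
    using that
  proof (induction "degree q" arbitrary: q w rule: less_induct)
    case less
    show ?case
    proof (cases "degree q = 0")
      case True
      then obtain c where q: "q = [:c:]" "c \<noteq> 0"
        using less.prems by (metis degree_eq_zeroE pCons_0_0)
      then have "csmul c w \<in> N1" using less.prems(3) by (simp add: poly_at_pCons)
      then have "csmul (inverse c) (csmul c w) \<in> N1" by (rule N1D(5))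
      then show ?thesis using q by (simp add: csmul_csmul csmul_one)
    next
      case False
      then obtain z where "poly q z = 0"
        using fundamental_theorem_of_algebra[of q] constant_degree[of q] by auto
      then obtain q' where q': "q = [:- z, 1:] * q'" using poly_eq_0_iff_dvd by (metis dvdE)
      have q'0: "q' \<noteq> 0" using less.prems(2) q' by auto
      have "degree q = Suc (degree q')"
        unfolding q' using q'0 by (subst degree_mult_eq) auto
      moreover have "smul (poly_at l q') w \<in> N1"
      proof (rule inj)
        show "smul (poly_at l q') w \<in> N2" using less.prems(1) N2D(4) poly_at_polys[OF l] by blast
        show "smul (T z) (smul (poly_at l q') w) \<in> N1"
          using less.prems(3) unfolding q' poly_at_mult poly_at_linear T_def by (simp only: smul_simps)
      qed
      ultimately show ?thesis using less.hyps[of q' w] less.prems(1) q'0 by simp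
    qed
  qed
  ultimately show False using q_s s by blast
qed

text \<open>Since every variable acts by a scalar, the span of \<open>w\<close> and
  \<open>N1\<close> is already a submodule, and simplicity makes it all of
  \<open>N2\<close>.\<close>

lemma one_dimensional:
  assumes w: "w \<in> N2" "w \<notin> N1" and w': "w' \<in> N2"
  shows "\<exists>c. w' - csmul c w \<in> N1"
proof -
  note N1D = submodD[OF N1] and N2D = submodD[OF N2]
  let ?P = "{w'\<in>N2. \<exists>c. w' - csmul c w \<in> N1}"
  have "submod n r ?P"
  proof (rule submodI_monomials)
    fix l v assume l: "l < n" and v: "v \<in> ?P"
    obtain \<mu> where \<mu>: "\<forall>w\<in>N2. smul (xvar l - const \<mu>) w \<in> N1" using acts_by_scalar[OF l] by blast
    obtain c where c: "v - csmul c w \<in> N1" using v by blast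
    have "smul (xvar l - const \<mu>) v + csmul \<mu> (v - csmul c w) \<in> N1"
      using \<mu> v c by (intro N1D(3) N1D(5)) auto
    moreover have "smul (xvar l - const \<mu>) v + csmul \<mu> (v - csmul c w) = smul (xvar l) v - csmul (\<mu> * c) w"
      by (simp add: smul_simps csmul_csmul)
    ultimately show "smul (xvar l) v \<in> ?P" using v N2D(4) xvar_polys[OF l] by auto
  next
    fix c v assume v: "v \<in> ?P"
    then obtain d where "v - csmul d w \<in> N1" by blast
    then have "csmul c (v - csmul d w) \<in> N1" by (rule N1D(5))
    then have "csmul c v - csmul (c * d) w \<in> N1" by (simp add: smul_simps csmul_csmul)
    then show "csmul c v \<in> ?P" using v N2D(5) by blast
  next
    fix v v' assume v: "v \<in> ?P" and v': "v' \<in> ?P"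
    obtain c d where "v - csmul c w \<in> N1" "v' - csmul d w \<in> N1" using v v' by blast
    then have "(v - csmul c w) + (v' - csmul d w) \<in> N1" by (rule N1D(3))
    then have "v + v' - csmul (c + d) w \<in> N1" by (simp add: csmul_add_left algebra_simps)
    then show "v + v' \<in> ?P" using v v' N2D(3) by blast
  qed (use N2D N1D(2) in \<open>auto intro!: exI[of _ 0] simp: csmul_zero\<close>)
  moreover have "N1 \<subseteq> ?P" using less by (auto intro!: exI[of _ 0] simp: csmul_zero)
  moreover have "w \<in> ?P" using w N1D(2) by (auto intro!: exI[of _ 1] simp: csmul_one)
  ultimately have "?P = N2" using simple[of ?P] w by blast
  then show ?thesis using w' by blast
qed

end


section \<open>Quotients of dimension two and commuting matrices\<close>

type_synonym c2 = "complex \<times> complex"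

text \<open>A matrix is the pair of its columns.\<close>
type_synonym mat2 = "c2 \<times> c2"

section \<open>Matrices and monomials acting on the plane\<close>

definition sc :: "complex \<Rightarrow> c2 \<Rightarrow> c2" where
  "sc c p = (c * fst p, c * snd p)"

definition det2 :: "c2 \<Rightarrow> c2 \<Rightarrow> complex" where
  "det2 p q = fst p * snd q - snd p * fst q"

definition app :: "mat2 \<Rightarrow> c2 \<Rightarrow> c2" where
  "app A p = sc (fst p) (fst A) + sc (snd p) (snd A)"

lemma sc_simps:
  "sc c (p + q) = sc c p + sc c q" "sc (a + b) p = sc a p + sc b p" "sc a (sc b p) = sc (a * b) p"
  "sc 1 p = p" "sc 0 p = 0" "sc c 0 = 0" "sc (- c) p = - sc c p" "sc c (p - q) = sc c p - sc c q"
  by (simp_all add: sc_def prod_eq_iff algebra_simps)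

lemma app_linear: "app A (p + q) = app A p + app A q" "app A (sc c p) = sc c (app A p)" "app A 0 = 0"
  by (simp_all add: app_def sc_def prod_eq_iff algebra_simps)

lemma app_basis: "app A (1, 0) = fst A" "app A (0, 1) = snd A"
  by (simp_all add: app_def sc_simps)

definition ev :: "((nat \<Rightarrow>\<^sub>0 nat) \<Rightarrow> nat \<Rightarrow> c2) \<Rightarrow> vec \<Rightarrow> c2" where
  "ev \<rho> v = (\<Sum>k\<in>Poly_Mapping.keys v. \<Sum>m\<in>Poly_Mapping.keys (Poly_Mapping.lookup v k).
      sc (Poly_Mapping.lookup (Poly_Mapping.lookup v k) m) (\<rho> m k))"

lemma sum_keys_add:
  fixes f :: "'k \<Rightarrow> 'b::monoid_add \<Rightarrow> 'c::comm_monoid_add"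
  assumes "\<And>k. f k 0 = 0" "\<And>k a b. f k (a + b) = f k a + f k b"
  shows "(\<Sum>k\<in>Poly_Mapping.keys (v + w). f k (Poly_Mapping.lookup (v + w) k)) =
    (\<Sum>k\<in>Poly_Mapping.keys v. f k (Poly_Mapping.lookup v k)) +
    (\<Sum>k\<in>Poly_Mapping.keys w. f k (Poly_Mapping.lookup w k))"
proof -
  let ?S = "Poly_Mapping.keys v \<union> Poly_Mapping.keys w"
  have *: "(\<Sum>k\<in>Poly_Mapping.keys u. f k (Poly_Mapping.lookup u k)) = (\<Sum>k\<in>?S. f k (Poly_Mapping.lookup u k))"
    if "Poly_Mapping.keys u \<subseteq> ?S" for u
    using that by (intro sum.mono_neutral_left) (auto simp: in_keys_iff assms)
  have "(\<Sum>k\<in>Poly_Mapping.keys (v + w). f k (Poly_Mapping.lookup (v + w) k))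
      = (\<Sum>k\<in>?S. f k (Poly_Mapping.lookup (v + w) k))"
    by (rule *) (rule Poly_Mapping.keys_add)
  then show ?thesis
    by (simp add: *[of v] *[of w] lookup_add assms sum.distrib)
qed

lemma ev_add: "ev \<rho> (v + w) = ev \<rho> v + ev \<rho> w"
  unfolding ev_def
  by (rule sum_keys_add[where f = "\<lambda>k p. \<Sum>m\<in>Poly_Mapping.keys p. sc (Poly_Mapping.lookup p m) (\<rho> m k)"])
    (auto intro!: sum_keys_add simp: sc_simps)

lemma ev_zero: "ev \<rho> 0 = 0"
  by (simp add: ev_def)

lemma ev_mon: "ev \<rho> (csmul c (mon_vec m k)) = sc c (\<rho> m k)"
proof -
  have "csmul c (mon_vec m k) = Poly_Mapping.single k (Poly_Mapping.single m c)"
    by (rule poly_mapping_eqI) (simp add: lookup_smul mon_vec_def lookup_single when_def mult_single)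
  moreover have "Poly_Mapping.single m c \<noteq> 0" if "c \<noteq> 0"
    using that by (metis lookup_single_eq lookup_zero)
  ultimately show ?thesis by (cases "c = 0") (simp_all add: ev_def sc_simps)
qed

text \<open>The product of matrix powers belonging to the monomial \<open>m\<close>, taken in a
  fixed order of the variables. Its multiplicativity in \<open>m\<close> comes from the matrices
  commuting.\<close>

fun mact :: "nat \<Rightarrow> (nat \<Rightarrow> mat2) \<Rightarrow> (nat \<Rightarrow>\<^sub>0 nat) \<Rightarrow> c2 \<Rightarrow> c2" where
  "mact 0 A m = id"
| "mact (Suc n) A m = (app (A n) ^^ Poly_Mapping.lookup m n) \<circ> mact n A m"

definition commuting :: "nat \<Rightarrow> (nat \<Rightarrow> mat2) \<Rightarrow> bool" where
  "commuting n A \<longleftrightarrow> (\<forall>k<n. \<forall>l<n. \<forall>p. app (A k) (app (A l) p) = app (A l) (app (A k) p))"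

lemma funpow_commute:
  assumes "\<And>p. f (g p) = g (f p)"
  shows "(f ^^ k) (g p) = g ((f ^^ k) p)"
  using assms by (induction k) auto

lemma mact_linear:
  "mact n A m (p + q) = mact n A m p + mact n A m q" "mact n A m (sc c p) = sc c (mact n A m p)"
proof -
  have "(app B ^^ k) (p + q) = (app B ^^ k) p + (app B ^^ k) q"
    "(app B ^^ k) (sc c p) = sc c ((app B ^^ k) p)" for B k p q c
    by (induction k) (simp_all add: app_linear)
  then show "mact n A m (p + q) = mact n A m p + mact n A m q" "mact n A m (sc c p) = sc c (mact n A m p)"
    by (induction n) simp_all
qed

lemma mact_commute:
  assumes "commuting N A" "n \<le> N" "l < N"
  shows "mact n A m (app (A l) p) = app (A l) (mact n A m p)"
  using assms(2)
proof (induction n)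
  case (Suc n)
  have "(app (A n) ^^ k) (app (A l) p) = app (A l) ((app (A n) ^^ k) p)" for k p
    by (rule funpow_commute) (use assms Suc in \<open>auto simp: commuting_def\<close>)
  then show ?case using Suc by simp
qed simp

lemma mact_commute_pow:
  assumes "commuting N A" "n \<le> N" "l < N"
  shows "mact n A m ((app (A l) ^^ k) p) = (app (A l) ^^ k) (mact n A m p)"
  using funpow_commute[of "app (A l)" "mact n A m" k p] mact_commute[OF assms] by simp

lemma mact_add:
  assumes "commuting N A" "n \<le> N"
  shows "mact n A (m + m') p = mact n A m (mact n A m' p)"
  using assms(2)
proof (induction n arbitrary: p)
  case (Suc n)
  then show ?case
    using mact_commute_pow[OF assms(1), of n n] by (simp add: lookup_add funpow_add)
qed simp

lemma mact_zero: "mact n A 0 = id"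
  by (induction n) auto

lemma mact_single: "l < n \<Longrightarrow> mact n A (Poly_Mapping.single l 1) = app (A l)"
proof -
  have *: "mact n A (Poly_Mapping.single l 1) = (if l < n then app (A l) else id)"
    by (induction n) (auto simp: lookup_single when_def less_Suc_eq)
  show "l < n \<Longrightarrow> ?thesis" using * by simp
qed

text \<open>For commuting \<open>A\<close> this is the module homomorphism to the plane, with the
  variables acting through \<open>A\<close>, that sends the \<open>k\<close>-th generator to
  \<open>v k\<close>.\<close>

definition \<Phi> :: "nat \<Rightarrow> (nat \<Rightarrow> mat2) \<Rightarrow> (nat \<Rightarrow> c2) \<Rightarrow> vec \<Rightarrow> c2" where
  "\<Phi> n A v = ev (\<lambda>m k. mact n A m (v k))"

definition point_of :: "nat \<Rightarrow> nat \<Rightarrow> (nat \<Rightarrow> mat2) \<Rightarrow> (nat \<Rightarrow> c2) \<Rightarrow> vec set" where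
  "point_of n r A v = {w \<in> vecs n r. \<Phi> n A v w = 0}"

lemma \<Phi>_add: "\<Phi> n A v (w + w') = \<Phi> n A v w + \<Phi> n A v w'"
  by (simp add: \<Phi>_def ev_add)

lemma \<Phi>_zero: "\<Phi> n A v 0 = 0"
  by (simp add: \<Phi>_def ev_zero)

lemma \<Phi>_mon: "\<Phi> n A v (csmul c (mon_vec m k)) = sc c (mact n A m (v k))"
  by (simp add: \<Phi>_def ev_mon)

lemma \<Phi>_smul_single:
  assumes "commuting n A" "w \<in> vecs n r"
  shows "\<Phi> n A v (smul (Poly_Mapping.single m c) w) = sc c (mact n A m (\<Phi> n A v w))"
  using assms(2)
proof (induction w rule: vec_induct)
  case zero
  have "mact n A m 0 = 0" using mact_linear(2)[of n A m 0 0] by (simp add: sc_simps)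
  then show ?case by (simp add: \<Phi>_zero sc_simps)
next
  case (add w w')
  then show ?case by (simp add: smul_simps \<Phi>_add mact_linear sc_simps)
next
  case (mon d m' k)
  then show ?case
    by (simp add: smul_mon \<Phi>_mon mact_add[OF assms(1) order_refl] mact_linear sc_simps)
qed

lemma \<Phi>_csmul: "w \<in> vecs n r \<Longrightarrow> commuting n A \<Longrightarrow> \<Phi> n A v (csmul c w) = sc c (\<Phi> n A v w)"
  by (simp add: \<Phi>_smul_single mact_zero)

lemma \<Phi>_xvar: "w \<in> vecs n r \<Longrightarrow> commuting n A \<Longrightarrow> l < n \<Longrightarrow> \<Phi> n A v (smul (xvar l) w) = app (A l) (\<Phi> n A v w)"
  unfolding xvar_def by (subst \<Phi>_smul_single) (auto simp: mact_single sc_simps simp del: One_nat_def)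

lemma \<Phi>_evec: "\<Phi> n A v (evec k) = v k"
proof -
  have "evec k = csmul 1 (mon_vec 0 k)" by (simp add: mon_vec_def)
  then show ?thesis by (simp only: \<Phi>_mon mact_zero sc_simps id_apply)
qed

text \<open>The quotient by \<open>K\<close> identified with the plane in such a way that
  \<open>b\<close> becomes the standard basis; surjectivity follows from the values at
  \<open>b\<close>. The two sources of such a \<open>\<phi>\<close> are the chart coordinates
  \<open>coord K b\<close> and the map \<open>\<Phi>\<close> of commuting matrices.\<close>

locale quotient_functional =
  fixes n r :: nat and K :: "vec set" and \<phi> :: "vec \<Rightarrow> c2" and b :: "nat \<Rightarrow> vec"
  assumes K: "submod n r K"
    and \<phi>_add: "\<And>v w. v \<in> vecs n r \<Longrightarrow> w \<in> vecs n r \<Longrightarrow> \<phi> (v + w) = \<phi> v + \<phi> w"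
    and \<phi>_csmul: "\<And>c v. v \<in> vecs n r \<Longrightarrow> \<phi> (csmul c v) = sc c (\<phi> v)"
    and ker: "\<And>v. v \<in> vecs n r \<Longrightarrow> v \<in> K \<longleftrightarrow> \<phi> v = 0"
    and b: "b 0 \<in> vecs n r" "b (Suc 0) \<in> vecs n r" and \<phi>b: "\<phi> (b 0) = (1, 0)" "\<phi> (b (Suc 0)) = (0, 1)"
begin

lemma diff: "v \<in> vecs n r \<Longrightarrow> w \<in> vecs n r \<Longrightarrow> \<phi> (v - w) = \<phi> v - \<phi> w"
  using \<phi>_add[of v "csmul (- 1) w"] \<phi>_csmul[of w "- 1"] vecs_csmul[of w n r "- 1"]
  by (simp add: csmul_minus_left sc_simps)

lemma diff_in_K: "v \<in> vecs n r \<Longrightarrow> w \<in> vecs n r \<Longrightarrow> v - w \<in> K \<longleftrightarrow> \<phi> v = \<phi> w"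
  using ker[of "v - w"] vecs_diff diff by auto

end

definition lc :: "c2 \<Rightarrow> (nat \<Rightarrow> vec) \<Rightarrow> vec" where
  "lc p b = csmul (fst p) (b 0) + csmul (snd p) (b (Suc 0))"

lemma lincomb_2: "lincomb 2 c b = lc (c 0, c (Suc 0)) b"
  by (simp add: lincomb_def lc_def smul_def numeral_2_eq_2)

text \<open>Extensional functions on two indices are pairs, which lets coordinates be treated as
  vectors of the plane.\<close>

lemma quotient_basis_iff:
  "quotient_basis 2 n r K b \<longleftrightarrow> b 0 \<in> vecs n r \<and> b (Suc 0) \<in> vecs n r \<and> (\<forall>v\<in>vecs n r. \<exists>!p. v - lc p b \<in> K)"
proof -
  have "(\<exists>!c. c \<in> {..<2} \<rightarrow>\<^sub>E UNIV \<and> v - lincomb 2 c b \<in> K) \<longleftrightarrow> (\<exists>!p. v - lc p b \<in> K)" for v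
  proof
    assume "\<exists>!c. c \<in> {..<2} \<rightarrow>\<^sub>E UNIV \<and> v - lincomb 2 c b \<in> K"
    then obtain c where c0: "c \<in> {..<2} \<rightarrow>\<^sub>E UNIV \<and> v - lincomb 2 c b \<in> K"
      and u0: "\<forall>c'. c' \<in> {..<2} \<rightarrow>\<^sub>E UNIV \<and> v - lincomb 2 c' b \<in> K \<longrightarrow> c' = c" by (rule ex1E)
    note c = c0[THEN conjunct2] and u = u0[rule_format, OF conjI]
    show "\<exists>!p. v - lc p b \<in> K"
    proof (rule ex1I[of _ "(c 0, c (Suc 0))"])
      show "v - lc (c 0, c (Suc 0)) b \<in> K" using c by (simp add: lincomb_2)
      fix p assume p: "v - lc p b \<in> K"
      define c' where "c' = (\<lambda>i\<in>{..<2::nat}. if i = 0 then fst p else snd p)"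
      have "c' = c" using p by (intro u) (auto simp: c'_def lincomb_2)
      then have "c 0 = c' 0" "c (Suc 0) = c' (Suc 0)" by simp_all
      then show "p = (c 0, c (Suc 0))" by (simp add: c'_def)
    qed
  next
    assume "\<exists>!p. v - lc p b \<in> K"
    then obtain p where p: "v - lc p b \<in> K" and u0: "\<forall>q. v - lc q b \<in> K \<longrightarrow> q = p" by (rule ex1E)
    note u = u0[rule_format]
    define c where "c = (\<lambda>i\<in>{..<2::nat}. if i = 0 then fst p else snd p)"
    show "\<exists>!c. c \<in> {..<2} \<rightarrow>\<^sub>E UNIV \<and> v - lincomb 2 c b \<in> K"
    proof (rule ex1I[of _ c], intro conjI)
      show "v - lincomb 2 c b \<in> K" using p by (simp add: c_def lincomb_2)
      fix c' :: "nat \<Rightarrow> complex" assume c': "c' \<in> {..<2} \<rightarrow>\<^sub>E UNIV \<and> v - lincomb 2 c' b \<in> K"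
      then have *: "(c' 0, c' (Suc 0)) = p" by (intro u) (simp add: lincomb_2)
      show "c' = c"
      proof
        fix i :: nat
        consider "i = 0" | "i = Suc 0" | "i \<notin> {..<2}" by fastforce
        then show "c' i = c i" using * c' by cases (auto simp: c_def PiE_def extensional_def)
      qed
    qed (simp add: c_def)
  qed
  moreover have "(\<forall>i<2. b i \<in> vecs n r) \<longleftrightarrow> b 0 \<in> vecs n r \<and> b (Suc 0) \<in> vecs n r"
    by (auto simp: numeral_2_eq_2 less_Suc_eq)
  ultimately show ?thesis by (simp add: quotient_basis_def)
qed

definition coord :: "vec set \<Rightarrow> (nat \<Rightarrow> vec) \<Rightarrow> vec \<Rightarrow> c2" where
  "coord K b v = (THE p. v - lc p b \<in> K)"

lemma lc_vecs: "b 0 \<in> vecs n r \<Longrightarrow> b (Suc 0) \<in> vecs n r \<Longrightarrow> lc p b \<in> vecs n r"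
  unfolding lc_def by (intro vecs_add vecs_csmul)

lemma coord_eqI:
  assumes "quotient_basis 2 n r K b" "v \<in> vecs n r" "v - lc p b \<in> K"
  shows "coord K b v = p"
  unfolding coord_def using assms by (intro the1_equality) (auto simp: quotient_basis_iff)

lemma coord_mem:
  assumes "quotient_basis 2 n r K b" "v \<in> vecs n r"
  shows "v - lc (coord K b v) b \<in> K"
proof -
  have "\<exists>!p. v - lc p b \<in> K" using assms by (simp add: quotient_basis_iff)
  then show ?thesis unfolding coord_def by (rule theI')
qed

lemma quotient_functional_coord:
  assumes K: "submod n r K" and b: "quotient_basis 2 n r K b"
  shows "quotient_functional n r K (coord K b) b"
proof -
  note KD = submodD[OF K]
  have b01: "b 0 \<in> vecs n r" "b (Suc 0) \<in> vecs n r" using b by (auto simp: quotient_basis_iff)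
  show ?thesis
  proof (rule quotient_functional.intro)
    fix v w assume v: "v \<in> vecs n r" and w: "w \<in> vecs n r"
    have "(v - lc (coord K b v) b) + (w - lc (coord K b w) b) \<in> K"
      by (intro KD(3) coord_mem[OF b] v w)
    moreover have "(v - lc (coord K b v) b) + (w - lc (coord K b w) b) = v + w - lc (coord K b v + coord K b w) b"
      by (simp add: lc_def csmul_add_left algebra_simps)
    ultimately show "coord K b (v + w) = coord K b v + coord K b w"
      by (intro coord_eqI[OF b] vecs_add v w) simp
  next
    fix c v assume v: "v \<in> vecs n r"
    have "csmul c (v - lc (coord K b v) b) \<in> K" by (intro KD(5) coord_mem[OF b] v)
    moreover have "csmul c (v - lc (coord K b v) b) = csmul c v - lc (sc c (coord K b v)) b"
      by (simp add: lc_def sc_def smul_simps csmul_csmul)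
    ultimately show "coord K b (csmul c v) = sc c (coord K b v)"
      by (intro coord_eqI[OF b] vecs_csmul v) simp
  next
    fix v assume v: "v \<in> vecs n r"
    have l0: "lc 0 b = 0" by (simp add: lc_def)
    show "v \<in> K \<longleftrightarrow> coord K b v = 0"
      using coord_eqI[OF b v, of 0] coord_mem[OF b v] l0 by auto
  next
    show "coord K b (b 0) = (1, 0)"
      using KD(2) by (intro coord_eqI[OF b b01(1)]) (simp add: lc_def)
    show "coord K b (b (Suc 0)) = (0, 1)"
      using KD(2) by (intro coord_eqI[OF b b01(2)]) (simp add: lc_def)
  qed (use K b01 in auto)
qed

lemma det2_nonzero_solve:
  assumes "det2 p q \<noteq> 0"
  shows "x = sc (det2 x q / det2 p q) p + sc (det2 p x / det2 p q) q"
proof -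
  have "det2 x q * fst p + det2 p x * fst q = fst x * det2 p q"
    "det2 x q * snd p + det2 p x * snd q = snd x * det2 p q"
    by (simp_all add: det2_def algebra_simps)
  then show ?thesis using assms by (auto simp: sc_def prod_eq_iff field_simps)
qed

lemma det2_zero_dependent:
  assumes "det2 p q = 0"
  shows "\<exists>a b. (a, b) \<noteq> (0, 0) \<and> sc a p + sc b q = 0"
proof (cases "p = 0")
  case True
  then show ?thesis by (intro exI[of _ 1] exI[of _ 0]) (simp add: sc_simps)
next
  case False
  show ?thesis
  proof (cases "fst p = 0")
    case True
    then have "snd p \<noteq> 0" using False by (simp add: prod_eq_iff)
    then show ?thesis
      using assms True by (intro exI[of _ "snd q"] exI[of _ "- snd p"]) (simp add: sc_def det2_def prod_eq_iff)
  next
    case False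
    then show ?thesis
      using assms by (intro exI[of _ "fst q"] exI[of _ "- fst p"]) (simp add: sc_def det2_def prod_eq_iff algebra_simps)
  qed
qed

context quotient_functional
begin

lemma lc_value:
  assumes "b' 0 \<in> vecs n r" "b' (Suc 0) \<in> vecs n r"
  shows "\<phi> (lc p b') = sc (fst p) (\<phi> (b' 0)) + sc (snd p) (\<phi> (b' (Suc 0)))"
  using assms by (simp add: lc_def \<phi>_add \<phi>_csmul vecs_csmul)

lemma surj: "\<phi> (lc p b) = p"
  using lc_value[OF b] \<phi>b by (simp add: sc_def)

text \<open>Membership in another chart becomes the nonvanishing of a determinant; all overlaps of
  charts are computed from this.\<close>

lemma quotient_basis_det:
  "quotient_basis 2 n r K b' \<longleftrightarrow> b' 0 \<in> vecs n r \<and> b' (Suc 0) \<in> vecs n r \<and> det2 (\<phi> (b' 0)) (\<phi> (b' (Suc 0))) \<noteq> 0"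
proof -
  have "(\<forall>v\<in>vecs n r. \<exists>!p. v - lc p b' \<in> K) \<longleftrightarrow> det2 (\<phi> (b' 0)) (\<phi> (b' (Suc 0))) \<noteq> 0"
    if b': "b' 0 \<in> vecs n r" "b' (Suc 0) \<in> vecs n r"
  proof -
    have *: "v - lc p b' \<in> K \<longleftrightarrow> \<phi> v = sc (fst p) (\<phi> (b' 0)) + sc (snd p) (\<phi> (b' (Suc 0)))"
      if "v \<in> vecs n r" for v p
      using diff_in_K[OF that lc_vecs[of b' n r p]] b' lc_value[OF b'] by simp
    show ?thesis
    proof
      assume u: "\<forall>v\<in>vecs n r. \<exists>!p. v - lc p b' \<in> K"
      show "det2 (\<phi> (b' 0)) (\<phi> (b' (Suc 0))) \<noteq> 0"
      proof
        assume "det2 (\<phi> (b' 0)) (\<phi> (b' (Suc 0))) = 0"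
        then obtain a c where ac: "(a, c) \<noteq> (0, 0)" "sc a (\<phi> (b' 0)) + sc c (\<phi> (b' (Suc 0))) = 0"
          using det2_zero_dependent by blast
        have z: "\<phi> 0 = 0" using ker[OF vecs_0] submodD(2)[OF K] by simp
        have "0 - lc (a, c) b' \<in> K" "0 - lc (0, 0) b' \<in> K"
          using *[OF vecs_0] ac z by (simp_all add: sc_simps)
        then show False using u vecs_0 ac(1) by metis
      qed
    next
      assume d: "det2 (\<phi> (b' 0)) (\<phi> (b' (Suc 0))) \<noteq> 0"
      show "\<forall>v\<in>vecs n r. \<exists>!p. v - lc p b' \<in> K"
      proof
        fix v assume v: "v \<in> vecs n r"
        let ?D = "det2 (\<phi> (b' 0)) (\<phi> (b' (Suc 0)))"
        show "\<exists>!p. v - lc p b' \<in> K"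
        proof (rule ex1I[of _ "(det2 (\<phi> v) (\<phi> (b' (Suc 0))) / ?D, det2 (\<phi> (b' 0)) (\<phi> v) / ?D)"])
          show "v - lc (det2 (\<phi> v) (\<phi> (b' (Suc 0))) / ?D, det2 (\<phi> (b' 0)) (\<phi> v) / ?D) b' \<in> K"
            unfolding *[OF v] using det2_nonzero_solve[OF d, of "\<phi> v"] by simp
          fix p assume "v - lc p b' \<in> K"
          then have \<phi>v: "\<phi> v = sc (fst p) (\<phi> (b' 0)) + sc (snd p) (\<phi> (b' (Suc 0)))" using *[OF v] by simp
          have "det2 (\<phi> v) (\<phi> (b' (Suc 0))) = fst p * ?D" "det2 (\<phi> (b' 0)) (\<phi> v) = snd p * ?D"
            unfolding \<phi>v by (simp_all add: det2_def sc_def algebra_simps)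
          then show "p = (det2 (\<phi> v) (\<phi> (b' (Suc 0))) / ?D, det2 (\<phi> (b' 0)) (\<phi> v) / ?D)"
            using d by (simp add: prod_eq_iff)
        qed
      qed
    qed
  qed
  then show ?thesis by (auto simp: quotient_basis_iff)
qed

text \<open>Cramer's rule as the change of chart: rational, with the determinant of the new basis as
  denominator.\<close>

lemma coord_cramer:
  assumes b': "quotient_basis 2 n r K b'" and v: "v \<in> vecs n r"
  shows "coord K b' v = (det2 (\<phi> v) (\<phi> (b' (Suc 0))) / det2 (\<phi> (b' 0)) (\<phi> (b' (Suc 0))),
                         det2 (\<phi> (b' 0)) (\<phi> v) / det2 (\<phi> (b' 0)) (\<phi> (b' (Suc 0))))"
proof (rule coord_eqI[OF b' v])
  have *: "b' 0 \<in> vecs n r" "b' (Suc 0) \<in> vecs n r" "det2 (\<phi> (b' 0)) (\<phi> (b' (Suc 0))) \<noteq> 0"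
    using b' quotient_basis_det by auto
  show "v - lc (det2 (\<phi> v) (\<phi> (b' (Suc 0))) / det2 (\<phi> (b' 0)) (\<phi> (b' (Suc 0))),
                det2 (\<phi> (b' 0)) (\<phi> v) / det2 (\<phi> (b' 0)) (\<phi> (b' (Suc 0)))) b' \<in> K"
    using diff_in_K[OF v lc_vecs[OF *(1,2)]] lc_value[OF *(1,2)] det2_nonzero_solve[OF *(3), of "\<phi> v"]
    by simp
qed

lemma quotient_basis_b: "quotient_basis 2 n r K b"
  using b \<phi>b by (simp add: quotient_basis_det det2_def)

lemma coord_b: "v \<in> vecs n r \<Longrightarrow> coord K b v = \<phi> v"
  by (simp add: coord_cramer[OF quotient_basis_b] \<phi>b det2_def)

lemma mat_of:
  assumes l: "l < n" and v: "v \<in> vecs n r"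
  shows "\<phi> (smul (xvar l) v) = app (\<phi> (smul (xvar l) (b 0)), \<phi> (smul (xvar l) (b (Suc 0)))) (\<phi> v)"
proof -
  note x = xvar_polys[OF l]
  have "v - lc (\<phi> v) b \<in> K" using diff_in_K[OF v lc_vecs[OF b]] surj by simp
  then have "smul (xvar l) (v - lc (\<phi> v) b) \<in> K" by (rule submodD(4)[OF K x])
  then have "smul (xvar l) v - smul (xvar l) (lc (\<phi> v) b) \<in> K" by (simp add: smul_simps)
  then have "\<phi> (smul (xvar l) v) = \<phi> (smul (xvar l) (lc (\<phi> v) b))"
    using diff_in_K[OF vecs_smul[OF x v] vecs_smul[OF x lc_vecs[OF b]]] by simp
  also have "smul (xvar l) (lc (\<phi> v) b) = lc (\<phi> v) (\<lambda>i. smul (xvar l) (b i))"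
    unfolding lc_def by (simp only: smul_simps smul_commute)
  also have "\<phi> \<dots> = sc (fst (\<phi> v)) (\<phi> (smul (xvar l) (b 0))) + sc (snd (\<phi> v)) (\<phi> (smul (xvar l) (b (Suc 0))))"
    by (rule lc_value) (intro vecs_smul x b)+
  finally show ?thesis by (simp add: app_def)
qed

text \<open>The matrices of the variables in the basis \<open>b\<close> and the images of the
  generators fix \<open>\<phi>\<close> on every monomial vector, and so they determine
  \<open>K\<close>. The matrices commute because the variables do and \<open>\<phi>\<close> is
  onto.\<close>

lemma functional_eq_\<Phi>:
  defines "A \<equiv> \<lambda>l. (\<phi> (smul (xvar l) (b 0)), \<phi> (smul (xvar l) (b (Suc 0))))" and "u \<equiv> \<lambda>k. \<phi> (evec k)"
  shows "commuting n A" "\<And>v. v \<in> vecs n r \<Longrightarrow> \<phi> v = \<Phi> n A u v" "K = point_of n r A u"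
proof -
  have A: "\<phi> (smul (xvar l) v) = app (A l) (\<phi> v)" if "l < n" "v \<in> vecs n r" for l v
    unfolding A_def by (rule mat_of[OF that])
  show comm: "commuting n A"
    unfolding commuting_def
  proof (intro allI impI)
    fix k l p assume kl: "k < n" "l < n"
    have w: "lc p b \<in> vecs n r" by (rule lc_vecs[OF b])
    have "app (A k) (app (A l) p) = \<phi> (smul (xvar k) (smul (xvar l) (lc p b)))"
      using kl w surj by (simp add: A vecs_smul xvar_polys)
    also have "smul (xvar k) (smul (xvar l) (lc p b)) = smul (xvar l) (smul (xvar k) (lc p b))"
      by (rule smul_commute)
    also have "\<phi> \<dots> = app (A l) (app (A k) p)"
      using kl w surj by (simp add: A vecs_smul xvar_polys)
    finally show "app (A k) (app (A l) p) = app (A l) (app (A k) p)" .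
  qed
  have mon: "\<phi> (mon_vec m k) = mact n A m (u k)" if "Poly_Mapping.keys m \<subseteq> {..<n}" "k < r" for m k
    using that(1)
  proof (induction m rule: monomial_induct)
    case zero
    have "mon_vec 0 k = evec k" by (simp add: mon_vec_def)
    then show ?case by (simp add: mact_zero u_def)
  next
    case (step l m)
    have "mon_vec (Poly_Mapping.single l 1 + m) k = smul (xvar l) (mon_vec m k)"
      unfolding xvar_def by (rule smul_mon'[symmetric])
    then have "\<phi> (mon_vec (Poly_Mapping.single l 1 + m) k) = app (A l) (\<phi> (mon_vec m k))"
      using A[OF step(1) mon_vecs[OF that(2) step(2)]] by simp
    also have "\<dots> = app (A l) (mact n A m (u k))" using step by simp
    also have "\<dots> = mact n A (Poly_Mapping.single l 1 + m) (u k)"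
      by (simp only: mact_add[OF comm order_refl] mact_single[OF step(1)])
    finally show ?case .
  qed
  show eq: "\<phi> v = \<Phi> n A u v" if "v \<in> vecs n r" for v
    using that
  proof (induction v rule: vec_induct)
    case zero
    then show ?case using ker[OF vecs_0] submodD(2)[OF K] by (simp add: \<Phi>_zero)
  next
    case (add v w)
    then show ?case by (simp add: \<Phi>_add \<phi>_add)
  next
    case (mon c m k)
    then show ?case by (simp add: \<phi>_csmul mon_vecs \<Phi>_mon \<open>\<And>m k. _ \<Longrightarrow> _ \<Longrightarrow> \<phi> (mon_vec m k) = _\<close>)
  qed
  show "K = point_of n r A u"
    using submodD(1)[OF K] ker eq by (auto simp: point_of_def)
qed

end

lemma point_of_submod:
  assumes "commuting n A"
  shows "submod n r (point_of n r A v)"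
  by (rule submodI_monomials)
    (auto simp: point_of_def vecs_0 \<Phi>_zero vecs_add \<Phi>_add vecs_csmul \<Phi>_csmul[OF _ assms] sc_simps
      vecs_smul xvar_polys \<Phi>_xvar[OF _ assms] app_linear)

lemma quotient_functional_point_of:
  assumes "commuting n A" "b 0 \<in> vecs n r" "b (Suc 0) \<in> vecs n r"
    "\<Phi> n A v (b 0) = (1, 0)" "\<Phi> n A v (b (Suc 0)) = (0, 1)"
  shows "quotient_functional n r (point_of n r A v) (\<Phi> n A v) b"
proof (rule quotient_functional.intro)
  show "submod n r (point_of n r A v)" by (rule point_of_submod[OF assms(1)])
qed (use assms in \<open>auto simp: \<Phi>_add \<Phi>_csmul point_of_def\<close>)


section \<open>Charts of the Quot scheme\<close>

lemma det2_zero_line: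
  assumes "p \<noteq> 0" "det2 p q = 0"
  shows "\<exists>c. q = sc c p"
proof (cases "fst p = 0")
  case True
  then show ?thesis
    using assms by (intro exI[of _ "snd q / snd p"]) (auto simp: sc_def det2_def prod_eq_iff)
next
  case False
  then show ?thesis
    using assms by (intro exI[of _ "fst q / fst p"]) (auto simp: sc_def det2_def prod_eq_iff field_simps)
qed

lemma c2_basis_nonzero [simp]: "(1, 0) \<noteq> (0 :: c2)" "(0, 1) \<noteq> (0 :: c2)" "(0 :: c2) \<noteq> (1, 0)" "(0 :: c2) \<noteq> (0, 1)"
  by (simp_all add: prod_eq_iff)

section \<open>Length two as dimension two\<close>

context quotient_functional
begin

text \<open>An element of \<open>Q\<close> outside \<open>K\<close> and one of \<open>P\<close>
  outside \<open>Q\<close> have independent images in the plane, so together they span everything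
  modulo \<open>K\<close>.\<close>

lemma no_longer_chain:
  assumes "submod n r Q" "submod n r P" "K \<subset> Q" "Q \<subset> P" "P \<subset> vecs n r"
  shows False
proof -
  note QD = submodD[OF assms(1)] and PD = submodD[OF assms(2)]
  obtain q where q: "q \<in> Q" "q \<notin> K" using assms by blast
  obtain p where p: "p \<in> P" "p \<notin> Q" using assms by blast
  have qv: "q \<in> vecs n r" and pv: "p \<in> vecs n r" using q p QD(1) PD(1) by blast+
  have q0: "\<phi> q \<noteq> 0" using q ker[OF qv] by blast
  have d: "det2 (\<phi> q) (\<phi> p) \<noteq> 0"
  proof
    assume "det2 (\<phi> q) (\<phi> p) = 0"
    then obtain c where "\<phi> p = sc c (\<phi> q)" using det2_zero_line q0 by blast
    then have "p - csmul c q \<in> K" using diff_in_K[OF pv vecs_csmul[OF qv]] \<phi>_csmul[OF qv] by simp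
    then have "(p - csmul c q) + csmul c q \<in> Q" using assms(3) q(1) by (intro QD(3) QD(5)) auto
    then show False using p by simp
  qed
  have "v \<in> P" if v: "v \<in> vecs n r" for v
  proof -
    let ?w = "csmul (det2 (\<phi> v) (\<phi> p) / det2 (\<phi> q) (\<phi> p)) q + csmul (det2 (\<phi> q) (\<phi> v) / det2 (\<phi> q) (\<phi> p)) p"
    have wv: "?w \<in> vecs n r" by (intro vecs_add vecs_csmul qv pv)
    have "\<phi> ?w = \<phi> v"
      using det2_nonzero_solve[OF d, of "\<phi> v"] by (simp add: \<phi>_add \<phi>_csmul vecs_csmul qv pv)
    then have "v - ?w \<in> K" using diff_in_K[OF v wv] by simp
    then have "(v - ?w) + ?w \<in> P"
      using assms(3,4) q(1) p(1) by (intro PD(3) PD(5)) auto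
    then show ?thesis by simp
  qed
  then show False using assms(5) by blast
qed

text \<open>If nothing lay between \<open>K\<close> and the whole module, the quotient would be
  simple, hence one-dimensional, against the two independent elements of \<open>b\<close>. So a
  chain of two steps exists, and the dimension forbids refining it.\<close>

lemma in_quot_points: "K \<in> quot_points 2 n r"
proof -
  let ?V = "vecs n r"
  have V: "submod n r ?V"
    unfolding submodule_iff by (auto simp: vecs_0 vecs_add vecs_smul)
  have KV: "K \<subset> ?V"
    using submodD(1)[OF K] ker[OF b(1)] \<phi>b b(1) by auto
  have "\<exists>P. submod n r P \<and> K \<subset> P \<and> P \<subset> ?V"
  proof (rule ccontr)
    assume no: "\<not> ?thesis"
    interpret simple_subquotient n r K ?V
    proof (rule simple_subquotient.intro)
      show "P = K \<or> P = ?V" if "submod n r P" "K \<subseteq> P" "P \<subseteq> ?V" for P using that no by blast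
    qed (use K V KV in auto)
    have "b 0 \<notin> K" using ker[OF b(1)] \<phi>b by simp
    then obtain c where "b (Suc 0) - csmul c (b 0) \<in> K" using one_dimensional[OF b(1) _ b(2)] by blast
    then have "\<phi> (b (Suc 0)) = sc c (\<phi> (b 0))"
      using diff_in_K[OF b(2) vecs_csmul[OF b(1)]] \<phi>_csmul[OF b(1)] by simp
    then show False by (simp add: \<phi>b sc_def)
  qed
  then obtain P where P: "submod n r P" "K \<subset> P" "P \<subset> ?V" by blast
  define N where "N i = (if i = 0 then K else if i = Suc 0 then P else ?V)" for i :: nat
  have "has_quotient_length (coordinate_ring n) (free_module n r) K 2"
    unfolding has_quotient_length_def
  proof (intro exI[of _ N] conjI allI impI)
    fix i :: nat assume "i < 2"
    then consider "i = 0" | "i = Suc 0" by linarith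
    then show "N i \<subset> N (Suc i)"
      using P by cases (simp_all add: N_def)
    show "\<not> (\<exists>Q. submod n r Q \<and> N i \<subset> Q \<and> Q \<subset> N (Suc i))"
    proof
      assume "\<exists>Q. submod n r Q \<and> N i \<subset> Q \<and> Q \<subset> N (Suc i)"
      then obtain Q where Q: "submod n r Q" "N i \<subset> Q" "Q \<subset> N (Suc i)" by blast
      from \<open>i < 2\<close> consider "i = 0" | "i = Suc 0" by linarith
      then show False
      proof cases
        case 1
        then have "K \<subset> Q" "Q \<subset> P" using Q by (simp_all add: N_def)
        then show ?thesis using no_longer_chain[OF Q(1) P(1) _ _ P(3)] by blast
      next
        case 2
        then have "P \<subset> Q" "Q \<subset> ?V" using Q by (simp_all add: N_def)
        then show ?thesis using no_longer_chain[OF P(1) Q(1) P(2)] by blast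
      qed
    qed
  qed (use K V P in \<open>auto simp: N_def\<close>)
  then show ?thesis using K by (simp add: quot_points_def)
qed

end

lemma quot_points_submod: "K \<in> quot_points d n r \<Longrightarrow> submod n r K"
  by (simp add: quot_points_def)

text \<open>Both steps of the composition chain are one-dimensional, so one vector from each gives a
  basis of the quotient.\<close>

lemma quot_points_basis:
  assumes K: "K \<in> quot_points 2 n r"
  shows "\<exists>b. quotient_basis 2 n r K b"
proof -
  obtain N where N0: "N 0 = K \<and> N 2 = vecs n r \<and> (\<forall>i\<le>2. submod n r (N i)) \<and>
      (\<forall>i<2. N i \<subset> N (Suc i) \<and> \<not> (\<exists>P. submod n r P \<and> N i \<subset> P \<and> P \<subset> N (Suc i)))"
    using K unfolding quot_points_def has_quotient_length_def by blast
  have N: "N 0 = K" "N 2 = vecs n r" "\<And>i. i \<le> 2 \<Longrightarrow> submod n r (N i)"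
    "\<And>i. i < 2 \<Longrightarrow> N i \<subset> N (Suc i)"
    "\<And>i P. i < 2 \<Longrightarrow> submod n r P \<Longrightarrow> N i \<subset> P \<Longrightarrow> P \<subset> N (Suc i) \<Longrightarrow> False"
    using N0 by blast+
  define L where "L = N 1"
  have V: "submod n r (vecs n r)" and L: "submod n r L" and K': "submod n r K"
    using N(3)[of 2] N(3)[of 1] N(3)[of 0] N(1,2) by (auto simp: L_def)
  have KL: "K \<subset> L" and LV: "L \<subset> vecs n r"
    using N(4)[of 0] N(4)[of 1] N(1,2) by (auto simp: L_def numeral_2_eq_2)
  interpret KL: simple_subquotient n r K L
  proof (rule simple_subquotient.intro)
    show "P = K \<or> P = L" if "submod n r P" "K \<subseteq> P" "P \<subseteq> L" for P
      using N(5)[of 0 P] that N(1) by (auto simp: L_def)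
  qed (use K' L KL in auto)
  interpret LV: simple_subquotient n r L "vecs n r"
  proof (rule simple_subquotient.intro)
    show "P = L \<or> P = vecs n r" if "submod n r P" "L \<subseteq> P" "P \<subseteq> vecs n r" for P
      using N(5)[of 1 P] that N(2) by (auto simp: L_def numeral_2_eq_2)
  qed (use L V LV in auto)
  note KD = submodD[OF K'] and LD = submodD[OF L]
  obtain w0 where w0: "w0 \<in> vecs n r" "w0 \<notin> L" using LV by blast
  obtain w1 where w1: "w1 \<in> L" "w1 \<notin> K" using KL by blast
  define b where "b i = (if i = 0 then w0 else w1)" for i :: nat
  have lc: "lc p b = csmul (fst p) w0 + csmul (snd p) w1" for p by (simp add: lc_def b_def)
  have "quotient_basis 2 n r K b"
    unfolding quotient_basis_iff
  proof (intro conjI ballI)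
    show "b 0 \<in> vecs n r" "b (Suc 0) \<in> vecs n r" using w0 w1 LD(1) by (auto simp: b_def)
    fix v assume v: "v \<in> vecs n r"
    obtain c where c: "v - csmul c w0 \<in> L" using LV.one_dimensional[OF w0 v] by blast
    obtain d where d: "v - csmul c w0 - csmul d w1 \<in> K" using KL.one_dimensional[OF w1 c] by blast
    show "\<exists>!p. v - lc p b \<in> K"
    proof (rule ex1I[of _ "(c, d)"])
      show cd: "v - lc (c, d) b \<in> K" using d by (simp add: lc algebra_simps)
      fix p assume p: "v - lc p b \<in> K"
      obtain c' d' where p': "p = (c', d')" by fastforce
      have "(v - lc (c, d) b) - (v - lc p b) \<in> K" by (rule KD(7)[OF cd p])
      moreover have "(v - lc (c, d) b) - (v - lc p b) = csmul (c' - c) w0 + csmul (d' - d) w1"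
        by (simp add: lc p' csmul_diff_left)
      ultimately have *: "csmul (c' - c) w0 + csmul (d' - d) w1 \<in> K" by simp
      have "c' = c"
      proof (rule ccontr)
        assume ne: "c' \<noteq> c"
        have "(csmul (c' - c) w0 + csmul (d' - d) w1) - csmul (d' - d) w1 \<in> L"
          using * KL.less w1(1) by (intro LD(7) LD(5)) auto
        then have "csmul (c' - c) w0 \<in> L" by simp
        then have "csmul (inverse (c' - c)) (csmul (c' - c) w0) \<in> L" by (rule LD(5))
        then show False using ne w0 by (simp add: csmul_csmul)
      qed
      moreover have "d' = d"
      proof (rule ccontr)
        assume ne: "d' \<noteq> d"
        have "csmul (d' - d) w1 \<in> K" using * \<open>c' = c\<close> by simp
        then have "csmul (inverse (d' - d)) (csmul (d' - d) w1) \<in> K" by (rule KD(5))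
        then show False using ne w1 by (simp add: csmul_csmul)
      qed
      ultimately show "p = (c, d)" by (simp add: p')
    qed
  qed
  then show ?thesis by blast
qed

definition std_basis :: "nat \<times> nat \<times> nat \<Rightarrow> nat \<Rightarrow> vec" where
  "std_basis = (\<lambda>(\<tau>, i, j) q. if q = 0 then evec i else if \<tau> = 0 then evec j else smul (xvar j) (evec i))"

text \<open>The leading tag makes the lexicographic order on triples place the charts of two
  generators before the others.\<close>

definition chart_index :: "nat \<Rightarrow> nat \<Rightarrow> (nat \<times> nat \<times> nat) set" where
  "chart_index n r = {0} \<times> {(i, j). i < j \<and> j < r} \<union> {1} \<times> {..<r} \<times> {..<n}"

text \<open>Otherwise a nonzero \<open>\<phi> (evec i)\<close> spans a line that contains the images
  of all generators and is stable under all variables, so \<open>\<phi>\<close> could not be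
  onto.\<close>

lemma std_basis_cover:
  assumes KQ: "K \<in> quot_points 2 n r"
  shows "\<exists>\<iota>\<in>chart_index n r. quotient_basis 2 n r K (std_basis \<iota>)"
proof (rule ccontr)
  assume no: "\<not> ?thesis"
  obtain b where b: "quotient_basis 2 n r K b" using quot_points_basis[OF KQ] by blast
  define \<phi> where "\<phi> = coord K b"
  interpret quotient_functional n r K \<phi> b
    unfolding \<phi>_def by (rule quotient_functional_coord[OF quot_points_submod[OF KQ] b])
  have d0: "det2 (\<phi> (evec i)) (\<phi> (evec j)) = 0" if "i < j" "j < r" for i j
  proof -
    have "(0, i, j) \<in> chart_index n r" using that by (simp add: chart_index_def)
    then have "\<not> quotient_basis 2 n r K (std_basis (0, i, j))" using no by blast
    then show ?thesis using that by (simp add: quotient_basis_det std_basis_def evec_vecs)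
  qed
  have d1: "det2 (\<phi> (evec i)) (\<phi> (smul (xvar l) (evec i))) = 0" if "i < r" "l < n" for i l
  proof -
    have "(1, i, l) \<in> chart_index n r" using that by (simp add: chart_index_def)
    then have "\<not> quotient_basis 2 n r K (std_basis (1, i, l))" using no by blast
    then show ?thesis
      using that by (simp add: quotient_basis_det std_basis_def evec_vecs vecs_smul xvar_polys)
  qed
  have d: "det2 (\<phi> (evec i)) (\<phi> (evec j)) = 0" if "i < r" "j < r" for i j
    using d0[of i j] d0[of j i] that by (cases i j rule: linorder_cases) (auto simp: det2_def algebra_simps)
  have "\<exists>i<r. \<phi> (evec i) \<noteq> 0"
  proof (rule ccontr)
    assume "\<not> ?thesis"
    then have 0: "\<phi> (evec i) = 0" if "i < r" for i using that by blast
    note \<Phi> = functional_eq_\<Phi>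
    have "\<phi> v = 0" if "v \<in> vecs n r" for v
      using that
    proof (induction v rule: vec_induct)
      case zero
      then show ?case using ker[OF vecs_0] submodD(2)[OF quot_points_submod[OF KQ]] by simp
    next
      case (mon c m k)
      have "mact n A m 0 = 0" for A using mact_linear(2)[of n A m 0 0] by (simp add: sc_simps)
      then show ?case
        using mon 0 by (simp add: \<Phi>(2) vecs_csmul mon_vecs \<Phi>_mon sc_simps)
    qed (simp add: \<phi>_add)
    then show False using \<phi>b(1) b(1) by simp
  qed
  then obtain i where i: "i < r" "\<phi> (evec i) \<noteq> 0" by blast
  define p where "p = \<phi> (evec i)"
  have line: "\<exists>c. q = sc c p" if "det2 p q = 0" for q
    using det2_zero_line[OF _ that] i(2) by (simp add: p_def)
  have det_sc: "det2 p (sc c p) = 0" "det2 p (sc c q) = c * det2 p q" for c q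
    by (simp_all add: det2_def sc_def algebra_simps)
  have mon: "det2 p (\<phi> (mon_vec m k)) = 0" if "Poly_Mapping.keys m \<subseteq> {..<n}" "k < r" for m k
    using that(1)
  proof (induction m rule: monomial_induct)
    case zero
    have "mon_vec 0 k = evec k" by (simp add: mon_vec_def)
    then show ?case using d[OF i(1) that(2)] by (simp add: p_def)
  next
    case (step l m)
    obtain c where c: "\<phi> (mon_vec m k) = sc c p" using line[OF step(3)] by blast
    have "mon_vec (Poly_Mapping.single l 1 + m) k = smul (xvar l) (mon_vec m k)"
      unfolding xvar_def by (rule smul_mon'[symmetric])
    then have "\<phi> (mon_vec (Poly_Mapping.single l 1 + m) k)
        = app (\<phi> (smul (xvar l) (b 0)), \<phi> (smul (xvar l) (b (Suc 0)))) (sc c p)"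
      using mat_of[OF step(1) mon_vecs[OF that(2) step(2)]] c by simp
    also have "\<dots> = sc c (\<phi> (smul (xvar l) (evec i)))"
      using mat_of[OF step(1) evec_vecs[OF i(1)]] by (simp add: app_linear p_def)
    finally show ?case using d1[OF i(1) step(1)] by (simp add: det_sc flip: p_def)
  qed
  have all: "det2 p (\<phi> v) = 0" if "v \<in> vecs n r" for v
    using that
  proof (induction v rule: vec_induct)
    case zero
    then show ?case
      using ker[OF vecs_0] submodD(2)[OF quot_points_submod[OF KQ]] by (simp add: det2_def)
  next
    case (add v w)
    then show ?case by (simp add: \<phi>_add det2_def algebra_simps)
  next
    case (mon c m k)
    then show ?case
      using \<open>\<And>m k. _ \<Longrightarrow> _ \<Longrightarrow> det2 p (\<phi> (mon_vec m k)) = 0\<close> by (simp add: \<phi>_csmul mon_vecs det_sc)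
  qed
  have "det2 p (1, 0) = 0" "det2 p (0, 1) = 0" using all[OF b(1)] all[OF b(2)] \<phi>b by simp_all
  then show False using i(2) by (simp add: det2_def p_def prod_eq_iff)
qed

section \<open>Topology of a chart\<close>

definition chart :: "nat \<Rightarrow> nat \<Rightarrow> (nat \<Rightarrow> vec) \<Rightarrow> vec set set" where
  "chart n r b = {K \<in> quot_points 2 n r. quotient_basis 2 n r K b}"

lemma chart_functional: "K \<in> chart n r b \<Longrightarrow> quotient_functional n r K (coord K b) b"
  using quotient_functional_coord quot_points_submod by (auto simp: chart_def)

lemma quot_chart_open_eq:
  assumes v: "v \<in> vecs n r"
  shows "quot_chart_open 2 n r b v W =
    {K \<in> chart n r b. fst (coord K b v) \<in> W 0 \<and> snd (coord K b v) \<in> W (Suc 0)}"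
proof -
  have "(\<exists>c. (\<forall>i<2. c i \<in> W i) \<and> v - lincomb 2 c b \<in> K) \<longleftrightarrow>
      fst (coord K b v) \<in> W 0 \<and> snd (coord K b v) \<in> W (Suc 0)" if K: "quotient_basis 2 n r K b" for K
  proof
    assume "\<exists>c. (\<forall>i<2. c i \<in> W i) \<and> v - lincomb 2 c b \<in> K"
    then obtain c where c: "\<forall>i<2. c i \<in> W i" "v - lincomb 2 c b \<in> K" by blast
    then have "coord K b v = (c 0, c (Suc 0))" by (intro coord_eqI[OF K v]) (simp add: lincomb_2)
    then show "fst (coord K b v) \<in> W 0 \<and> snd (coord K b v) \<in> W (Suc 0)" using c(1) by simp
  next
    assume W: "fst (coord K b v) \<in> W 0 \<and> snd (coord K b v) \<in> W (Suc 0)"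
    define c where "c i = (if i = 0 then fst (coord K b v) else snd (coord K b v))" for i :: nat
    have "v - lincomb 2 c b \<in> K" using coord_mem[OF K v] by (simp add: lincomb_2 c_def)
    moreover have "\<forall>i<2. c i \<in> W i" using W by (auto simp: c_def numeral_2_eq_2 less_Suc_eq)
    ultimately show "\<exists>c. (\<forall>i<2. c i \<in> W i) \<and> v - lincomb 2 c b \<in> K" by blast
  qed
  then show ?thesis by (auto simp: quot_chart_open_def chart_def)
qed

lemma openin_quot_chart_open:
  assumes "v \<in> vecs n r" "\<forall>i<2. open (W i)"
  shows "openin (quot_space 2 n r) (quot_chart_open 2 n r b v W)"
  unfolding quot_space_def using assms by (intro topology_generated_by_Basis) blast

lemma openin_chart: "openin (quot_space 2 n r) (chart n r b)"
proof -
  have "chart n r b = quot_chart_open 2 n r b 0 (\<lambda>_. UNIV)"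
    using quot_chart_open_eq[OF vecs_0, of n r b "\<lambda>_. UNIV"] by simp
  then show ?thesis using openin_quot_chart_open[OF vecs_0, of "\<lambda>_. UNIV"] by simp
qed

lemma topspace_quot_space: "topspace (quot_space 2 n r) = (\<Union>\<iota>\<in>chart_index n r. chart n r (std_basis \<iota>))"
proof
  show "topspace (quot_space 2 n r) \<subseteq> (\<Union>\<iota>\<in>chart_index n r. chart n r (std_basis \<iota>))"
    using std_basis_cover by (auto simp: quot_space_def quot_chart_open_def chart_def)
  show "(\<Union>\<iota>\<in>chart_index n r. chart n r (std_basis \<iota>)) \<subseteq> topspace (quot_space 2 n r)"
    using openin_subset[OF openin_chart] by blast
qed

abbreviation chart_space :: "nat \<Rightarrow> nat \<Rightarrow> (nat \<Rightarrow> vec) \<Rightarrow> vec set topology" where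
  "chart_space n r b \<equiv> subtopology (quot_space 2 n r) (chart n r b)"

lemma topspace_chart_space: "topspace (chart_space n r b) = chart n r b"
  using openin_subset[OF openin_chart] by (auto simp: topspace_subtopology)

lemma continuous_map_coord:
  assumes v: "v \<in> vecs n r"
  shows "continuous_map (chart_space n r b) euclidean (\<lambda>K. coord K b v)"
proof -
  have pre: "openin (chart_space n r b) {K \<in> chart n r b. fst (coord K b v) \<in> W 0 \<and> snd (coord K b v) \<in> W (Suc 0)}"
    if W: "\<forall>i<2. open (W i)" for W
    using openin_quot_chart_open[OF v W, of b] openin_chart
    by (subst openin_open_subtopology) (auto simp: quot_chart_open_eq[OF v])
  have "continuous_map (chart_space n r b) euclidean (\<lambda>K. fst (coord K b v))"
    unfolding continuous_map_def topspace_chart_space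
    using pre[of "\<lambda>i. if i = 0 then U else UNIV" for U] by auto
  moreover have "continuous_map (chart_space n r b) euclidean (\<lambda>K. snd (coord K b v))"
    unfolding continuous_map_def topspace_chart_space
    using pre[of "\<lambda>i. if i = 0 then UNIV else U" for U] by auto
  ultimately show ?thesis
    using continuous_map_euclidean_pair[of "chart_space n r b" "\<lambda>K. fst (coord K b v)" "\<lambda>K. snd (coord K b v)"]
    by simp
qed

lemma continuous_map_fst_euclidean:
  "continuous_map X euclidean f \<Longrightarrow> continuous_map X euclidean (\<lambda>x. fst (f x))"
  by (rule continuous_map_euclidean_compose[where h = fst]) (auto intro: continuous_intros)

lemma continuous_map_snd_euclidean:
  "continuous_map X euclidean f \<Longrightarrow> continuous_map X euclidean (\<lambda>x. snd (f x))"
  by (rule continuous_map_euclidean_compose[where h = snd]) (auto intro: continuous_intros)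

lemma continuous_map_det2:
  assumes "continuous_map X euclidean f" "continuous_map X euclidean g"
  shows "continuous_map X euclidean (\<lambda>x. det2 (f x) (g x))"
proof -
  have "continuous_on UNIV (\<lambda>p. det2 (fst p) (snd p))"
    unfolding det2_def by (intro continuous_intros)
  from continuous_map_euclidean_compose[OF continuous_map_euclidean_pair[OF assms] this]
  show ?thesis by simp
qed

lemma continuous_map_complex_divide:
  fixes f g :: "'a \<Rightarrow> complex"
  assumes "continuous_map X euclidean f" "continuous_map X euclidean g" "\<And>x. x \<in> topspace X \<Longrightarrow> g x \<noteq> 0"
  shows "continuous_map X euclidean (\<lambda>x. f x / g x)"
proof -
  have "continuous_map X (top_of_set (- {0})) g"
    using assms by (auto simp: continuous_map_in_subtopology)
  moreover have "continuous_map (top_of_set (- {0})) euclidean (inverse :: complex \<Rightarrow> complex)"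
    by (auto intro!: continuous_intros)
  ultimately have "continuous_map X euclidean (inverse \<circ> g)"
    by (rule continuous_map_compose)
  then show ?thesis
    using continuous_map_euclidean_mult[OF assms(1)] by (simp add: divide_inverse o_def)
qed

text \<open>The topology is generated by the coordinates in all bases. On the chart of
  \<open>b\<close>, those in any other basis are rational functions of finitely many coordinates in
  \<open>b\<close>, so it suffices to control the latter.\<close>

lemma continuous_map_into_chart_space:
  assumes f: "\<And>t. t \<in> topspace T \<Longrightarrow> f t \<in> chart n r b"
    and cont: "\<And>v. v \<in> vecs n r \<Longrightarrow> continuous_map T euclidean (\<lambda>t. coord (f t) b v)"
  shows "continuous_map T (chart_space n r b) f"
proof -
  have pre: "openin T {t \<in> topspace T. f t \<in> quot_chart_open 2 n r b' v W}"
    if v: "v \<in> vecs n r" and W: "\<forall>i<2. open (W i)" for b' v W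
  proof (cases "b' 0 \<in> vecs n r \<and> b' (Suc 0) \<in> vecs n r")
    case False
    then have "quot_chart_open 2 n r b' v W = {}"
      by (auto simp: quot_chart_open_eq[OF v] chart_def quotient_basis_iff)
    then show ?thesis by simp
  next
    case True
    \<comment> \<open>Where \<open>D\<close> vanishes, \<open>f t\<close> lies outside the chart of
      \<open>b'\<close>; on the open rest, \<open>x\<close> and \<open>y\<close> are the coordinates
      of \<open>v\<close> in the basis \<open>b'\<close>.\<close>
    define D where "D t = det2 (coord (f t) b (b' 0)) (coord (f t) b (b' (Suc 0)))" for t
    define x where "x t = det2 (coord (f t) b v) (coord (f t) b (b' (Suc 0))) / D t" for t
    define y where "y t = det2 (coord (f t) b (b' 0)) (coord (f t) b v) / D t" for t
    define T0 where "T0 = {t \<in> topspace T. D t \<in> - {0}}"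
    have D: "continuous_map T euclidean D"
      unfolding D_def using True by (intro continuous_map_det2 cont) auto
    have T0: "openin T T0"
      unfolding T0_def by (rule openin_continuous_map_preimage[OF D]) auto
    have topT0: "topspace (subtopology T T0) = T0" by (auto simp: T0_def)
    have sub: "continuous_map (subtopology T T0) euclidean (\<lambda>t. coord (f t) b w)" if "w \<in> vecs n r" for w
      by (rule continuous_map_from_subtopology[OF cont[OF that]])
    have x: "continuous_map (subtopology T T0) euclidean x"
      unfolding x_def using True v
      by (intro continuous_map_complex_divide continuous_map_det2 sub continuous_map_from_subtopology[OF D])
        (auto simp: T0_def)
    have y: "continuous_map (subtopology T T0) euclidean y"
      unfolding y_def using True v
      by (intro continuous_map_complex_divide continuous_map_det2 sub continuous_map_from_subtopology[OF D])
        (auto simp: T0_def)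
    have "openin (subtopology T T0) {t \<in> topspace (subtopology T T0). x t \<in> W 0}"
      by (rule openin_continuous_map_preimage[OF x]) (use W in auto)
    moreover have "openin (subtopology T T0) {t \<in> topspace (subtopology T T0). y t \<in> W (Suc 0)}"
      by (rule openin_continuous_map_preimage[OF y]) (use W in auto)
    ultimately have "openin (subtopology T T0) ({t \<in> T0. x t \<in> W 0} \<inter> {t \<in> T0. y t \<in> W (Suc 0)})"
      unfolding topT0 by (rule openin_Int)
    then have "openin T ({t \<in> T0. x t \<in> W 0} \<inter> {t \<in> T0. y t \<in> W (Suc 0)})"
      using T0 openin_open_subtopology by blast
    moreover have "f t \<in> quot_chart_open 2 n r b' v W \<longleftrightarrow> D t \<noteq> 0 \<and> x t \<in> W 0 \<and> y t \<in> W (Suc 0)"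
      if t: "t \<in> topspace T" for t
    proof -
      interpret quotient_functional n r "f t" "coord (f t) b" b by (rule chart_functional[OF f[OF t]])
      show ?thesis
      proof (cases "quotient_basis 2 n r (f t) b'")
        case qb: True
        then show ?thesis
          using coord_cramer[OF qb v] quotient_basis_det[of b'] in_quot_points
          by (simp add: quot_chart_open_eq[OF v] chart_def D_def x_def y_def)
      next
        case False
        then show ?thesis
          using quotient_basis_det[of b'] True by (simp add: quot_chart_open_eq[OF v] chart_def D_def)
      qed
    qed
    then have "{t \<in> topspace T. f t \<in> quot_chart_open 2 n r b' v W}
        = {t \<in> T0. x t \<in> W 0} \<inter> {t \<in> T0. y t \<in> W (Suc 0)}"
      by (auto simp: T0_def)
    ultimately show ?thesis by simp
  qed
  then have "continuous_map T (quot_space 2 n r) f"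
    unfolding quot_space_def
  proof (intro continuous_on_generated_topo)
    fix U assume "U \<in> {quot_chart_open 2 n r b v W |b v W. v \<in> vecs n r \<and> (\<forall>i<2. open (W i))}"
    then obtain b' v W where U: "U = quot_chart_open 2 n r b' v W" "v \<in> vecs n r" "\<forall>i<2. open (W i)" by blast
    have "f -` U \<inter> topspace T = {t \<in> topspace T. f t \<in> U}" by auto
    then show "openin T (f -` U \<inter> topspace T)"
      using pre[OF U(2,3), of b'] U(1) by simp
  next
    have "f t \<in> quot_chart_open 2 n r b 0 (\<lambda>_. UNIV)" if "t \<in> topspace T" for t
      using f[OF that] by (simp add: quot_chart_open_eq[OF vecs_0])
    moreover have "quot_chart_open 2 n r b 0 (\<lambda>_. UNIV)
        \<in> {quot_chart_open 2 n r b v W |b v W. v \<in> vecs n r \<and> (\<forall>i<2. open (W i))}"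
      using vecs_0 by (intro CollectI exI conjI refl) auto
    ultimately show "f ` topspace T \<subseteq> \<Union> {quot_chart_open 2 n r b v W |b v W. v \<in> vecs n r \<and> (\<forall>i<2. open (W i))}"
      by (intro image_subsetI UnionI)
  qed
  then show ?thesis using f by (auto simp: continuous_map_in_subtopology)
qed

lemma continuous_map_app:
  assumes "continuous_map X euclidean A" "continuous_map X euclidean p"
  shows "continuous_map X euclidean (\<lambda>x. app (A x) (p x))"
proof -
  have "continuous_on UNIV (\<lambda>q. app (fst q) (snd q))"
    unfolding app_def sc_def by (intro continuous_intros)
  from continuous_map_euclidean_compose[OF continuous_map_euclidean_pair[OF assms] this]
  show ?thesis by simp
qed

lemma continuous_map_sc:
  assumes "continuous_map X euclidean p"
  shows "continuous_map X euclidean (\<lambda>x. sc c (p x))"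
proof (rule continuous_map_euclidean_compose[OF assms])
  show "continuous_on UNIV (sc c)" unfolding sc_def by (intro continuous_intros)
qed

lemma continuous_map_mact:
  assumes "\<And>l. l < n \<Longrightarrow> continuous_map X euclidean (\<lambda>x. A x l)" "continuous_map X euclidean p"
  shows "continuous_map X euclidean (\<lambda>x. mact n (A x) m (p x))"
  using assms(1)
proof (induction n)
  case (Suc n)
  then have IH: "continuous_map X euclidean (\<lambda>x. mact n (A x) m (p x))" by simp
  have "continuous_map X euclidean (\<lambda>x. (app (A x n) ^^ k) (mact n (A x) m (p x)))" for k
    by (induction k) (simp_all add: IH continuous_map_app Suc.prems)
  then show ?case by simp
qed (simp add: assms(2))

lemma continuous_map_\<Phi>:
  assumes "\<And>l. l < n \<Longrightarrow> continuous_map X euclidean (\<lambda>x. A x l)"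
    and "\<And>k. k < r \<Longrightarrow> continuous_map X euclidean (\<lambda>x. u x k)" and w: "w \<in> vecs n r"
  shows "continuous_map X euclidean (\<lambda>x. \<Phi> n (A x) (u x) w)"
  using w
proof (induction w rule: vec_induct)
  case (add v w)
  then show ?case by (simp add: \<Phi>_add continuous_map_euclidean_add)
next
  case (mon c m k)
  then show ?case
    unfolding \<Phi>_mon by (intro continuous_map_sc continuous_map_mact assms(1) assms(2)[of k]) auto
qed (simp add: \<Phi>_zero)

lemma point_of_in_chart:
  assumes "commuting n A" "b 0 \<in> vecs n r" "b (Suc 0) \<in> vecs n r"
    "\<Phi> n A u (b 0) = (1, 0)" "\<Phi> n A u (b (Suc 0)) = (0, 1)"
  shows "point_of n r A u \<in> chart n r b"
    and "v \<in> vecs n r \<Longrightarrow> coord (point_of n r A u) b v = \<Phi> n A u v"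
proof -
  interpret quotient_functional n r "point_of n r A u" "\<Phi> n A u" b
    using assms by (rule quotient_functional_point_of)
  show "point_of n r A u \<in> chart n r b"
    using in_quot_points quotient_basis_b by (simp add: chart_def)
  show "v \<in> vecs n r \<Longrightarrow> coord (point_of n r A u) b v = \<Phi> n A u v" by (rule coord_b)
qed

text \<open>The scaling homotopies and the sections of the charts are all given by continuously
  varying matrix data. The coordinates of the resulting point are polynomials in the
  entries.\<close>

lemma continuous_map_point_of:
  assumes "b 0 \<in> vecs n r" "b (Suc 0) \<in> vecs n r"
    and t: "\<And>t. t \<in> topspace T \<Longrightarrow> commuting n (A t)"
      "\<And>t. t \<in> topspace T \<Longrightarrow> \<Phi> n (A t) (u t) (b 0) = (1, 0)"
      "\<And>t. t \<in> topspace T \<Longrightarrow> \<Phi> n (A t) (u t) (b (Suc 0)) = (0, 1)"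
    and A: "\<And>l. l < n \<Longrightarrow> continuous_map T euclidean (\<lambda>t. A t l)"
    and u: "\<And>k. k < r \<Longrightarrow> continuous_map T euclidean (\<lambda>t. u t k)"
  shows "continuous_map T (chart_space n r b) (\<lambda>t. point_of n r (A t) (u t))"
proof (rule continuous_map_into_chart_space)
  fix t assume "t \<in> topspace T"
  then show "point_of n r (A t) (u t) \<in> chart n r b"
    using assms by (intro point_of_in_chart) auto
next
  fix v assume v: "v \<in> vecs n r"
  have "continuous_map T euclidean (\<lambda>t. \<Phi> n (A t) (u t) v)"
    by (rule continuous_map_\<Phi>[OF A u v])
  then show "continuous_map T euclidean (\<lambda>t. coord (point_of n r (A t) (u t)) b v)"
    by (rule continuous_map_eq) (use assms v point_of_in_chart(2) in auto)
qed


section \<open>The cells\<close>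

lemma mact_cong: "(\<And>l. l < n \<Longrightarrow> A l = A' l) \<Longrightarrow> mact n A m = mact n A' m"
  by (induction n) auto

lemma point_of_cong:
  assumes A: "\<And>l. l < n \<Longrightarrow> A l = A' l" and u: "\<And>k. k < r \<Longrightarrow> u k = u' k"
  shows "point_of n r A u = point_of n r A' u'"
proof -
  have "\<Phi> n A u v = \<Phi> n A' u' v" if "v \<in> vecs n r" for v
    using that
    by (induction v rule: vec_induct) (simp_all add: \<Phi>_zero \<Phi>_add \<Phi>_mon u mact_cong[of n A A', OF A])
  then show ?thesis by (auto simp: point_of_def)
qed

lemma continuous_map_sc2:
  assumes "continuous_map X euclidean c" "continuous_map X euclidean p"
  shows "continuous_map X euclidean (\<lambda>x. sc (c x) (p x))"
proof -
  have "continuous_on UNIV (\<lambda>q. sc (fst q) (snd q))"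
    unfolding sc_def by (intro continuous_intros)
  from continuous_map_euclidean_compose[OF continuous_map_euclidean_pair[OF assms] this]
  show ?thesis by simp
qed

text \<open>What attaching the chart \<open>W\<close> to the union \<open>U\<close> of its
  predecessors requires of the pair.\<close>

definition cell_attached :: "'a topology \<Rightarrow> 'a set \<Rightarrow> 'a set \<Rightarrow> nat \<Rightarrow> bool" where
  "cell_attached X W U c \<longleftrightarrow> contractible_space (subtopology X W) \<and> W \<noteq> {} \<and>
     (c = 0 \<longrightarrow> W \<inter> U = {}) \<and>
     (c > 0 \<longrightarrow> subtopology X (W \<inter> U) homotopy_equivalent_space nsphere (2 * c - 1))"

lemma cell_attachedI:
  fixes g :: "vec set \<Rightarrow> 'i \<Rightarrow> complex" and s :: "('i \<Rightarrow> complex) \<Rightarrow> vec set"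
    and \<Theta> :: "real \<Rightarrow> real \<Rightarrow> vec set \<Rightarrow> vec set"
  assumes S: "finite S" "card S = c"
    and g: "\<And>i. i \<in> S \<Longrightarrow> continuous_map (chart_space n r b) euclidean (\<lambda>x. g x i)"
    and \<Theta>: "continuous_map (prod_topology (prod_topology euclidean euclidean) (chart_space n r b))
       (chart_space n r b) (\<lambda>x. \<Theta> (fst (fst x)) (snd (fst x)) (snd x))"
    and s: "continuous_map (product_topology (\<lambda>_. euclidean) UNIV) (chart_space n r b) s"
    and \<Theta>1: "\<And>x. x \<in> chart n r b \<Longrightarrow> \<Theta> 1 1 x = x"
    and \<Theta>g: "\<And>l t x i. x \<in> chart n r b \<Longrightarrow> i \<in> S \<Longrightarrow> g (\<Theta> l t x) i = of_real l * g x i"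
    and \<Theta>0: "\<And>l x. x \<in> chart n r b \<Longrightarrow> \<Theta> l 0 x = s (\<lambda>i. if i \<in> S then of_real l * g x i else 0)"
    and gs: "\<And>y i. i \<in> S \<Longrightarrow> g (s y) i = y i"
    and U: "\<And>x. x \<in> chart n r b \<Longrightarrow> x \<in> U \<longleftrightarrow> (\<exists>i\<in>S. g x i \<noteq> 0)"
  shows "cell_attached (quot_space 2 n r) (chart n r b) U c"
proof -
  have \<Theta>': "continuous_map (prod_topology (prod_topology euclidean euclidean) (chart_space n r b))
       (chart_space n r b) (\<lambda>((l, t), x). \<Theta> l t x)"
    using \<Theta> by (simp add: case_prod_unfold)
  note top = topspace_chart_space[of n r b]
  note * = indexed_cell_homotopy[where W = "chart_space n r b" and \<Theta> = \<Theta> and g = g and s = s,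
      OF S g \<Theta>' s]
  have 1: "contractible_space (chart_space n r b)"
    by (rule *(1)) (use \<Theta>1 \<Theta>g \<Theta>0 gs top in auto)
  have 2: "subtopology (chart_space n r b) {x. \<exists>i\<in>S. g x i \<noteq> 0} homotopy_equivalent_space nsphere (2 * c - 1)"
    if "c > 0"
    by (rule *(2)) (use that \<Theta>1 \<Theta>g \<Theta>0 gs top in auto)
  have eq: "chart n r b \<inter> {x. \<exists>i\<in>S. g x i \<noteq> 0} = chart n r b \<inter> U" using U by auto
  have "s (\<lambda>_. 0) \<in> topspace (chart_space n r b)"
    using s by (auto simp: continuous_map_def)
  then have "chart n r b \<noteq> {}" using top by auto
  moreover have "chart n r b \<inter> U = {}" if "c = 0" using S that U by auto
  moreover have "subtopology (quot_space 2 n r) (chart n r b \<inter> U) homotopy_equivalent_space nsphere (2 * c - 1)"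
    if "c > 0"
    using 2[OF that] by (simp only: subtopology_subtopology eq)
  ultimately show ?thesis using 1 by (simp add: cell_attached_def)
qed

section \<open>Scaling the two kinds of charts\<close>

context
  fixes n r :: nat
begin

abbreviation (input) homotopy_domain :: "(nat \<Rightarrow> vec) \<Rightarrow> ((real \<times> real) \<times> vec set) topology" where
  "homotopy_domain b \<equiv> prod_topology (prod_topology euclidean euclidean) (chart_space n r b)"

lemma continuous_map_homotopy_domain:
  "continuous_map (homotopy_domain b) euclidean (\<lambda>x. complex_of_real (fst (fst x)))"
  "continuous_map (homotopy_domain b) euclidean (\<lambda>x. complex_of_real (snd (fst x)))"
  "v \<in> vecs n r \<Longrightarrow> continuous_map (homotopy_domain b) euclidean (\<lambda>x. coord (snd x) b v)"
proof -
  have of_real: "continuous_on UNIV (of_real :: real \<Rightarrow> complex)" by (intro continuous_intros)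
  have *: "continuous_map (homotopy_domain b) (prod_topology euclidean euclidean) fst"
    by (rule continuous_map_fst)
  have "continuous_map (homotopy_domain b) euclidean (fst \<circ> fst)"
    by (rule continuous_map_compose[OF * continuous_map_fst])
  from continuous_map_euclidean_compose[OF this of_real]
  show "continuous_map (homotopy_domain b) euclidean (\<lambda>x. complex_of_real (fst (fst x)))"
    by (simp only: o_def)
  have "continuous_map (homotopy_domain b) euclidean (snd \<circ> fst)"
    by (rule continuous_map_compose[OF * continuous_map_snd])
  from continuous_map_euclidean_compose[OF this of_real]
  show "continuous_map (homotopy_domain b) euclidean (\<lambda>x. complex_of_real (snd (fst x)))"
    by (simp only: o_def)
  show "continuous_map (homotopy_domain b) euclidean (\<lambda>x. coord (snd x) b v)" if "v \<in> vecs n r"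
    using continuous_map_compose[OF continuous_map_snd continuous_map_coord[OF that]] by (simp add: o_def)
qed

text \<open>With \<open>v i\<close> and \<open>v j\<close> as standard basis, a point avoids all
  earlier charts iff its vectors are in echelon form: first coordinates vanish before position
  \<open>i\<close>, second coordinates before position \<open>j\<close>. The second coordinate at
  \<open>i\<close> is 0 anyway, which leaves \<open>i + (j - 1)\<close> equations. The matrices do
  not enter them.\<close>

lemma cell_attached_grassmannian:
  assumes ij: "i < j" "j < r"
  shows "cell_attached (quot_space 2 n r) (chart n r (std_basis (0, i, j)))
    (\<Union>\<kappa>\<in>{\<kappa> \<in> chart_index n r. \<kappa> < (0, i, j)}. chart n r (std_basis \<kappa>)) (i + j - 1)"
proof -
  define b where "b = std_basis (0, i, j)"
  have b: "b 0 = evec i" "b (Suc 0) = evec j" by (simp_all add: b_def std_basis_def)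
  have bv: "b 0 \<in> vecs n r" "b (Suc 0) \<in> vecs n r" using ij by (simp_all add: b evec_vecs)
  define S where "S = {0::nat} \<times> {..<i} \<union> {1} \<times> ({..<j} - {i})"
  define v where "v K k = coord K b (evec k)" for K k
  define A where "A K l = (coord K b (smul (xvar l) (b 0)), coord K b (smul (xvar l) (b (Suc 0))))" for K l
  define g where "g K = (\<lambda>(\<tau>::nat, k). if \<tau> = 0 then fst (v K k) else snd (v K k))" for K
  \<comment> \<open>Scaling all matrices by the same factor preserves commutation.\<close>
  define B where "B t K l = (sc (of_real t) (fst (A K l)), sc (of_real t) (snd (A K l)))" for t K l
  \<comment> \<open>Coordinates indexed by \<open>S\<close> are scaled by \<open>a\<close>, the
    others by \<open>t\<close>; \<open>v i\<close> and \<open>v j\<close> stay fixed to remain in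
    the chart.\<close>
  define u where "u a t K k = (if k = i then (1, 0) else if k = j then (0, 1) else
      (complex_of_real (if k < i then a else t) * fst (v K k),
       complex_of_real (if k < j then a else t) * snd (v K k)))" for a t K k
  define \<Theta> where "\<Theta> a t K = point_of n r (B t K) (u a t K)" for a t K
  \<comment> \<open>The core of the chart: zero matrices, and only the coordinates indexed by
    \<open>S\<close> free.\<close>
  define us where "us y k = (if k = i then (1, 0) else if k = j then (0, 1) else
      (if k < i then y (0::nat, k) else 0, if k < j then y (1, k) else (0::complex)))"
    for y :: "nat \<times> nat \<Rightarrow> complex" and k
  define s where "s y = point_of n r (\<lambda>_. 0) (us y)" for y
  have app0: "app 0 p = 0" for p by (simp add: app_def sc_def prod_eq_iff)
  have comm0: "commuting n (\<lambda>_. 0)" by (simp add: commuting_def app0)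
  have \<phi>: "quotient_functional n r K (coord K b) b" if "K \<in> chart n r b" for K
    by (rule chart_functional[OF that])
  have v_ij: "v K i = (1, 0)" "v K j = (0, 1)" if "K \<in> chart n r b" for K
    using quotient_functional.\<phi>b[OF \<phi>[OF that]] by (simp_all add: v_def b)
  have KA: "K = point_of n r (A K) (v K)" "commuting n (A K)" if "K \<in> chart n r b" for K
    using quotient_functional.functional_eq_\<Phi>(1,3)[OF \<phi>[OF that]]
    by (simp_all add: A_def[abs_def] v_def[abs_def])
  have commB: "commuting n (B t K)" if K: "K \<in> chart n r b" for K t
  proof -
    have "app (B t K l) p = sc (of_real t) (app (A K l) p)" for l p
      by (simp add: B_def app_def sc_def prod_eq_iff algebra_simps)
    then show ?thesis using KA(2)[OF K] by (simp add: commuting_def app_linear)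
  qed
  have \<Phi>\<Theta>: "\<Phi> n C (u a t K) (b 0) = (1, 0)" "\<Phi> n C (u a t K) (b (Suc 0)) = (0, 1)" for C a t K
    using ij by (simp_all add: b \<Phi>_evec u_def)
  have \<Phi>s: "\<Phi> n C (us y) (b 0) = (1, 0)" "\<Phi> n C (us y) (b (Suc 0)) = (0, 1)" for C y
    using ij by (simp_all add: b \<Phi>_evec us_def)
  have v\<Theta>: "v (\<Theta> a t K) k = u a t K k" if "K \<in> chart n r b" "k < r" for a t K k
    unfolding v_def \<Theta>_def
    by (subst point_of_in_chart(2)[OF commB[OF that(1)] bv \<Phi>\<Theta>]) (simp_all add: \<Phi>_evec evec_vecs that)
  have vs: "v (s y) k = us y k" if "k < r" for y k
    unfolding v_def s_def
    by (subst point_of_in_chart(2)[OF comm0 bv \<Phi>s]) (simp_all add: \<Phi>_evec evec_vecs that)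
  have S_iff: "(0, k) \<in> S \<longleftrightarrow> k < i" "(1, k) \<in> S \<longleftrightarrow> k < j \<and> k \<noteq> i" for k
    by (auto simp: S_def)
  have S_cases: "(\<exists>k. \<iota> = (0, k) \<and> k < i) \<or> (\<exists>k. \<iota> = (1, k) \<and> k < j \<and> k \<noteq> i)" if "\<iota> \<in> S" for \<iota>
    using that by (auto simp: S_def)
  have "cell_attached (quot_space 2 n r) (chart n r b)
    (\<Union>\<kappa>\<in>{\<kappa> \<in> chart_index n r. \<kappa> < (0, i, j)}. chart n r (std_basis \<kappa>)) (i + j - 1)"
  proof (rule cell_attachedI[where S = S and g = g and \<Theta> = \<Theta> and s = s])
    show "finite S" by (simp add: S_def)
    have "card S = i + card ({..<j} - {i})"
      unfolding S_def by (subst card_Un_disjoint) (auto simp: card_cartesian_product)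
    then show "card S = i + j - 1" using ij by simp
  next
    fix \<iota> assume "\<iota> \<in> S"
    then have k: "snd \<iota> < r" using ij by (auto simp: S_def)
    have "continuous_map (chart_space n r b) euclidean (\<lambda>K. v K (snd \<iota>))"
      unfolding v_def by (rule continuous_map_coord) (simp add: evec_vecs k)
    then show "continuous_map (chart_space n r b) euclidean (\<lambda>K. g K \<iota>)"
      by (cases "fst \<iota> = 0")
        (simp_all add: g_def case_prod_unfold continuous_map_fst_euclidean continuous_map_snd_euclidean)
  next
    show "continuous_map (homotopy_domain b) (chart_space n r b) (\<lambda>x. \<Theta> (fst (fst x)) (snd (fst x)) (snd x))"
      unfolding \<Theta>_def
    proof (rule continuous_map_point_of[OF bv _ \<Phi>\<Theta>])
      fix x assume "x \<in> topspace (homotopy_domain b)"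
      then show "commuting n (B (snd (fst x)) (snd x))"
        using topspace_chart_space by (intro commB) auto
    next
      fix l assume l: "l < n"
      note x = vecs_smul[OF xvar_polys[OF l] bv(1)] vecs_smul[OF xvar_polys[OF l] bv(2)]
      show "continuous_map (homotopy_domain b) euclidean (\<lambda>x. B (snd (fst x)) (snd x) l)"
        unfolding B_def A_def fst_conv snd_conv
        by (intro continuous_map_euclidean_pair continuous_map_sc2 continuous_map_homotopy_domain x)
    next
      fix k assume k: "k < r"
      have vk: "continuous_map (homotopy_domain b) euclidean (\<lambda>x. v (snd x) k)"
        unfolding v_def by (rule continuous_map_homotopy_domain(3)) (simp add: evec_vecs k)
      have sel: "continuous_map (homotopy_domain b) euclidean
          (\<lambda>x. complex_of_real (if Q then fst (fst x) else snd (fst x)))" for Q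
        by (cases Q) (simp_all only: continuous_map_homotopy_domain if_True if_False)
      consider "k = i" | "k = j" "k \<noteq> i" | "k \<noteq> i" "k \<noteq> j" by blast
      then show "continuous_map (homotopy_domain b) euclidean (\<lambda>x. u (fst (fst x)) (snd (fst x)) (snd x) k)"
      proof cases
        case 3
        then show ?thesis
          unfolding u_def
          by (simp only: if_False)
            (intro continuous_map_euclidean_pair continuous_map_euclidean_mult sel
              continuous_map_fst_euclidean continuous_map_snd_euclidean vk)
      qed (simp_all add: u_def)
    qed
  next
    show "continuous_map (product_topology (\<lambda>_. euclidean) UNIV) (chart_space n r b) s"
      unfolding s_def
    proof (rule continuous_map_point_of[OF bv comm0 \<Phi>s])
      fix k assume "k < r"
      have "continuous_map (product_topology (\<lambda>_. euclidean) UNIV) euclidean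
          (\<lambda>y. if Q then y \<iota> else (0::complex))" for Q and \<iota> :: "nat \<times> nat"
        by (cases Q) (auto intro: continuous_map_product_projection)
      then show "continuous_map (product_topology (\<lambda>_. euclidean) UNIV) euclidean (\<lambda>y. us y k)"
        unfolding us_def by (cases "k = i"; cases "k = j") (auto intro!: continuous_map_euclidean_pair)
    qed auto
  next
    fix K assume K: "K \<in> chart n r b"
    have "u 1 1 K k = v K k" for k using v_ij[OF K] by (auto simp: u_def)
    moreover have "B 1 K l = A K l" for l by (simp add: B_def sc_simps)
    ultimately have "\<Theta> 1 1 K = point_of n r (A K) (v K)"
      unfolding \<Theta>_def by (intro point_of_cong) auto
    then show "\<Theta> 1 1 K = K" using KA(1)[OF K] by simp
  next
    fix a t K \<iota> assume K: "K \<in> chart n r b" and \<iota>: "\<iota> \<in> S"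
    from S_cases[OF \<iota>] show "g (\<Theta> a t K) \<iota> = of_real a * g K \<iota>"
      using ij by (auto simp: g_def v\<Theta>[OF K] u_def)
  next
    fix a K assume K: "K \<in> chart n r b"
    show "\<Theta> a 0 K = s (\<lambda>\<iota>. if \<iota> \<in> S then of_real a * g K \<iota> else 0)"
      unfolding \<Theta>_def s_def
    proof (rule point_of_cong)
      show "B 0 K l = 0" for l by (simp add: B_def sc_simps zero_prod_def)
      show "u a 0 K k = us (\<lambda>\<iota>. if \<iota> \<in> S then of_real a * g K \<iota> else 0) k" for k
        using ij by (auto simp: u_def us_def S_def g_def)
    qed
  next
    fix y \<iota> assume \<iota>: "\<iota> \<in> S"
    from S_cases[OF \<iota>] show "g (s y) \<iota> = y \<iota>"
      using ij by (auto simp: g_def vs us_def)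
  next
    fix K assume KC: "K \<in> chart n r b"
    interpret quotient_functional n r K "coord K b" b by (rule \<phi>[OF KC])
    have in_chart: "K \<in> chart n r (std_basis (0, i', j')) \<longleftrightarrow> det2 (v K i') (v K j') \<noteq> 0"
      if "i' < j'" "j' < r" for i' j'
      using in_quot_points quotient_basis_det[of "std_basis (0, i', j')"] that
      by (simp add: chart_def std_basis_def evec_vecs v_def)
    show "K \<in> (\<Union>\<kappa>\<in>{\<kappa> \<in> chart_index n r. \<kappa> < (0, i, j)}. chart n r (std_basis \<kappa>)) \<longleftrightarrow> (\<exists>\<iota>\<in>S. g K \<iota> \<noteq> 0)"
      (is "?L \<longleftrightarrow> ?R")
    proof
      assume ?L
      then obtain i' j' where \<kappa>: "i' < j'" "j' < r" "i' < i \<or> i' = i \<and> j' < j"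
        "K \<in> chart n r (std_basis (0, i', j'))"
        by (auto simp: chart_index_def le_less)
      then have d: "det2 (v K i') (v K j') \<noteq> 0" using in_chart by blast
      show ?R
      proof (rule ccontr)
        assume "\<not> ?R"
        then have z: "fst (v K k) = 0" if "k < i" for k
          using S_iff(1)[of k] that by (force simp: g_def)
        have z': "snd (v K k) = 0" if "k < j" "k \<noteq> i" for k
          using \<open>\<not> ?R\<close> S_iff(2)[of k] that by (force simp: g_def)
        \<comment> \<open>For \<open>i' < i\<close> both coordinates of \<open>v K i'\<close>
          vanish; for \<open>i' = i\<close> the vector \<open>v K j'\<close> is parallel to
          \<open>v K i\<close>.\<close>
        show False
        proof (cases "i' < i")
          case True
          then show ?thesis using d z[of i'] z'[of i'] ij by (simp add: det2_def)
        next
          case False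
          then show ?thesis using d \<kappa> z'[of j'] v_ij[OF KC] by (simp add: det2_def)
        qed
      qed
    next
      assume ?R
      then obtain \<iota> where \<iota>: "\<iota> \<in> S" "g K \<iota> \<noteq> 0" by blast
      have idx: "(0, i', j') \<in> chart_index n r" if "i' < j'" "j' < r" for i' j'
        using that by (simp add: chart_index_def)
      \<comment> \<open>Exchange: the nonzero coordinate lets \<open>v K k\<close> replace one of
        the two basis vectors, and the new pair, sorted, precedes \<open>(i, j)\<close>.\<close>
      consider k where "k < i" "fst (v K k) \<noteq> 0" | k where "k < i" "snd (v K k) \<noteq> 0"
        | k where "i < k" "k < j" "snd (v K k) \<noteq> 0"
        using S_cases[OF \<iota>(1)] \<iota>(2) by (auto simp: g_def) (metis linorder_neqE_nat)
      then show ?L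
      proof cases
        case 1
        then have "det2 (v K k) (v K j) \<noteq> 0" using v_ij[OF KC] by (simp add: det2_def)
        then show ?thesis using 1 ij in_chart[of k j] idx[of k j] by (auto intro!: bexI[of _ "(0, k, j)"])
      next
        case 2
        then have "det2 (v K k) (v K i) \<noteq> 0" using v_ij[OF KC] by (simp add: det2_def)
        then show ?thesis using 2 ij in_chart[of k i] idx[of k i] by (auto intro!: bexI[of _ "(0, k, i)"])
      next
        case 3
        then have "det2 (v K i) (v K k) \<noteq> 0" using v_ij[OF KC] by (simp add: det2_def)
        then show ?thesis using 3 ij in_chart[of i k] idx[of i k] by (auto intro!: bexI[of _ "(0, i, k)"])
      qed
    qed
  qed
  then show ?thesis by (simp add: b_def)
qed


text \<open>The matrix of \<open>\<alpha> + \<beta> x\<close> in the basis \<open>1, x\<close>, where \<open>w\<close> contains the coordinates of \<open>x\<^sup>2\<close>.\<close>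

definition affine_mat :: "complex \<Rightarrow> complex \<Rightarrow> c2 \<Rightarrow> mat2" where
  "affine_mat \<alpha> \<beta> w = ((\<alpha>, \<beta>), (\<beta> * fst w, \<alpha> + \<beta> * snd w))"

lemma commuting_affine_mat: "commuting n (\<lambda>k. affine_mat (\<alpha> k) (\<beta> k) w)"
  by (simp add: commuting_def affine_mat_def app_def sc_def algebra_simps)

lemma continuous_map_affine_mat:
  assumes "continuous_map X euclidean \<alpha>" "continuous_map X euclidean \<beta>" "continuous_map X euclidean w"
  shows "continuous_map X euclidean (\<lambda>x. affine_mat (\<alpha> x) (\<beta> x) (w x))"
  unfolding affine_mat_def
  by (intro continuous_map_euclidean_pair continuous_map_euclidean_mult continuous_map_euclidean_add
      continuous_map_fst_euclidean continuous_map_snd_euclidean assms)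

text \<open>Here \<open>v i\<close> is a cyclic vector of the \<open>l\<close>-th matrix, so every
  matrix commuting with that one is determined by its value at \<open>v i\<close>, and the chart is
  an affine space. A point avoids all earlier charts iff every \<open>v k\<close> is a multiple of
  \<open>v i\<close>, which is zero for \<open>k < i\<close>, and every \<open>e K k\<close> with
  \<open>k < l\<close> is a multiple of \<open>v i\<close>. These are \<open>r - 1\<close>,
  \<open>i\<close> and \<open>l\<close> equations.\<close>

lemma cell_attached_curvilinear:
  assumes il: "i < r" "l < n"
  shows "cell_attached (quot_space 2 n r) (chart n r (std_basis (1, i, l)))
    (\<Union>\<kappa>\<in>{\<kappa> \<in> chart_index n r. \<kappa> < (1, i, l)}. chart n r (std_basis \<kappa>)) (r - 1 + i + l)"
proof -
  define b where "b = std_basis (1, i, l)"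
  have b: "b 0 = evec i" "b (Suc 0) = smul (xvar l) (evec i)" by (simp_all add: b_def std_basis_def)
  have bv: "b 0 \<in> vecs n r" "b (Suc 0) \<in> vecs n r"
    using il by (simp_all add: b evec_vecs vecs_smul xvar_polys)
  \<comment> \<open>The tag 0 stands for first coordinates of the vectors, 1 for their second
    coordinates, and 2 for second coordinates of the \<open>e K k\<close>.\<close>
  define S where "S = {0::nat} \<times> {..<i} \<union> {1} \<times> ({..<r} - {i}) \<union> {2} \<times> {..<l}"
  define v where "v K k = coord K b (evec k)" for K k
  define e where "e K k = coord K b (smul (xvar k) (evec i))" for K k
  define w where "w K = coord K b (smul (xvar l) (b (Suc 0)))" for K
  define g where "g K = (\<lambda>(\<tau>::nat, k). if \<tau> = 0 then fst (v K k) else if \<tau> = 1 then snd (v K k) else snd (e K k))" for K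
  \<comment> \<open>For \<open>k = l\<close> the values of \<open>\<alpha>\<close> and
    \<open>\<beta>\<close> are pinned to 0 and 1, because the \<open>l\<close>-th variable must keep
    sending \<open>v i\<close> to the second basis vector.\<close>
  define \<alpha> where "\<alpha> t K k = (if k = l then 0 else complex_of_real t * fst (e K k))" for t K k
  define \<beta> where "\<beta> a t K k = (if k = l then 1 else complex_of_real (if k < l then a else t) * snd (e K k))" for a t K k
  define B where "B a t K k = affine_mat (\<alpha> t K k) (\<beta> a t K k) (sc (of_real t) (w K))" for a t K k
  define u where "u a t K k = (if k = i then (1, 0) else
      (complex_of_real (if k < i then a else t) * fst (v K k), complex_of_real a * snd (v K k)))" for a t K k
  define \<Theta> where "\<Theta> a t K = point_of n r (B a t K) (u a t K)" for a t K
  define Bs where "Bs y k = affine_mat 0 (if k = l then 1 else if k < l then y (2::nat, k) else 0) 0"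
    for y :: "nat \<times> nat \<Rightarrow> complex" and k
  define us where "us y k = (if k = i then (1, 0) else (if k < i then y (0::nat, k) else 0, y (1, k)))"
    for y :: "nat \<times> nat \<Rightarrow> complex" and k
  define s where "s y = point_of n r (Bs y) (us y)" for y
  have \<phi>: "quotient_functional n r K (coord K b) b" if "K \<in> chart n r b" for K
    by (rule chart_functional[OF that])
  have v_i: "v K i = (1, 0)" and e_l: "e K l = (0, 1)" if "K \<in> chart n r b" for K
    using quotient_functional.\<phi>b[OF \<phi>[OF that]] by (simp_all add: v_def e_def b)
  have mat: "coord K b (smul (xvar k) x) = app (e K k, coord K b (smul (xvar k) (b (Suc 0)))) (coord K b x)"
    if "K \<in> chart n r b" "k < n" "x \<in> vecs n r" for K k x
    using quotient_functional.mat_of[OF \<phi>[OF that(1)] that(2,3)] by (simp add: e_def b(1))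
  have matl: "coord K b (smul (xvar l) x) = app ((0, 1), w K) (coord K b x)"
    if "K \<in> chart n r b" "x \<in> vecs n r" for K x
    using mat[OF that(1) il(2) that(2)] e_l[OF that(1)] by (simp add: w_def)
  have KA: "K = point_of n r (\<lambda>k. affine_mat (fst (e K k)) (snd (e K k)) (w K)) (v K)"
    if K: "K \<in> chart n r b" for K
  proof -
    have "K = point_of n r (\<lambda>k. (e K k, coord K b (smul (xvar k) (b (Suc 0))))) (v K)"
      using quotient_functional.functional_eq_\<Phi>(3)[OF \<phi>[OF K]] by (simp add: e_def v_def[abs_def] b(1))
    \<comment> \<open>The second column is the \<open>k\<close>-th variable applied to the
      \<open>l\<close>-th applied to generator \<open>i\<close>. Exchanging the two variables
      computes it from the first column \<open>e K k\<close> and \<open>w K\<close>.\<close>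
    also have "\<dots> = point_of n r (\<lambda>k. affine_mat (fst (e K k)) (snd (e K k)) (w K)) (v K)"
    proof (rule point_of_cong)
      fix k assume k: "k < n"
      have ev: "smul (xvar k) (evec i) \<in> vecs n r" using k il by (intro vecs_smul xvar_polys evec_vecs)
      have "smul (xvar k) (b (Suc 0)) = smul (xvar l) (smul (xvar k) (evec i))"
        unfolding b by (rule smul_commute)
      then have "coord K b (smul (xvar k) (b (Suc 0))) = app ((0, 1), w K) (e K k)"
        using matl[OF K ev] by (simp add: e_def)
      then show "(e K k, coord K b (smul (xvar k) (b (Suc 0)))) = affine_mat (fst (e K k)) (snd (e K k)) (w K)"
        by (simp add: affine_mat_def app_def sc_def prod_eq_iff)
    qed simp
    finally show ?thesis .
  qed
  have commB: "commuting n (B a t K)" for a t K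
    unfolding B_def by (rule commuting_affine_mat)
  have commBs: "commuting n (Bs y)" for y
    unfolding Bs_def by (rule commuting_affine_mat)
  have \<Phi>\<Theta>: "\<Phi> n (B a t K) (u a t K) (b 0) = (1, 0)" "\<Phi> n (B a t K) (u a t K) (b (Suc 0)) = (0, 1)" for a t K
    using il by (simp_all add: b \<Phi>_evec \<Phi>_xvar[OF evec_vecs commB] u_def app_basis)
      (simp_all add: B_def \<alpha>_def \<beta>_def affine_mat_def)
  have \<Phi>s: "\<Phi> n (Bs y) (us y) (b 0) = (1, 0)" "\<Phi> n (Bs y) (us y) (b (Suc 0)) = (0, 1)" for y
    using il by (simp_all add: b \<Phi>_evec \<Phi>_xvar[OF evec_vecs commBs] us_def app_basis)
      (simp_all add: Bs_def affine_mat_def)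
  have v\<Theta>: "v (\<Theta> a t K) k = u a t K k" if "k < r" for a t K k
    unfolding v_def \<Theta>_def
    by (subst point_of_in_chart(2)[OF commB bv \<Phi>\<Theta>]) (simp_all add: \<Phi>_evec evec_vecs that)
  have e\<Theta>: "e (\<Theta> a t K) k = (\<alpha> t K k, \<beta> a t K k)" if "k < n" for a t K k
    unfolding e_def \<Theta>_def
    by (subst point_of_in_chart(2)[OF commB bv \<Phi>\<Theta>])
      (use il that in \<open>simp_all add: \<Phi>_xvar[OF evec_vecs commB] \<Phi>_evec vecs_smul xvar_polys evec_vecs
          u_def app_basis B_def affine_mat_def\<close>)
  have vs: "v (s y) k = us y k" if "k < r" for y k
    unfolding v_def s_def
    by (subst point_of_in_chart(2)[OF commBs bv \<Phi>s]) (simp_all add: \<Phi>_evec evec_vecs that)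
  have es: "e (s y) k = (0, if k = l then 1 else if k < l then y (2, k) else 0)" if "k < n" for y k
    unfolding e_def s_def
    by (subst point_of_in_chart(2)[OF commBs bv \<Phi>s])
      (use il that in \<open>simp_all add: \<Phi>_xvar[OF evec_vecs commBs] \<Phi>_evec vecs_smul xvar_polys evec_vecs
          us_def app_basis Bs_def affine_mat_def\<close>)
  have S_cases: "(\<exists>k. \<iota> = (0, k) \<and> k < i) \<or> (\<exists>k. \<iota> = (1, k) \<and> k < r \<and> k \<noteq> i) \<or> (\<exists>k. \<iota> = (2, k) \<and> k < l)"
    if "\<iota> \<in> S" for \<iota>
    using that by (auto simp: S_def)
  have S_in: "k < i \<Longrightarrow> (0, k) \<in> S" "k < r \<Longrightarrow> k \<noteq> i \<Longrightarrow> (Suc 0, k) \<in> S" "k < l \<Longrightarrow> (2, k) \<in> S" for k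
    by (auto simp: S_def)
  have "cell_attached (quot_space 2 n r) (chart n r b)
    (\<Union>\<kappa>\<in>{\<kappa> \<in> chart_index n r. \<kappa> < (1, i, l)}. chart n r (std_basis \<kappa>)) (r - 1 + i + l)"
  proof (rule cell_attachedI[where S = S and g = g and \<Theta> = \<Theta> and s = s])
    show "finite S" by (simp add: S_def)
    have "card S = card ({0::nat} \<times> {..<i} \<union> {1} \<times> ({..<r} - {i})) + l"
      unfolding S_def by (subst card_Un_disjoint) (auto simp: card_cartesian_product)
    also have "card ({0::nat} \<times> {..<i} \<union> {1} \<times> ({..<r} - {i})) = i + card ({..<r} - {i})"
      by (subst card_Un_disjoint) (auto simp: card_cartesian_product)
    also have "card ({..<r} - {i}) = r - 1" using il by simp
    finally show "card S = r - 1 + i + l" by simp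
  next
    fix \<iota> assume \<iota>: "\<iota> \<in> S"
    have v: "continuous_map (chart_space n r b) euclidean (\<lambda>K. v K k)" if "k < r" for k
      unfolding v_def by (rule continuous_map_coord) (simp add: evec_vecs that)
    have e: "continuous_map (chart_space n r b) euclidean (\<lambda>K. e K k)" if "k < n" for k
      unfolding e_def using il that by (intro continuous_map_coord vecs_smul xvar_polys evec_vecs)
    from S_cases[OF \<iota>] show "continuous_map (chart_space n r b) euclidean (\<lambda>K. g K \<iota>)"
      using il by (elim disjE exE conjE)
        (simp_all add: g_def v e continuous_map_fst_euclidean continuous_map_snd_euclidean)
  next
    have sel: "continuous_map (homotopy_domain b) euclidean
        (\<lambda>x. complex_of_real (if Q then fst (fst x) else snd (fst x)))" for Q
      by (cases Q) (simp_all only: continuous_map_homotopy_domain if_True if_False)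
    show "continuous_map (homotopy_domain b) (chart_space n r b) (\<lambda>x. \<Theta> (fst (fst x)) (snd (fst x)) (snd x))"
      unfolding \<Theta>_def
    proof (rule continuous_map_point_of[OF bv commB \<Phi>\<Theta>])
      fix k assume k: "k < n"
      have e: "continuous_map (homotopy_domain b) euclidean (\<lambda>x. e (snd x) k)"
        unfolding e_def using il k by (intro continuous_map_homotopy_domain(3) vecs_smul xvar_polys evec_vecs)
      have w: "continuous_map (homotopy_domain b) euclidean (\<lambda>x. w (snd x))"
        unfolding w_def using il by (intro continuous_map_homotopy_domain(3) vecs_smul xvar_polys bv)
      have "continuous_map (homotopy_domain b) euclidean (\<lambda>x. \<alpha> (snd (fst x)) (snd x) k)"
      proof (cases "k = l")
        case False
        then show ?thesis
          unfolding \<alpha>_def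
          by (simp only: if_False)
            (intro continuous_map_euclidean_mult continuous_map_homotopy_domain continuous_map_fst_euclidean e)
      qed (simp add: \<alpha>_def)
      moreover have "continuous_map (homotopy_domain b) euclidean (\<lambda>x. \<beta> (fst (fst x)) (snd (fst x)) (snd x) k)"
      proof (cases "k = l")
        case False
        then show ?thesis
          unfolding \<beta>_def
          by (simp only: if_False) (intro continuous_map_euclidean_mult sel continuous_map_snd_euclidean e)
      qed (simp add: \<beta>_def)
      ultimately show "continuous_map (homotopy_domain b) euclidean (\<lambda>x. B (fst (fst x)) (snd (fst x)) (snd x) k)"
        unfolding B_def by (intro continuous_map_affine_mat continuous_map_sc2 continuous_map_homotopy_domain w)
    next
      fix k assume k: "k < r"
      have vk: "continuous_map (homotopy_domain b) euclidean (\<lambda>x. v (snd x) k)"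
        unfolding v_def by (rule continuous_map_homotopy_domain(3)) (simp add: evec_vecs k)
      show "continuous_map (homotopy_domain b) euclidean (\<lambda>x. u (fst (fst x)) (snd (fst x)) (snd x) k)"
      proof (cases "k = i")
        case False
        then show ?thesis
          unfolding u_def
          by (simp only: if_False)
            (intro continuous_map_euclidean_pair continuous_map_euclidean_mult sel continuous_map_homotopy_domain
              continuous_map_fst_euclidean continuous_map_snd_euclidean vk)
      qed (simp add: u_def)
    qed
  next
    have proj: "continuous_map (product_topology (\<lambda>_. euclidean) UNIV) euclidean
        (\<lambda>y. if Q then y \<iota> else (0::complex))" for Q and \<iota> :: "nat \<times> nat"
      by (cases Q) (auto intro: continuous_map_product_projection)
    show "continuous_map (product_topology (\<lambda>_. euclidean) UNIV) (chart_space n r b) s"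
      unfolding s_def
    proof (rule continuous_map_point_of[OF bv commBs \<Phi>s])
      fix k assume "k < n"
      show "continuous_map (product_topology (\<lambda>_. euclidean) UNIV) euclidean (\<lambda>y. Bs y k)"
        unfolding Bs_def using proj by (cases "k = l") (auto intro!: continuous_map_affine_mat)
    next
      fix k assume "k < r"
      show "continuous_map (product_topology (\<lambda>_. euclidean) UNIV) euclidean (\<lambda>y. us y k)"
        unfolding us_def using proj[of "k < i" "(0, k)"] proj[of True "(1, k)"]
        by (cases "k = i") (auto intro!: continuous_map_euclidean_pair)
    qed
  next
    fix K assume K: "K \<in> chart n r b"
    have "\<Theta> 1 1 K = point_of n r (\<lambda>k. affine_mat (fst (e K k)) (snd (e K k)) (w K)) (v K)"
      unfolding \<Theta>_def
    proof (rule point_of_cong)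
      show "B 1 1 K k = affine_mat (fst (e K k)) (snd (e K k)) (w K)" for k
        using e_l[OF K] by (simp add: B_def \<alpha>_def \<beta>_def sc_simps)
      show "u 1 1 K k = v K k" for k using v_i[OF K] by (simp add: u_def)
    qed
    then show "\<Theta> 1 1 K = K" using KA[OF K] by simp
  next
    fix a t K \<iota> assume K: "K \<in> chart n r b" and \<iota>: "\<iota> \<in> S"
    from S_cases[OF \<iota>] show "g (\<Theta> a t K) \<iota> = of_real a * g K \<iota>"
      using il by (auto simp: g_def v\<Theta> e\<Theta> u_def \<beta>_def)
  next
    fix a K assume K: "K \<in> chart n r b"
    show "\<Theta> a 0 K = s (\<lambda>\<iota>. if \<iota> \<in> S then of_real a * g K \<iota> else 0)"
      unfolding \<Theta>_def s_def
    proof (rule point_of_cong)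
      fix k assume "k < n"
      show "B a 0 K k = Bs (\<lambda>\<iota>. if \<iota> \<in> S then of_real a * g K \<iota> else 0) k"
        by (auto simp: B_def Bs_def \<alpha>_def \<beta>_def sc_simps S_def g_def)
    next
      fix k assume "k < r"
      then show "u a 0 K k = us (\<lambda>\<iota>. if \<iota> \<in> S then of_real a * g K \<iota> else 0) k"
        by (auto simp: u_def us_def S_def g_def)
    qed
  next
    fix y \<iota> assume \<iota>: "\<iota> \<in> S"
    from S_cases[OF \<iota>] show "g (s y) \<iota> = y \<iota>"
      using il by (auto simp: g_def vs es us_def)
  next
    fix K assume KC: "K \<in> chart n r b"
    interpret quotient_functional n r K "coord K b" b by (rule \<phi>[OF KC])
    have in_chart0: "K \<in> chart n r (std_basis (0, i', j')) \<longleftrightarrow> det2 (v K i') (v K j') \<noteq> 0"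
      if "i' < j'" "j' < r" for i' j'
      using in_quot_points quotient_basis_det[of "std_basis (0, i', j')"] that
      by (simp add: chart_def std_basis_def evec_vecs v_def)
    have in_chart1: "K \<in> chart n r (std_basis (Suc 0, i', l')) \<longleftrightarrow>
        det2 (v K i') (coord K b (smul (xvar l') (evec i'))) \<noteq> 0"
      if "i' < r" "l' < n" for i' l'
      using in_quot_points quotient_basis_det[of "std_basis (Suc 0, i', l')"] that
      by (simp add: chart_def std_basis_def evec_vecs v_def vecs_smul xvar_polys)
    show "K \<in> (\<Union>\<kappa>\<in>{\<kappa> \<in> chart_index n r. \<kappa> < (1, i, l)}. chart n r (std_basis \<kappa>)) \<longleftrightarrow> (\<exists>\<iota>\<in>S. g K \<iota> \<noteq> 0)"
      (is "?L \<longleftrightarrow> ?R")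
    proof
      assume ?L
      then obtain \<kappa> where \<kappa>: "\<kappa> \<in> chart_index n r" "\<kappa> < (1, i, l)" "K \<in> chart n r (std_basis \<kappa>)" by blast
      show ?R
      proof (rule ccontr)
        assume no: "\<not> ?R"
        have z0: "fst (v K k) = 0" if "k < i" for k
          using no S_in(1)[OF that] by (force simp: g_def)
        have z1: "snd (v K k) = 0" if "k < r" for k
        proof (cases "k = i")
          case False
          then show ?thesis using no S_in(2)[OF that] by (force simp: g_def)
        qed (simp add: v_i[OF KC])
        have z2: "snd (e K k) = 0" if "k < l" for k
          using no S_in(3)[OF that] by (force simp: g_def)
        consider i' j' where "\<kappa> = (0, i', j')" "i' < j'" "j' < r"
          | i' l' where "\<kappa> = (Suc 0, i', l')" "i' < i" "i' < r" "l' < n"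
          | l' where "\<kappa> = (Suc 0, i, l')" "l' < l" "l' < n"
          using \<kappa>(1,2) by (auto simp: chart_index_def le_less)
        then show False
        proof cases
          case 1
          then show ?thesis using \<kappa>(3) in_chart0[of i' j'] z1[of i'] z1[of j'] by (simp add: det2_def)
        next
          case 2
          then show ?thesis using \<kappa>(3) in_chart1[of i' l'] z0[of i'] z1[of i'] by (simp add: det2_def)
        next
          case 3
          then show ?thesis
            using \<kappa>(3) in_chart1[OF il(1), of l'] z2[of l'] v_i[OF KC] by (simp add: det2_def e_def)
        qed
      qed
    next
      assume ?R
      then obtain \<iota> where \<iota>: "\<iota> \<in> S" "g K \<iota> \<noteq> 0" by blast
      have idx0: "(0, i', j') \<in> chart_index n r" if "i' < j'" "j' < r" for i' j'
        using that by (simp add: chart_index_def)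
      have idx1: "(Suc 0, i', l') \<in> chart_index n r" if "i' < r" "l' < n" for i' l'
        using that by (simp add: chart_index_def)
      have "(\<exists>k<i. fst (v K k) \<noteq> 0) \<or> (\<exists>k<r. k \<noteq> i \<and> snd (v K k) \<noteq> 0) \<or> (\<exists>k<l. snd (e K k) \<noteq> 0)"
        using S_cases[OF \<iota>(1)] \<iota>(2) by (elim disjE exE conjE) (auto simp: g_def)
      \<comment> \<open>A nonzero second coordinate already gives a chart of two generators. The
        second case may therefore assume that none is left, so that \<open>v K k\<close> is a
        multiple of \<open>v K i\<close> and can replace it as cyclic vector.\<close>
      then consider k where "k < r" "k \<noteq> i" "snd (v K k) \<noteq> 0"
        | k where "\<forall>k<r. k \<noteq> i \<longrightarrow> snd (v K k) = 0" "k < i" "fst (v K k) \<noteq> 0"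
        | k where "k < l" "snd (e K k) \<noteq> 0"
        by blast
      then show ?L
      proof cases
        case 1
        have "det2 (v K k) (v K i) \<noteq> 0" "det2 (v K i) (v K k) \<noteq> 0"
          using 1 v_i[OF KC] by (simp_all add: det2_def)
        then show ?thesis
          using 1 il in_chart0[of k i] in_chart0[of i k] idx0[of k i] idx0[of i k]
          by (cases "k < i") (auto intro!: bexI[of _ "(0, k, i)"] bexI[of _ "(0, i, k)"])
      next
        case 2
        then have kr: "k < r" and sk: "snd (v K k) = 0" using il by simp_all
        have "det2 (v K k) (coord K b (smul (xvar l) (evec k))) = fst (v K k) * fst (v K k)"
          using matl[OF KC evec_vecs[OF kr]] sk by (simp add: v_def[symmetric] det2_def app_def sc_def)
        then have "det2 (v K k) (coord K b (smul (xvar l) (evec k))) \<noteq> 0" using 2 by simp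
        then show ?thesis
          using 2 il kr in_chart1[of k l] idx1[of k l] by (auto intro!: bexI[of _ "(Suc 0, k, l)"])
      next
        case 3
        then have "det2 (v K i) (coord K b (smul (xvar k) (evec i))) \<noteq> 0"
          using v_i[OF KC] by (simp add: det2_def e_def)
        then show ?thesis
          using 3 il in_chart1[of i k] idx1[of i k] by (auto intro!: bexI[of _ "(Suc 0, i, k)"])
      qed
    qed
  qed
  then show ?thesis by (simp add: b_def)
qed

end


section \<open>The Hilbert-Poincare series\<close>

text \<open>The double sum is the Gaussian binomial coefficient of \<open>Suc m\<close> over 2. In
  the induction the terms with the new largest \<open>j\<close> form a geometric sum times
  \<open>q ^ m\<close>. Since \<open>i < j\<close>, the subtraction in \<open>i + j - 1\<close>
  never truncates.\<close>

lemma sum_grassmannian: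
  fixes q :: "'a :: comm_ring_1"
  shows "(q - 1)^2 * (q + 1) * (\<Sum>j<Suc m. \<Sum>i<j. q ^ (i + j - 1)) = (q ^ Suc m - 1) * (q ^ m - 1)"
proof (induction m)
  case (Suc m)
  have "(\<Sum>i<Suc m. q ^ (i + Suc m - 1)) = q ^ m * (\<Sum>i<Suc m. q ^ i)"
    unfolding sum_distrib_left by (intro sum.cong) (simp_all add: power_add mult.commute)
  then have "(q - 1)^2 * (q + 1) * (\<Sum>i<Suc m. q ^ (i + Suc m - 1))
      = (q - 1) * (q + 1) * q ^ m * ((q - 1) * (\<Sum>i<Suc m. q ^ i))"
    by (simp add: power2_eq_square mult_ac)
  also have "(q - 1) * (\<Sum>i<Suc m. q ^ i) = q ^ Suc m - 1"
    by (rule power_diff_1_eq[symmetric])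
  finally have *: "(q - 1)^2 * (q + 1) * (\<Sum>i<Suc m. q ^ (i + Suc m - 1)) = (q - 1) * (q + 1) * q ^ m * (q ^ Suc m - 1)" .
  have "(q - 1)^2 * (q + 1) * (\<Sum>j<Suc (Suc m). \<Sum>i<j. q ^ (i + j - 1))
      = (q ^ Suc m - 1) * (q ^ m - 1) + (q - 1) * (q + 1) * q ^ m * (q ^ Suc m - 1)"
    unfolding sum.lessThan_Suc[of _ "Suc m"] distrib_left[of "(q - 1)^2 * (q + 1)"] Suc.IH * ..
  also have "\<dots> = (q ^ Suc (Suc m) - 1) * (q ^ Suc m - 1)"
    by (simp add: algebra_simps)
  finally show ?case .
qed simp

text \<open>A product of two geometric sums, the Poincare polynomials of projective spaces of
  dimensions \<open>r - 1\<close> and \<open>n - 1\<close>; the offset \<open>m\<close> becomes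
  \<open>r - 1\<close> in the application.\<close>

lemma sum_curvilinear:
  fixes q :: "'a :: comm_ring_1"
  shows "(q - 1)^2 * (\<Sum>i<r. \<Sum>l<n. q ^ (m + i + l)) = q ^ m * (q ^ r - 1) * (q ^ n - 1)"
proof -
  have "(\<Sum>i<r. \<Sum>l<n. q ^ (m + i + l)) = q ^ m * (\<Sum>i<r. q ^ i) * (\<Sum>l<n. q ^ l)"
    by (simp add: power_add sum_product sum_distrib_left mult_ac)
  then have "(q - 1)^2 * (\<Sum>i<r. \<Sum>l<n. q ^ (m + i + l))
      = q ^ m * ((q - 1) * (\<Sum>i<r. q ^ i)) * ((q - 1) * (\<Sum>l<n. q ^ l))"
    by (simp add: power2_eq_square mult_ac)
  then show ?thesis by (simp only: power_diff_1_eq)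
qed

definition codim :: "nat \<Rightarrow> nat \<times> nat \<times> nat \<Rightarrow> nat" where
  "codim r = (\<lambda>(\<tau>, i, j). if \<tau> = 0 then i + j - 1 else r - 1 + i + j)"

lemma finite_chart_index: "finite (chart_index n r)"
proof -
  have "chart_index n r \<subseteq> {0, 1} \<times> {..<r} \<times> ({..<r} \<union> {..<n})"
    by (auto simp: chart_index_def)
  then show ?thesis by (rule finite_subset) auto
qed

lemma sum_chart_index:
  fixes q :: "'a :: comm_ring_1"
  assumes "r \<ge> 1"
  shows "(q - 1)^2 * (q + 1) * (\<Sum>\<iota>\<in>chart_index n r. q ^ codim r \<iota>)
    = (q ^ r - 1) * (q ^ (n + r) + q ^ (n + r - 1) - q ^ r - 1)"
proof -
  obtain m where m: "r = Suc m" using assms by (cases r) auto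
  let ?P = "{(i, j). i < j \<and> j < r}"
  have "(\<Sum>\<iota>\<in>chart_index n r. q ^ codim r \<iota>)
      = (\<Sum>\<iota>\<in>{0} \<times> ?P. q ^ codim r \<iota>) + (\<Sum>\<iota>\<in>{1} \<times> {..<r} \<times> {..<n}. q ^ codim r \<iota>)"
    using finite_chart_index[of n r] unfolding chart_index_def
    by (intro sum.union_disjoint) auto
  also have "(\<Sum>\<iota>\<in>{0} \<times> ?P. q ^ codim r \<iota>) = (\<Sum>(j, i)\<in>Sigma {..<r} (\<lambda>j. {..<j}). q ^ (i + j - 1))"
    by (rule sum.reindex_bij_witness[of _ "\<lambda>(j, i). (0, i, j)" "\<lambda>(\<tau>, i, j). (j, i)"])
      (auto simp: codim_def)
  also have "\<dots> = (\<Sum>j<r. \<Sum>i<j. q ^ (i + j - 1))"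
    by (rule sum.Sigma[symmetric]) auto
  also have "(\<Sum>\<iota>\<in>{1} \<times> {..<r} \<times> {..<n}. q ^ codim r \<iota>) = (\<Sum>(i, l)\<in>{..<r} \<times> {..<n}. q ^ (m + i + l))"
    by (rule sum.reindex_bij_witness[of _ "\<lambda>(i, l). (1, i, l)" snd]) (auto simp: codim_def m)
  also have "\<dots> = (\<Sum>i<r. \<Sum>l<n. q ^ (m + i + l))"
    by (rule sum.cartesian_product[symmetric])
  finally have sum: "(\<Sum>\<iota>\<in>chart_index n r. q ^ codim r \<iota>)
      = (\<Sum>j<Suc m. \<Sum>i<j. q ^ (i + j - 1)) + (\<Sum>i<r. \<Sum>l<n. q ^ (m + i + l))"
    unfolding m .
  have "(q - 1)^2 * (q + 1) * (\<Sum>\<iota>\<in>chart_index n r. q ^ codim r \<iota>)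
      = (q - 1)^2 * (q + 1) * (\<Sum>j<Suc m. \<Sum>i<j. q ^ (i + j - 1))
        + (q + 1) * ((q - 1)^2 * (\<Sum>i<r. \<Sum>l<n. q ^ (m + i + l)))"
    unfolding sum by (simp only: distrib_left mult_ac)
  also have "\<dots> = (q ^ Suc m - 1) * (q ^ m - 1) + (q + 1) * (q ^ m * (q ^ r - 1) * (q ^ n - 1))"
    by (simp only: sum_grassmannian sum_curvilinear)
  also have "\<dots> = (q ^ r - 1) * (q ^ (n + r) + q ^ (n + r - 1) - q ^ r - 1)"
    by (simp add: m power_add algebra_simps)
  finally show ?thesis .
qed

lemma cell_attached_chart:
  assumes "\<iota> \<in> chart_index n r"
  shows "cell_attached (quot_space 2 n r) (chart n r (std_basis \<iota>))
    (\<Union>\<kappa>\<in>{\<kappa> \<in> chart_index n r. \<kappa> < \<iota>}. chart n r (std_basis \<kappa>)) (codim r \<iota>)"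
proof -
  obtain \<tau> i j where \<iota>: "\<iota> = (\<tau>, i, j)" by (cases \<iota>)
  from assms consider "\<tau> = 0" "i < j" "j < r" | "\<tau> = 1" "i < r" "j < n"
    by (auto simp: chart_index_def \<iota>)
  then show ?thesis
  proof cases
    case 1
    then show ?thesis using cell_attached_grassmannian[of i j r n] by (simp add: \<iota> codim_def)
  next
    case 2
    then show ?thesis using cell_attached_curvilinear[of i r j n] by (simp add: \<iota> codim_def)
  qed
qed

lemma abelian_rank_cohomology_quot_space:
  "abelian_rank (cohomology_group p (quot_space 2 n r)) = enat (card {\<iota> \<in> chart_index n r. 2 * codim r \<iota> = p})"
proof -
  note cell = cell_attached_chart[unfolded cell_attached_def]
  have "free_of_rank (homology_group (int q) (subtopology (quot_space 2 n r)
      (\<Union>\<iota>\<in>chart_index n r. chart n r (std_basis \<iota>)))) (card {\<iota> \<in> chart_index n r. 2 * codim r \<iota> = q})" for q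
    using cell by (intro free_of_rank_homology_charts finite_chart_index openin_chart) blast+
  then have "free_of_rank (homology_group (int q) (quot_space 2 n r))
      (card {\<iota> \<in> chart_index n r. 2 * codim r \<iota> = q})" for q
    by (simp flip: topspace_quot_space)
  then have "free_of_rank (cohomology_group p (quot_space 2 n r)) (card {\<iota> \<in> chart_index n r. 2 * codim r \<iota> = p})"
    by (rule free_of_rank_cohomology_group)
  then show ?thesis by (rule abelian_rank_free[OF comm_group_cohomology_group])
qed

theorem mainTheorem11:
  fixes n r :: nat
  assumes "n \<ge> 1" and "r \<ge> 1"
  shows "(\<forall>i. abelian_rank (cohomology_group i (quot_space 2 n r)) \<noteq> \<infinity>) \<and>
    Abs_fps (\<lambda>i. of_nat (the_enat (abelian_rank (cohomology_group i (quot_space 2 n r))))) =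
      (let q = (fps_X :: rat fps) ^ 2
       in ((q ^ r - 1) * (q ^ (n + r) + q ^ (n + r - 1) - q ^ r - 1)) / ((q - 1) ^ 2 * (q + 1)))"
proof -
  define q where "q = (fps_X :: rat fps) ^ 2"
  let ?P = "\<Sum>\<iota>\<in>chart_index n r. q ^ codim r \<iota>"
  have P: "Abs_fps (\<lambda>i. of_nat (the_enat (abelian_rank (cohomology_group i (quot_space 2 n r))))) = ?P"
  proof (rule fps_ext)
    fix i
    \<comment> \<open>As \<open>q\<close> is the square of the variable, a chart contributes the
      monomial of degree \<open>2 * codim r \<iota>\<close>.\<close>
    have "fps_nth ?P i = (\<Sum>\<iota>\<in>chart_index n r. if 2 * codim r \<iota> = i then 1 else 0)"
      unfolding q_def fps_sum_nth by (intro sum.cong) (auto simp flip: power_mult)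
    also have "\<dots> = of_nat (card {\<iota> \<in> chart_index n r. 2 * codim r \<iota> = i})"
      using finite_chart_index by (simp add: sum.If_cases Int_def)
    finally show "fps_nth (Abs_fps (\<lambda>i. of_nat (the_enat (abelian_rank (cohomology_group i (quot_space 2 n r)))))) i
        = fps_nth ?P i"
      by (simp add: abelian_rank_cohomology_quot_space)
  qed
  \<comment> \<open>The denominator has constant coefficient 1, so it is nonzero and the division of
    power series cancels it exactly.\<close>
  have "fps_nth ((q - 1)^2 * (q + 1)) 0 \<noteq> 0"
    by (simp add: q_def power2_eq_square)
  then have "(q - 1)^2 * (q + 1) \<noteq> 0" by fastforce
  then have "(q - 1)^2 * (q + 1) * ?P / ((q - 1)^2 * (q + 1)) = ?P"
    by (rule nonzero_mult_div_cancel_left)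
  then have "?P = ((q ^ r - 1) * (q ^ (n + r) + q ^ (n + r - 1) - q ^ r - 1)) / ((q - 1) ^ 2 * (q + 1))"
    unfolding sum_chart_index[OF assms(2)] by simp
  then show ?thesis
    unfolding P Let_def q_def[symmetric] by (simp add: abelian_rank_cohomology_quot_space)
qed

end
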